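(* There exists an absolute constant $c>0$ such that the following holds. Let $n\ge 3$, let $K$ be an origin symmetric convex body in $\mathbb{R}^n$ whose John ellipsoid is a Euclidean ball, and let $\varepsilon\in[0,1)$. If $\delta_{\rm vol}(K,W^n)\ge \varepsilon$, then $$\frac{S(K)^n}{V(K)^{n-1}}\le (1-\gamma\,\varepsilon^3)\,\frac{S(W^n)^n}{V(W^n)^{n-1}},\qquad\text{where } \gamma=n^{-cn^3}.$$
   Context: A convex body in $\mathbb{R}^n$ is a compact convex set with non-empty interior. $V(\cdot)$ denotes volume and $S(\cdot)$ surface area in $\mathbb{R}^n$. $W^n=[-1,1]^n$. The John ellipsoid of a convex body $K$ is the unique ellipsoid of maximal volume contained in $K$. For origin symmetric convex bodies $K,M$ in $\mathbb{R}^n$, put $\alpha=V(K)^{-1/n}$, $\beta=V(M)^{-1/n}$ and define $$\delta_{\rm vol}(K,M)=\min\{V(\Phi(\alpha K)\,\Delta\,(\beta M)):\Phi\in {\rm SL}(n)\},$$ where $\Delta$ denotes symmetric difference of sets and ${\rm SL}(n)$ is the group of linear transformations of $\mathbb{R}^n$ of determinant one. *)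

theory Defs
  imports
    "HOL-Analysis.Analysis"
    "HOL-Library.Function_Algebras"
    "Jordan_Normal_Form.Determinant"
begin

text \<open>
  Since the constant in the theorem does not depend on the dimension, all dimensions must live in
  one type. We use \<^const>\<open>Euclidean_space\<close>, whose points are the functions
  \<^typ>\<open>nat \<Rightarrow> real\<close> vanishing at all arguments \<open>\<ge> n\<close>, with the (subspace of the) product
  topology. Addition on functions is the pointwise one of \<^theory>\<open>HOL-Library.Function_Algebras\<close>;
  the following instance adds pointwise scaling.
\<close>

instantiation "fun" :: (type, real_vector) real_vector
begin

definition scaleR_fun :: "real \<Rightarrow> ('a \<Rightarrow> 'b) \<Rightarrow> 'a \<Rightarrow> 'b"
  where "scaleR_fun c f = (\<lambda>x. c *\<^sub>R f x)"

instance
  by standard (simp_all add: scaleR_fun_def fun_eq_iff scaleR_add_right scaleR_add_left)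

end

lemma scaleR_fun_apply [simp]: "(c *\<^sub>R f) x = c *\<^sub>R f x"
  by (simp add: scaleR_fun_def)

definition Eball :: "nat \<Rightarrow> (nat \<Rightarrow> real) \<Rightarrow> real \<Rightarrow> (nat \<Rightarrow> real) set"
  where "Eball n a r = {x \<in> topspace (Euclidean_space n). L2_set (x - a) {..<n} \<le> r}"

text \<open>The cube \<open>W\<^sup>n = [-1,1]\<^sup>n\<close>.\<close>

definition cube :: "nat \<Rightarrow> (nat \<Rightarrow> real) set"
  where "cube n = {x \<in> topspace (Euclidean_space n). \<forall>i<n. -1 \<le> x i \<and> x i \<le> 1}"

text \<open>
  Lebesgue (Borel) measure on \<open>\<real>\<^sup>n\<close>: the \<open>n\<close>-fold product of \<^const>\<open>lborel\<close>, transported from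
  extensional functions on \<open>{..<n}\<close> to functions extended by \<open>0\<close>.
\<close>

definition lebesgue_E :: "nat \<Rightarrow> (nat \<Rightarrow> real) measure"
  where "lebesgue_E n =
    distr (PiM {..<n} (\<lambda>_. lborel)) borel (\<lambda>x i. if i < n then x i else 0)"

definition vol :: "nat \<Rightarrow> (nat \<Rightarrow> real) set \<Rightarrow> real"
  where "vol n K = measure (lebesgue_E n) K"

definition convex_body :: "nat \<Rightarrow> (nat \<Rightarrow> real) set \<Rightarrow> bool"
  where "convex_body n K \<longleftrightarrow>
    compactin (Euclidean_space n) K \<and> convex K \<and> (Euclidean_space n) interior_of K \<noteq> {}"

definition origin_symmetric :: "(nat \<Rightarrow> real) set \<Rightarrow> bool"
  where "origin_symmetric K \<longleftrightarrow> uminus ` K = K"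

text \<open>
  Surface area of a convex body, as the derivative at \<open>0\<close> of the volume of the outer parallel body
  \<open>K + r B\<^sup>n\<close> (Minkowski).
\<close>

definition surface_area :: "nat \<Rightarrow> (nat \<Rightarrow> real) set \<Rightarrow> real"
  where "surface_area n K =
    Lim (at_right 0) (\<lambda>r. (vol n {x + y | x y. x \<in> K \<and> y \<in> Eball n 0 r} - vol n K) / r)"

text \<open>The linear map \<open>x \<mapsto> A x\<close>, on vectors represented as functions.\<close>

definition apply_mat :: "real mat \<Rightarrow> (nat \<Rightarrow> real) \<Rightarrow> nat \<Rightarrow> real"
  where "apply_mat A x =
    (\<lambda>i. if i < dim_row A then (\<Sum>j<dim_col A. A $$ (i, j) * x j) else 0)"

definition SL :: "nat \<Rightarrow> real mat set"
  where "SL n = {A \<in> carrier_mat n n. Determinant.det A = 1}"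

definition ellipsoid :: "nat \<Rightarrow> (nat \<Rightarrow> real) set \<Rightarrow> bool"
  where "ellipsoid n E \<longleftrightarrow>
    (\<exists>A \<in> carrier_mat n n. \<exists>a \<in> topspace (Euclidean_space n).
       Determinant.det A \<noteq> 0 \<and> E = (\<lambda>x. a + apply_mat A x) ` Eball n 0 1)"

text \<open>
  \<open>E\<close> is an ellipsoid of maximal volume contained in \<open>K\<close>. For a convex body there is exactly one,
  by John's theorem; uniqueness is not part of the definition.
\<close>

definition is_john_ellipsoid :: "nat \<Rightarrow> (nat \<Rightarrow> real) set \<Rightarrow> (nat \<Rightarrow> real) set \<Rightarrow> bool"
  where "is_john_ellipsoid n K E \<longleftrightarrow>
    ellipsoid n E \<and> E \<subseteq> K \<and> (\<forall>E'. ellipsoid n E' \<and> E' \<subseteq> K \<longrightarrow> vol n E' \<le> vol n E)"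

text \<open>
  The minimum over \<open>SL(n)\<close> is written as an infimum; for convex bodies it is attained.
\<close>

definition delta_vol :: "nat \<Rightarrow> (nat \<Rightarrow> real) set \<Rightarrow> (nat \<Rightarrow> real) set \<Rightarrow> real"
  where "delta_vol n K M =
    (let \<alpha> = vol n K powr (- 1 / real n); \<beta> = vol n M powr (- 1 / real n)
     in INF \<Phi> \<in> SL n.
          vol n (sym_diff (apply_mat \<Phi> ` ((\<lambda>x. \<alpha> *\<^sub>R x) ` K)) ((\<lambda>x. \<beta> *\<^sub>R x) ` M)))"

end

theory Submission
  imports Defs "HOL-Probability.Distributions" "HOL-Real_Asymp.Real_Asymp"
begin

text \<open>
  Let \<open>rB\<close> be the John ellipsoid of \<open>K\<close>; by symmetry of \<open>K\<close> its centre may be moved to the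
  origin. Since \<open>rB \<subseteq> K\<close>, the parallel body \<open>K + tB\<close> lies in \<open>(1 + t/r)K\<close>, so that
  \<open>S(K) \<le> n V(K) / r\<close>, with equality for the cube and \<open>r = 1\<close> (\<open>surface_area_le\<close>,
  \<open>surface_area_cube_ge\<close>). Hence the isoperimetric ratio of \<open>K\<close> is at most \<open>n\<^sup>n V(K/r)\<close>, that of
  the cube is at least \<open>n\<^sup>n 2\<^sup>n\<close>, and everything reduces to a stability version of Ball's bound
  \<open>V(K/r) \<le> 2\<^sup>n\<close> (\<open>volume_stability\<close>). From now on \<open>r = 1\<close>.

  By John's theorem there are unit vectors \<open>u\<^sub>i\<close> and weights \<open>c\<^sub>i > 0\<close> such that \<open>\<Sum> c\<^sub>i u\<^sub>i \<otimes> u\<^sub>i\<close> is the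
  identity and \<open>K\<close> is contained in all the slabs \<open>|\<langle>u\<^sub>i, x\<rangle>| \<le> 1\<close> (\<open>john_decomposition\<close>). Ball's bound is
  the geometric Brascamp--Lieb inequality for the indicator functions of these slabs. Here it is
  proved with an explicit deficit by Gaussian interpolation: put
  \<open>p(l, s) = \<integral> exp (l s y - l\<^sup>2 y\<^sup>2 / 2) dy\<close>, the integral being over \<open>[-1, 1]\<close>, and let \<open>\<Phi>(l)\<close> be the
  expectation of \<open>\<Prod> p(l, \<langle>u\<^sub>i, X\<rangle>)\<close>, the \<open>i\<close>-th factor raised to the power \<open>c\<^sub>i\<close>, for a standard
  Gaussian vector \<open>X\<close>. Then \<open>\<Phi>(0) = 2\<^sup>n\<close>, the lower limit of \<open>\<Phi>\<close> at infinity is at least \<open>V(K)\<close>,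
  and Gaussian integration by parts shows that \<open>\<Phi>'(l)\<close> is \<open>-l\<close> times the expectation of a
  nonnegative quantity: the squared distance of the vector of tilted means
  \<open>m\<^sub>i = \<partial>\<^sub>s ln p(l, \<langle>u\<^sub>i, X\<rangle>) / l\<close> from the range of \<open>x \<mapsto> (\<langle>u\<^sub>i, x\<rangle>)\<^sub>i\<close> (\<open>expect_flow_deriv\<close>). For small
  \<open>l\<close> the function \<open>m\<close> is strictly nonlinear, its third derivative having a negative mean; testing the
  distance against the cubes \<open>\<langle>u\<^sub>i, X\<rangle>\<^sup>3\<close> bounds it from below by a multiple of the frame defect
  \<open>F = \<Sum> c\<^sub>i c\<^sub>j (\<langle>u\<^sub>i, u\<^sub>j\<rangle>\<^sup>2 - \<langle>u\<^sub>i, u\<^sub>j\<rangle>\<^sup>4)\<close>. The outcome is \<open>V(K) \<le> 2\<^sup>n (1 - gain \<cdot> F)\<close>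
  (\<open>vol_le_frame_defect\<close>).

  If \<open>F\<close> is at least a suitable multiple of \<open>\<epsilon>\<close>, this is the claim. Otherwise most of the inner products
  \<open>\<langle>u\<^sub>i, u\<^sub>j\<rangle>\<close> are close to \<open>0\<close> or \<open>\<plusminus>1\<close>, and an averaging argument selects \<open>n\<close> almost orthonormal contact
  vectors (\<open>almost_orthonormal_subfamily\<close>). Their slabs cut out a parallelotope that contains \<open>K\<close> and
  has volume only slightly larger than \<open>2\<^sup>n\<close>. If also \<open>V(K)\<close> were close to \<open>2\<^sup>n\<close>, then \<open>K\<close> would nearly
  fill this parallelotope and \<open>\<delta>\<^sub>v\<^sub>o\<^sub>l(K, W\<^sup>n) < \<epsilon>\<close> (\<open>delta_vol_cube_le\<close>), a contradiction.
  This gives a deficit linear in \<open>\<epsilon>\<close>, and \<open>\<epsilon>\<^sup>3 \<le> \<epsilon>\<close>.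
\<close>

section \<open>Lebesgue measure under linear maps\<close>

abbreviation Espace :: "nat \<Rightarrow> (nat \<Rightarrow> real) set"
  where "Espace n \<equiv> {x. \<forall>i\<ge>n. x i = 0}"

abbreviation PiL :: "nat \<Rightarrow> (nat \<Rightarrow> real) measure"
  where "PiL n \<equiv> PiM {..<n} (\<lambda>_. lborel)"

text \<open>
  Points of the product measure are extensional functions, whose value outside \<open>{..<n}\<close> is
  \<open>undefined\<close>; \<open>pad\<close> carries them to the points of \<open>Espace n\<close>.
\<close>

definition pad :: "nat \<Rightarrow> (nat \<Rightarrow> real) \<Rightarrow> nat \<Rightarrow> real"
  where "pad n x = (\<lambda>i. if i < n then x i else 0)"

lemma product_sigma_finite_lborel: "product_sigma_finite (\<lambda>_::nat. lborel :: real measure)"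
  by standard

lemma measurable_pad [measurable]: "pad n \<in> borel_measurable (PiL n)"
proof (rule measurable_coordinatewise_then_product)
  fix i show "(\<lambda>x. pad n x i) \<in> borel_measurable (PiL n)"
  proof (cases "i < n")
    case True
    then have "(\<lambda>x. x i) \<in> measurable (PiL n) lborel"
      by (intro measurable_component_singleton) simp
    with True show ?thesis by (simp add: pad_def)
  qed (simp add: pad_def)
qed

lemma measurable_coord [measurable]: "(\<lambda>x::nat \<Rightarrow> real. x i) \<in> borel_measurable borel"
  by (intro borel_measurable_continuous_onI) simp

lemma lebesgue_E_eq: "lebesgue_E n = distr (PiL n) borel (pad n)"
  by (simp add: lebesgue_E_def pad_def[abs_def])

lemma sets_lebesgue_E [measurable_cong, simp]: "sets (lebesgue_E n) = sets borel"
  by (simp add: lebesgue_E_def)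

lemma space_lebesgue_E [simp]: "space (lebesgue_E n) = UNIV"
  by (simp add: lebesgue_E_def)

lemma nn_integral_lebesgue_E:
  assumes [measurable]: "f \<in> borel_measurable borel"
  shows "(\<integral>\<^sup>+x. f x \<partial>lebesgue_E n) = (\<integral>\<^sup>+x. f (pad n x) \<partial>PiL n)"
  unfolding lebesgue_E_eq by (subst nn_integral_distr) auto

lemma pad_in_Espace [simp]: "pad n x \<in> Espace n"
  by (simp add: pad_def)

lemma borel_Espace [measurable]: "Espace n \<in> sets borel"
proof -
  have "Espace n = (\<Inter>i\<in>{n..}. {x. x i = 0})" by auto
  also have "\<dots> \<in> sets borel"
    by (intro sets.countable_INT'') auto
  finally show ?thesis .
qed

lemma AE_lebesgue_E_Espace: "AE x in lebesgue_E n. x \<in> Espace n"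
  unfolding lebesgue_E_eq by (subst AE_distr_iff) (auto simp: pad_def)

lemma borel_measurable_apply_mat [measurable]: "apply_mat A \<in> borel_measurable borel"
proof (rule measurable_coordinatewise_then_product)
  fix i show "(\<lambda>x. apply_mat A x i) \<in> borel_measurable borel"
    by (cases "i < dim_row A") (auto simp: apply_mat_def)
qed

lemma apply_mat_in_Espace: "A \<in> carrier_mat n n \<Longrightarrow> apply_mat A x \<in> Espace n"
  by (auto simp: apply_mat_def)

lemma apply_mat_mult:
  assumes "A \<in> carrier_mat n n" "B \<in> carrier_mat n n"
  shows "apply_mat (A * B) x = apply_mat A (apply_mat B x)"
proof
  fix i
  show "apply_mat (A * B) x i = apply_mat A (apply_mat B x) i"
  proof (cases "i < n")
    case True
    have "apply_mat (A * B) x i = (\<Sum>j<n. (\<Sum>k<n. A $$ (i,k) * B $$ (k,j)) * x j)"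
      using assms True by (auto simp: apply_mat_def scalar_prod_def atLeast0LessThan intro!: sum.cong)
    also have "\<dots> = (\<Sum>k<n. A $$ (i,k) * (\<Sum>j<n. B $$ (k,j) * x j))"
      by (simp add: sum_distrib_left sum_distrib_right mult.assoc) (rule sum.swap)
    also have "\<dots> = apply_mat A (apply_mat B x) i"
      using assms True by (auto simp: apply_mat_def)
    finally show ?thesis .
  qed (use assms in \<open>auto simp: apply_mat_def\<close>)
qed

lemma apply_mat_one:
  assumes "x \<in> Espace n"
  shows "apply_mat (1\<^sub>m n) x = x"
proof
  fix i show "apply_mat (1\<^sub>m n) x i = x i"
  proof (cases "i < n")
    case True
    then show ?thesis
      by (simp add: apply_mat_def mult_delta_left)
  qed (use assms in \<open>auto simp: apply_mat_def\<close>)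
qed

text \<open>
  The identity matrix with row \<open>k\<close> replaced by \<open>a\<close>. These matrices generate all invertible ones, and
  each of them changes a single coordinate, so that the change of variables is one-dimensional.
\<close>

definition row_mat :: "nat \<Rightarrow> nat \<Rightarrow> (nat \<Rightarrow> real) \<Rightarrow> real mat"
  where "row_mat n k a = mat n n (\<lambda>(i,j). if i = k then a j else if i = j then 1 else 0)"

lemma row_mat_carrier [simp]: "row_mat n k a \<in> carrier_mat n n"
  by (simp add: row_mat_def)

lemma apply_row_mat:
  assumes "x \<in> Espace n" "k < n"
  shows "apply_mat (row_mat n k a) x = x(k := \<Sum>j<n. a j * x j)"
proof
  fix i show "apply_mat (row_mat n k a) x i = (x(k := \<Sum>j<n. a j * x j)) i"
  proof (cases "i < n \<and> i \<noteq> k")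
    case True
    then show ?thesis
      by (simp add: apply_mat_def row_mat_def mult_delta_left)
  next
    case False
    then consider "i = k" | "i \<noteq> k" "i \<ge> n" by linarith
    then show ?thesis
    proof cases
      case 1
      then show ?thesis using assms(2) by (simp add: apply_mat_def row_mat_def)
    next
      case 2
      then show ?thesis using assms by (simp add: apply_mat_def row_mat_def)
    qed
  qed
qed

text \<open>
  In the Leibniz formula a permutation other than the identity moves some \<open>i \<noteq> k\<close>, where the row is a
  unit vector; only the identity contributes.
\<close>

lemma det_row_mat:
  assumes "k < n"
  shows "Determinant.det (row_mat n k a) = a k"
proof -
  have "Determinant.det (row_mat n k a) =
      (\<Sum> p \<in> {p. p permutes {0 ..< n}}. signof p * (\<Prod> i = 0 ..< n. row_mat n k a $$ (i, p i)))"
    by (rule det_def'[OF row_mat_carrier])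
  also have "\<dots> = (\<Sum> p \<in> {p. p permutes {0 ..< n}}. if p = id then a k else 0)"
  proof (rule sum.cong[OF refl])
    fix p assume "p \<in> {p. p permutes {0 ..< n}}"
    then have p: "p permutes {0 ..< n}" by simp
    show "signof p * (\<Prod> i = 0 ..< n. row_mat n k a $$ (i, p i)) = (if p = id then a k else 0)"
    proof (cases "p = id")
      case True
      have "(\<Prod> i = 0 ..< n. row_mat n k a $$ (i, i)) = (\<Prod> i = 0 ..< n. if i = k then a k else 1)"
        by (intro prod.cong) (auto simp: row_mat_def)
      with True assms show ?thesis by simp
    next
      case False
      have "\<exists>i<n. i \<noteq> k \<and> p i \<noteq> i"
      proof (rule ccontr)
        assume *: "\<not> ?thesis"
        have "p i = i" for i
        proof (cases "i = k")
          case True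
          have "p k = k"
          proof (rule ccontr)
            assume ne: "p k \<noteq> k"
            have "p k < n" using p assms by (metis atLeastLessThan_iff permutes_in_image zero_le)
            then have "p (p k) = p k" using * ne by blast
            then have "p k = k" using permutes_inj[OF p] by (meson injD)
            with ne show False by simp
          qed
          with True show ?thesis by simp
        next
          case False
          then show ?thesis using * p by (metis atLeastLessThan_iff permutes_not_in)
        qed
        with False show False by auto
      qed
      then obtain i where i: "i < n" "i \<noteq> k" "p i \<noteq> i" by auto
      have "p i < n" using p i(1) by (metis atLeastLessThan_iff permutes_in_image zero_le)
      then have "row_mat n k a $$ (i, p i) = 0" using i by (auto simp: row_mat_def)
      then have "(\<Prod> i = 0 ..< n. row_mat n k a $$ (i, p i)) = 0"
        using i by (intro prod_zero) auto
      with False show ?thesis by simp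
    qed
  qed
  also have "\<dots> = a k"
    by (simp add: sum.delta' finite_permutations permutes_id)
  finally show ?thesis .
qed

text \<open>
  The change of variables formula for \<open>A\<close>, as a property that can be propagated along products.
\<close>

definition transforms_volume :: "nat \<Rightarrow> real mat \<Rightarrow> bool"
  where "transforms_volume n A \<longleftrightarrow> (\<forall>f \<in> borel_measurable borel.
     ennreal \<bar>Determinant.det A\<bar> * (\<integral>\<^sup>+x. f (apply_mat A x) \<partial>lebesgue_E n) = (\<integral>\<^sup>+x. f x \<partial>lebesgue_E n))"

lemma transforms_volume_mult:
  assumes "A \<in> carrier_mat n n" "B \<in> carrier_mat n n"
    and "transforms_volume n A" "transforms_volume n B"
  shows "transforms_volume n (A * B)"
  unfolding transforms_volume_def
proof
  fix f :: "(nat \<Rightarrow> real) \<Rightarrow> ennreal" assume [measurable]: "f \<in> borel_measurable borel"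
  have "(\<lambda>x. f (apply_mat A x)) \<in> borel_measurable borel" by measurable
  then have "ennreal \<bar>Determinant.det B\<bar> * (\<integral>\<^sup>+x. f (apply_mat A (apply_mat B x)) \<partial>lebesgue_E n)
      = (\<integral>\<^sup>+x. f (apply_mat A x) \<partial>lebesgue_E n)"
    using assms(4)[unfolded transforms_volume_def, rule_format, of "\<lambda>x. f (apply_mat A x)"] by simp
  moreover have "ennreal \<bar>Determinant.det A\<bar> * (\<integral>\<^sup>+x. f (apply_mat A x) \<partial>lebesgue_E n) = (\<integral>\<^sup>+x. f x \<partial>lebesgue_E n)"
    using assms(3) unfolding transforms_volume_def by simp
  ultimately show "ennreal \<bar>Determinant.det (A * B)\<bar> * (\<integral>\<^sup>+x. f (apply_mat (A * B) x) \<partial>lebesgue_E n) = (\<integral>\<^sup>+x. f x \<partial>lebesgue_E n)"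
    by (simp add: det_mult[OF assms(1,2)] apply_mat_mult[OF assms(1,2)] abs_mult ennreal_mult mult.assoc)
qed

text \<open>
  By Fubini the coordinate \<open>k\<close> is integrated first, and in that coordinate the map is the affine
  function \<open>y \<mapsto> b + a\<^sub>k y\<close>.
\<close>

lemma transforms_volume_row_mat:
  assumes k: "k < n" and ak: "a k \<noteq> 0"
  shows "transforms_volume n (row_mat n k a)"
  unfolding transforms_volume_def
proof
  fix f :: "(nat \<Rightarrow> real) \<Rightarrow> ennreal" assume [measurable]: "f \<in> borel_measurable borel"
  interpret product_sigma_finite "\<lambda>_::nat. lborel :: real measure" by (rule product_sigma_finite_lborel)
  define I where "I = {..<n} - {k}"
  have I: "finite I" "k \<notin> I" "insert k I = {..<n}" using k by (auto simp: I_def)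
  let ?T = "apply_mat (row_mat n k a)"
  have T: "?T (pad n (x(k := y))) = pad n (x(k := (\<Sum>j\<in>I. a j * x j) + a k * y))" for x y
  proof -
    have "?T (pad n (x(k := y))) = (pad n (x(k := y)))(k := \<Sum>j<n. a j * pad n (x(k := y)) j)"
      using k by (intro apply_row_mat) (auto simp: pad_def)
    also have "(\<Sum>j<n. a j * pad n (x(k := y)) j) = (\<Sum>j\<in>I. a j * x j) + a k * y"
      unfolding I(3)[symmetric] using I(1,2) k
      by (subst sum.insert) (auto simp: pad_def I_def intro!: sum.cong)
    also have "(pad n (x(k := y)))(k := (\<Sum>j\<in>I. a j * x j) + a k * y) = pad n (x(k := (\<Sum>j\<in>I. a j * x j) + a k * y))"
      using k by (auto simp: pad_def fun_eq_iff)
    finally show ?thesis .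
  qed
  have mT: "(\<lambda>x. f (?T (pad n x))) \<in> borel_measurable (PiM (insert k I) (\<lambda>_. lborel))"
    and mf: "(\<lambda>x. f (pad n x)) \<in> borel_measurable (PiM (insert k I) (\<lambda>_. lborel))"
    unfolding I(3) by measurable
  have m1: "(\<lambda>y. f (pad n (x(k := y)))) \<in> borel_measurable borel" if "x \<in> space (PiM I (\<lambda>_. lborel))" for x
    using measurable_comp[OF measurable_component_update mf, OF that I(2)] by (simp add: comp_def fun_upd_def)
  have "ennreal \<bar>a k\<bar> * (\<integral>\<^sup>+x. f (?T x) \<partial>lebesgue_E n)
      = ennreal \<bar>a k\<bar> * (\<integral>\<^sup>+ x. (\<integral>\<^sup>+ y. f (?T (pad n (x(k := y)))) \<partial>lborel) \<partial>(PiM I (\<lambda>_. lborel)))"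
    by (subst nn_integral_lebesgue_E) (simp_all only: I(3)[symmetric] product_nn_integral_insert[OF I(1,2) mT], measurable)
  also have "\<dots> = (\<integral>\<^sup>+ x. ennreal \<bar>a k\<bar> * (\<integral>\<^sup>+ y. f (?T (pad n (x(k := y)))) \<partial>lborel) \<partial>(PiM I (\<lambda>_. lborel)))"
  proof (rule nn_integral_cmult[symmetric])
    have "(\<lambda>p. f (?T (pad n ((fst p)(k := snd p))))) \<in> borel_measurable (PiM I (\<lambda>_. lborel) \<Otimes>\<^sub>M lborel)"
      using measurable_comp[OF measurable_add_dim mT] by (simp add: comp_def case_prod_beta')
    then show "(\<lambda>x. \<integral>\<^sup>+ y. f (?T (pad n (x(k := y)))) \<partial>lborel) \<in> borel_measurable (PiM I (\<lambda>_. lborel))"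
      by (intro lborel.borel_measurable_nn_integral) (simp add: case_prod_beta')
  qed
  also have "\<dots> = (\<integral>\<^sup>+ x. (\<integral>\<^sup>+ y. f (pad n (x(k := y))) \<partial>lborel) \<partial>(PiM I (\<lambda>_. lborel)))"
  proof (rule nn_integral_cong)
    fix x :: "nat \<Rightarrow> real" assume x: "x \<in> space (PiM I (\<lambda>_. lborel))"
    show "ennreal \<bar>a k\<bar> * (\<integral>\<^sup>+ y. f (?T (pad n (x(k := y)))) \<partial>lborel) = (\<integral>\<^sup>+ y. f (pad n (x(k := y))) \<partial>lborel)"
      unfolding T using nn_integral_real_affine[OF m1[OF x] ak, of "\<Sum>j\<in>I. a j * x j"] by simp
  qed
  also have "\<dots> = (\<integral>\<^sup>+x. f x \<partial>lebesgue_E n)"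
    by (subst nn_integral_lebesgue_E) (simp_all only: I(3)[symmetric] product_nn_integral_insert[OF I(1,2) mf], measurable)
  finally show "ennreal \<bar>Determinant.det (row_mat n k a)\<bar> * (\<integral>\<^sup>+x. f (?T x) \<partial>lebesgue_E n) = (\<integral>\<^sup>+x. f x \<partial>lebesgue_E n)"
    by (simp add: det_row_mat[OF k])
qed

lemma mult_row_mat_index:
  assumes "A \<in> carrier_mat n n" "i < n" "j < n" "k < n"
  shows "(A * row_mat n k b) $$ (i,j) = A $$ (i,k) * b j + (if j = k then 0 else A $$ (i,j))"
proof -
  have "(A * row_mat n k b) $$ (i,j) = (\<Sum>l<n. A $$ (i,l) * (if l = k then b j else if l = j then 1 else 0))"
    using assms by (auto simp: scalar_prod_def row_mat_def atLeast0LessThan intro!: sum.cong)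
  also have "\<dots> = A $$ (i,k) * b j + (\<Sum>l\<in>{..<n}-{k}. A $$ (i,l) * (if l = j then 1 else 0))"
    using assms(4) by (subst sum.remove[of _ k]) (auto intro!: sum.cong)
  also have "(\<Sum>l\<in>{..<n}-{k}. A $$ (i,l) * (if l = j then 1 else 0)) = (if j = k then 0 else A $$ (i,j))"
    using assms(3) by (simp add: mult_delta_right)
  finally show ?thesis .
qed

lemma row_mat_index:
  "i < n \<Longrightarrow> j < n \<Longrightarrow> row_mat n k a $$ (i,j) = (if i = k then a j else if i = j then 1 else 0)"
  by (simp add: row_mat_def)

lemma transforms_volume_one: "transforms_volume n (1\<^sub>m n)"
  unfolding transforms_volume_def
proof
  fix f :: "(nat \<Rightarrow> real) \<Rightarrow> ennreal" assume "f \<in> borel_measurable borel"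
  have "(\<integral>\<^sup>+x. f (apply_mat (1\<^sub>m n) x) \<partial>lebesgue_E n) = (\<integral>\<^sup>+x. f x \<partial>lebesgue_E n)"
    using AE_lebesgue_E_Espace[of n] by (intro nn_integral_cong_AE) (auto elim!: eventually_mono simp: apply_mat_one)
  then show "ennreal \<bar>Determinant.det (1\<^sub>m n)\<bar> * (\<integral>\<^sup>+x. f (apply_mat (1\<^sub>m n) x) \<partial>lebesgue_E n) = (\<integral>\<^sup>+x. f x \<partial>lebesgue_E n)"
    by simp
qed

text \<open>
  Elimination, by downward induction on the number \<open>k\<close> of leading rows that agree with those of the
  identity. If the pivot \<open>A\<^sub>k\<^sub>k\<close> is nonzero, then \<open>A = (A B) T\<close>, where \<open>T\<close> carries row \<open>k\<close> of \<open>A\<close>,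
  \<open>B\<close> is its inverse, and \<open>A B\<close> has one more unit row. If the pivot vanishes, \<open>det A \<noteq> 0\<close> provides
  a nonzero entry \<open>A\<^sub>k\<^sub>j\<close> with \<open>j > k\<close>, and adding column \<open>j\<close> to column \<open>k\<close> produces a pivot.
\<close>

lemma transforms_volume_by_rows:
  assumes "k \<le> n"
  shows "A \<in> carrier_mat n n \<Longrightarrow> Determinant.det A \<noteq> 0 \<Longrightarrow>
    (\<And>i j. i < k \<Longrightarrow> j < n \<Longrightarrow> A $$ (i,j) = (if i = j then 1 else 0)) \<Longrightarrow> transforms_volume n A"
  using assms
proof (induction k arbitrary: A rule: inc_induct)
  case base
  then have "A = 1\<^sub>m n" by (intro eq_matI) auto
  then show ?case by (simp add: transforms_volume_one)
next
  case (step k)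
  note A = step.prems(1) and det = step.prems(2) and rows = step.prems(3)
  have k: "k < n" using step by simp
  have pivot: "transforms_volume n A"
    if A: "A \<in> carrier_mat n n" and det: "Determinant.det A \<noteq> 0" and akk: "A $$ (k,k) \<noteq> 0"
      and rows: "\<And>i j. i < k \<Longrightarrow> j < n \<Longrightarrow> A $$ (i,j) = (if i = j then 1 else 0)" for A
  proof -
    define T where "T = row_mat n k (\<lambda>j. A $$ (k,j))"
    define b where "b = (\<lambda>j. if j = k then 1 / A $$ (k,k) else - A $$ (k,j) / A $$ (k,k))"
    define B where "B = row_mat n k b"
    have TB: "T \<in> carrier_mat n n" "B \<in> carrier_mat n n" by (auto simp: T_def B_def)
    have "B * T = 1\<^sub>m n"
    proof (rule eq_matI)
      fix i j assume "i < dim_row (1\<^sub>m n)" "j < dim_col (1\<^sub>m n)"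
      then have ij: "i < n" "j < n" by auto
      have "(B * T) $$ (i,j) = B $$ (i,k) * A $$ (k,j) + (if j = k then 0 else B $$ (i,j))"
        unfolding T_def using TB ij k by (intro mult_row_mat_index) auto
      then show "(B * T) $$ (i,j) = 1\<^sub>m n $$ (i,j)"
        using ij k akk by (auto simp: B_def row_mat_index b_def)
    qed (use TB in auto)
    then have "A = (A * B) * T" using A TB by (metis assoc_mult_mat right_mult_one_mat)
    moreover have "transforms_volume n (A * B)"
    proof (rule step.IH)
      show "A * B \<in> carrier_mat n n" using A TB by auto
      show "Determinant.det (A * B) \<noteq> 0"
        unfolding det_mult[OF A TB(2)] using det akk k by (simp add: B_def det_row_mat b_def)
    next
      fix i j assume ij: "i < Suc k" "j < n"
      have "(A * B) $$ (i,j) = A $$ (i,k) * b j + (if j = k then 0 else A $$ (i,j))"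
        unfolding B_def using A ij k by (intro mult_row_mat_index) auto
      then show "(A * B) $$ (i,j) = (if i = j then 1 else 0)"
        using ij k akk rows by (auto simp: b_def less_Suc_eq)
    qed
    moreover have "transforms_volume n T"
      unfolding T_def using k akk by (intro transforms_volume_row_mat)
    ultimately show ?thesis using A TB by (metis mult_carrier_mat transforms_volume_mult)
  qed
  have "\<exists>j. k \<le> j \<and> j < n \<and> A $$ (k,j) \<noteq> 0"
  proof (rule ccontr)
    assume no: "\<not> ?thesis"
    have "(\<Prod> i = 0 ..< n. A $$ (i, p i)) = 0" if p: "p permutes {0..<n}" for p
    proof -
      have pn: "p i < n" if "i < n" for i using p that by (metis atLeastLessThan_iff permutes_in_image zero_le)
      have "\<exists>i<n. A $$ (i, p i) = 0"
      proof (cases "\<exists>i<k. p i \<noteq> i")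
        case True
        then obtain i where "i < k" "p i \<noteq> i" by auto
        then show ?thesis using rows[of i "p i"] pn[of i] k by (intro exI[of _ i]) auto
      next
        case False
        have "p k \<ge> k"
        proof (rule ccontr)
          assume "\<not> k \<le> p k"
          then have "p (p k) = p k" using False by auto
          then have "p k = k" using permutes_inj[OF p] by (meson injD)
          with \<open>\<not> k \<le> p k\<close> show False by simp
        qed
        then show ?thesis using no pn[OF k] k by blast
      qed
      then show ?thesis by (intro prod_zero) auto
    qed
    then have "Determinant.det A = 0"
      unfolding det_def'[OF A] by (intro sum.neutral ballI) (metis mult_zero_right mem_Collect_eq)
    with det show False by simp
  qed
  then obtain j where j: "k \<le> j" "j < n" "A $$ (k,j) \<noteq> 0" by auto
  show ?case
  proof (cases "A $$ (k,k) = 0")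
    case False
    then show ?thesis using pivot[OF A det _ rows] by auto
  next
    case True
    with j have kj: "k < j" by (cases "k = j") auto
    \<comment> \<open>Right multiplication by \<open>S\<close> adds column \<open>j\<close> to column \<open>k\<close>; \<open>S'\<close> is the inverse of \<open>S\<close>.\<close>
    define S where "S = row_mat n j (\<lambda>l. if l = k \<or> l = j then 1 else 0)"
    define S' where "S' = row_mat n j (\<lambda>l. if l = j then 1 else if l = k then -1 else 0)"
    have SS: "S \<in> carrier_mat n n" "S' \<in> carrier_mat n n" by (auto simp: S_def S'_def)
    have "S * S' = 1\<^sub>m n"
    proof (rule eq_matI)
      fix i l assume "i < dim_row (1\<^sub>m n)" "l < dim_col (1\<^sub>m n)"
      then have il: "i < n" "l < n" by auto
      have "(S * S') $$ (i,l) = S $$ (i,j) * (if l = j then 1 else if l = k then -1 else 0) + (if l = j then 0 else S $$ (i,l))"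
        unfolding S'_def using SS il j by (intro mult_row_mat_index) auto
      then show "(S * S') $$ (i,l) = 1\<^sub>m n $$ (i,l)"
        using il j by (auto simp: S_def row_mat_index)
    qed (use SS in auto)
    then have eq: "A = (A * S) * S'" using A SS by (metis assoc_mult_mat right_mult_one_mat)
    have AS: "(A * S) $$ (i,l) = A $$ (i,j) * (if l = k \<or> l = j then 1 else 0) + (if l = j then 0 else A $$ (i,l))"
      if "i < n" "l < n" for i l
      unfolding S_def using A that j by (intro mult_row_mat_index) auto
    have "transforms_volume n (A * S)"
    proof (rule pivot)
      show "A * S \<in> carrier_mat n n" using A SS by auto
      show "Determinant.det (A * S) \<noteq> 0"
        unfolding det_mult[OF A SS(1)] using det j by (simp add: S_def det_row_mat)
      show "(A * S) $$ (k, k) \<noteq> 0" using AS[OF k k] True j kj by simp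
    next
      fix i l assume il: "i < k" "l < n"
      show "(A * S) $$ (i,l) = (if i = l then 1 else 0)"
        using AS[of i l] rows[OF il] rows[of i j] il kj j k by auto
    qed
    moreover have "transforms_volume n S'"
      unfolding S'_def using j by (intro transforms_volume_row_mat) auto
    ultimately show ?thesis using A SS eq by (metis mult_carrier_mat transforms_volume_mult)
  qed
qed

theorem transforms_volume_det:
  "A \<in> carrier_mat n n \<Longrightarrow> Determinant.det A \<noteq> 0 \<Longrightarrow> transforms_volume n A"
  using transforms_volume_by_rows[of 0 n A] by auto

lemma mat_inverse_exists:
  fixes A :: "real mat"
  assumes A: "A \<in> carrier_mat n n" and "Determinant.det A \<noteq> 0"
  obtains B where "B \<in> carrier_mat n n" "A * B = 1\<^sub>m n" "B * A = 1\<^sub>m n"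
  using det_non_zero_imp_unit[OF assms, of "()"] by (auto simp: Units_def ring_mat_def)

lemma apply_mat_image_eq:
  assumes A: "A \<in> carrier_mat n n" and B: "B \<in> carrier_mat n n" and AB: "A * B = 1\<^sub>m n" "B * A = 1\<^sub>m n"
    and S: "S \<subseteq> Espace n"
  shows "apply_mat A ` S = {y \<in> Espace n. apply_mat B y \<in> S}"
proof safe
  fix x assume "x \<in> S"
  with S show "apply_mat B (apply_mat A x) \<in> S"
    by (simp flip: apply_mat_mult[OF B A] add: AB apply_mat_one subset_eq)
next
  fix y assume "\<forall>i\<ge>n. y i = 0" "apply_mat B y \<in> S"
  then show "y \<in> apply_mat A ` S"
    by (intro image_eqI[of _ _ "apply_mat B y"]) (simp_all flip: apply_mat_mult[OF A B] add: AB apply_mat_one)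
next
  fix x i assume "x \<in> S" "n \<le> i"
  then show "apply_mat A x i = 0" using apply_mat_in_Espace[OF A, of x] by auto
qed

lemma borel_apply_mat_image:
  assumes A: "A \<in> carrier_mat n n" and det: "Determinant.det A \<noteq> 0"
    and S[measurable]: "S \<in> sets borel" and sub: "S \<subseteq> Espace n"
  shows "apply_mat A ` S \<in> sets borel"
proof -
  obtain B where B: "B \<in> carrier_mat n n" "A * B = 1\<^sub>m n" "B * A = 1\<^sub>m n"
    by (rule mat_inverse_exists[OF A det])
  have "{y \<in> space borel. apply_mat B y \<in> S} \<in> sets borel" by measurable
  moreover have "apply_mat A ` S = Espace n \<inter> {y \<in> space borel. apply_mat B y \<in> S}"
    unfolding apply_mat_image_eq[OF A B sub] by auto
  ultimately show ?thesis by (simp only:) (rule sets.Int, rule borel_Espace)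
qed

lemma emeasure_apply_mat_image:
  assumes A: "A \<in> carrier_mat n n" and det: "Determinant.det A \<noteq> 0"
    and S[measurable]: "S \<in> sets borel" and sub: "S \<subseteq> Espace n"
  shows "emeasure (lebesgue_E n) (apply_mat A ` S) = ennreal \<bar>Determinant.det A\<bar> * emeasure (lebesgue_E n) S"
proof -
  have AS[measurable]: "apply_mat A ` S \<in> sets borel" by (rule borel_apply_mat_image[OF assms])
  obtain B where B: "B \<in> carrier_mat n n" "A * B = 1\<^sub>m n" "B * A = 1\<^sub>m n"
    by (rule mat_inverse_exists[OF A det])
  have iff: "apply_mat A x \<in> apply_mat A ` S \<longleftrightarrow> x \<in> S" if "x \<in> Espace n" for x
  proof
    assume "apply_mat A x \<in> apply_mat A ` S"
    then have "apply_mat B (apply_mat A x) \<in> S" unfolding apply_mat_image_eq[OF A B sub] by simp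
    then show "x \<in> S" using that by (simp flip: apply_mat_mult[OF B(1) A] add: B apply_mat_one)
  qed auto
  have "emeasure (lebesgue_E n) (apply_mat A ` S) = (\<integral>\<^sup>+x. indicator (apply_mat A ` S) x \<partial>lebesgue_E n)"
    by simp
  also have "\<dots> = ennreal \<bar>Determinant.det A\<bar> * (\<integral>\<^sup>+x. indicator (apply_mat A ` S) (apply_mat A x) \<partial>lebesgue_E n)"
    using transforms_volume_det[OF A det, unfolded transforms_volume_def, rule_format, of "indicator (apply_mat A ` S)"]
    by simp
  also have "(\<integral>\<^sup>+x. indicator (apply_mat A ` S) (apply_mat A x) \<partial>lebesgue_E n) = (\<integral>\<^sup>+x. indicator S x \<partial>lebesgue_E n)"
  proof (rule nn_integral_cong_AE, rule AE_mp[OF AE_lebesgue_E_Espace[of n]], rule AE_I2, rule impI)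
    fix x assume "x \<in> Espace n"
    from iff[OF this] show "indicator (apply_mat A ` S) (apply_mat A x) = (indicator S x :: ennreal)"
      by (simp only: indicator_def)
  qed
  finally show ?thesis by simp
qed

lemma vol_apply_mat_image:
  assumes "A \<in> carrier_mat n n" "Determinant.det A \<noteq> 0" "S \<in> sets borel" "S \<subseteq> Espace n"
  shows "vol n (apply_mat A ` S) = \<bar>Determinant.det A\<bar> * vol n S"
  by (simp add: vol_def measure_def emeasure_apply_mat_image[OF assms] enn2real_mult)

lemma scale_image_eq_apply_mat:
  assumes "S \<subseteq> Espace n"
  shows "(\<lambda>x. c *\<^sub>R x) ` S = apply_mat (c \<cdot>\<^sub>m 1\<^sub>m n) ` S"
proof (rule image_cong[OF refl])
  fix x assume "x \<in> S"
  then have x: "x \<in> Espace n" using assms by auto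
  show "c *\<^sub>R x = apply_mat (c \<cdot>\<^sub>m 1\<^sub>m n) x"
  proof
    fix i show "(c *\<^sub>R x) i = apply_mat (c \<cdot>\<^sub>m 1\<^sub>m n) x i"
    proof (cases "i < n")
      case True
      then show ?thesis by (simp add: apply_mat_def mult_delta_left mult_delta_right)
    qed (use x in \<open>auto simp: apply_mat_def\<close>)
  qed
qed

lemma borel_scale_image:
  assumes "S \<in> sets borel" "S \<subseteq> Espace n" "c \<noteq> 0"
  shows "(\<lambda>x. c *\<^sub>R x) ` S \<in> sets borel"
  unfolding scale_image_eq_apply_mat[OF assms(2)] using assms by (intro borel_apply_mat_image) auto

lemma emeasure_scale_image:
  assumes "S \<in> sets borel" "S \<subseteq> Espace n" "c > 0"
  shows "emeasure (lebesgue_E n) ((\<lambda>x. c *\<^sub>R x) ` S) = ennreal (c ^ n) * emeasure (lebesgue_E n) S"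
  unfolding scale_image_eq_apply_mat[OF assms(2)] using assms by (subst emeasure_apply_mat_image) (auto simp: abs_mult power_abs)

lemma vol_scale_image:
  assumes "S \<in> sets borel" "S \<subseteq> Espace n" "c > 0"
  shows "vol n ((\<lambda>x. c *\<^sub>R x) ` S) = c ^ n * vol n S"
  using assms by (simp add: vol_def measure_def emeasure_scale_image enn2real_mult)

section \<open>Boxes, balls and polar bodies\<close>

lemma topspace_Euclidean_space_eq [simp]: "topspace (Euclidean_space n) = Espace n"
  by (simp add: topspace_Euclidean_space)

lemma compactin_Euclidean_space_iff: "compactin (Euclidean_space n) K \<longleftrightarrow> compact K \<and> K \<subseteq> Espace n"
  unfolding Euclidean_space_def euclidean_product_topology compactin_subtopology by simp

lemma compact_Pi_UNIV:
  fixes S :: "nat \<Rightarrow> 'a::topological_space set"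
  assumes "\<And>i. compact (S i)"
  shows "compact {x. \<forall>i. x i \<in> S i}"
proof -
  have "compactin (product_topology (\<lambda>i. euclidean) UNIV) (PiE UNIV S)"
    using assms by (subst compactin_PiE) auto
  moreover have "PiE UNIV S = {x. \<forall>i. x i \<in> S i}" by auto
  ultimately show ?thesis by (simp add: euclidean_product_topology)
qed

lemma closed_Espace: "closed (Espace n)"
proof -
  have "Espace n = (\<Inter>i\<in>{n..}. {x. x i = 0})" by auto
  also have "closed \<dots>"
    by (intro closed_INT ballI closed_Collect_eq continuous_on_const) simp
  finally show ?thesis .
qed

lemma compact_bounded_coords:
  fixes K :: "(nat \<Rightarrow> real) set"
  assumes "compact K"
  obtains R where "R > 0" "\<And>x i. x \<in> K \<Longrightarrow> i < n \<Longrightarrow> \<bar>x i\<bar> \<le> R"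
proof -
  have "\<exists>R. \<forall>x\<in>K. \<bar>x i\<bar> \<le> R" for i
  proof -
    have "compact ((\<lambda>x. x i) ` K)"
      using assms by (intro compact_continuous_image continuous_on_subset[OF continuous_on_product_coordinates]) auto
    then have "bounded ((\<lambda>x. x i) ` K)" by (rule compact_imp_bounded)
    then show ?thesis by (auto simp: bounded_iff)
  qed
  then obtain B where B: "\<And>i x. x \<in> K \<Longrightarrow> \<bar>x i\<bar> \<le> B i" by metis
  show ?thesis
  proof (rule that[of "1 + (\<Sum>i<n. \<bar>B i\<bar>)"])
    show "0 < 1 + (\<Sum>i<n. \<bar>B i\<bar>)" by (intro add_pos_nonneg sum_nonneg) auto
    fix x i assume "x \<in> K" "i < n"
    then have "\<bar>x i\<bar> \<le> \<bar>B i\<bar>" using B by (meson abs_ge_self order_trans)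
    also have "\<bar>B i\<bar> \<le> (\<Sum>i<n. \<bar>B i\<bar>)" using \<open>i < n\<close> by (intro member_le_sum) auto
    finally show "\<bar>x i\<bar> \<le> 1 + (\<Sum>i<n. \<bar>B i\<bar>)" by simp
  qed
qed

lemma compact_scale_image:
  fixes K :: "(nat \<Rightarrow> real) set"
  assumes "compact K"
  shows "compact ((\<lambda>x. c *\<^sub>R x) ` K)"
proof (rule compact_continuous_image[OF _ assms])
  show "continuous_on K (\<lambda>x. c *\<^sub>R x)"
  proof (rule continuous_on_coordinatewise_then_product)
    fix i
    have "continuous_on K (\<lambda>x. c * x i)"
      by (rule continuous_on_mult[OF continuous_on_const continuous_on_subset[OF continuous_on_product_coordinates]]) simp
    then show "continuous_on K (\<lambda>x. (c *\<^sub>R x) i)" by simp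
  qed
qed

lemma abs_le_interval: "\<bar>x :: real\<bar> \<le> b \<longleftrightarrow> - b \<le> x \<and> x \<le> b"
  by auto

definition box_E :: "nat \<Rightarrow> (nat \<Rightarrow> real) \<Rightarrow> (nat \<Rightarrow> real) set"
  where "box_E n b = {x \<in> Espace n. \<forall>i<n. \<bar>x i\<bar> \<le> b i}"

lemma closed_box_E: "closed (box_E n b)"
proof -
  have "box_E n b = Espace n \<inter> (\<Inter>i\<in>{..<n}. {x. \<bar>x i\<bar> \<le> b i})" by (auto simp: box_E_def)
  also have "closed \<dots>"
    by (intro closed_Int closed_Espace closed_INT ballI closed_Collect_le continuous_intros) simp_all
  finally show ?thesis .
qed

lemma emeasure_box_E:
  assumes "\<And>i. i < n \<Longrightarrow> 0 \<le> b i"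
  shows "emeasure (lebesgue_E n) (box_E n b) = ennreal (\<Prod>i<n. 2 * b i)"
proof -
  interpret product_sigma_finite "\<lambda>_::nat. lborel :: real measure" by (rule product_sigma_finite_lborel)
  have "emeasure (lebesgue_E n) (box_E n b) = emeasure (PiL n) (pad n -` box_E n b \<inter> space (PiL n))"
    unfolding lebesgue_E_eq by (rule emeasure_distr[OF measurable_pad]) (simp add: borel_closed closed_box_E)
  also have "pad n -` box_E n b \<inter> space (PiL n) = PiE {..<n} (\<lambda>i. {- b i..b i})"
  proof -
    have "pad n x \<in> box_E n b \<longleftrightarrow> (\<forall>i<n. x i \<in> {- b i..b i})" for x
      unfolding box_E_def pad_def atLeastAtMost_iff abs_le_interval by simp
    then show ?thesis
      by (intro Set.set_eqI) (auto simp: space_PiM PiE_iff)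
  qed
  also have "emeasure (PiL n) \<dots> = (\<Prod>i<n. emeasure lborel {- b i..b i})"
    by (rule emeasure_PiM) auto
  also have "\<dots> = (\<Prod>i<n. ennreal (2 * b i))"
    using assms by (intro prod.cong) auto
  also have "\<dots> = ennreal (\<Prod>i<n. 2 * b i)"
    using assms by (intro prod_ennreal) auto
  finally show ?thesis .
qed

lemma vol_box_E: "(\<And>i. i < n \<Longrightarrow> 0 \<le> b i) \<Longrightarrow> vol n (box_E n b) = (\<Prod>i<n. 2 * b i)"
  unfolding vol_def measure_def by (subst emeasure_box_E) (auto intro!: enn2real_ennreal prod_nonneg)

lemma cube_eq_box_E: "cube n = box_E n (\<lambda>_. 1)"
  by (auto simp: cube_def box_E_def abs_le_interval)

lemma vol_cube: "vol n (cube n) = 2 ^ n"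
  by (simp add: cube_eq_box_E vol_box_E)

lemma compact_imp_borel: "compact (K :: (nat \<Rightarrow> real) set) \<Longrightarrow> K \<in> sets borel"
  by (intro borel_closed compact_imp_closed)

lemma emeasure_compact_finite:
  assumes "compact K" "K \<subseteq> Espace n"
  shows "emeasure (lebesgue_E n) K < \<infinity>"
proof -
  obtain R where R: "R > 0" "\<And>x i. x \<in> K \<Longrightarrow> i < n \<Longrightarrow> \<bar>x i\<bar> \<le> R"
    using compact_bounded_coords[OF assms(1)] by blast
  have "emeasure (lebesgue_E n) K \<le> emeasure (lebesgue_E n) (box_E n (\<lambda>_. R))"
    using assms R by (intro emeasure_mono) (auto simp: box_E_def borel_closed closed_box_E)
  also have "\<dots> < \<infinity>" using R by (subst emeasure_box_E) auto
  finally show ?thesis .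
qed

lemma vol_mono:
  assumes "A \<subseteq> B" "A \<in> sets borel" "compact B" "B \<subseteq> Espace n"
  shows "vol n A \<le> vol n B"
  unfolding vol_def using assms emeasure_compact_finite[OF assms(3,4)]
  by (intro measure_mono_fmeasurable) (auto simp: fmeasurable_def compact_imp_borel)

definition dot :: "nat \<Rightarrow> (nat \<Rightarrow> real) \<Rightarrow> (nat \<Rightarrow> real) \<Rightarrow> real"
  where "dot n x y = (\<Sum>i<n. x i * y i)"

lemma dot_commute: "dot n x y = dot n y x" by (simp add: dot_def mult.commute)
lemma dot_add_left: "dot n (x + y) z = dot n x z + dot n y z" by (simp add: dot_def distrib_right sum.distrib)
lemma dot_diff_left: "dot n (x - y) z = dot n x z - dot n y z" by (simp add: dot_def left_diff_distrib sum_subtractf)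
lemma dot_scaleR_left: "dot n (r *\<^sub>R x) z = r * dot n x z" by (simp add: dot_def sum_distrib_left mult.assoc)
lemma dot_minus_left: "dot n (- x) z = - dot n x z" by (simp add: dot_def sum_negf)
lemma dot_add_right: "dot n z (x + y) = dot n z x + dot n z y" by (simp add: dot_def distrib_left sum.distrib)
lemma dot_diff_right: "dot n z (x - y) = dot n z x - dot n z y" by (simp add: dot_def right_diff_distrib sum_subtractf)
lemma dot_scaleR_right: "dot n z (r *\<^sub>R x) = r * dot n z x" by (simp add: dot_def sum_distrib_left mult_ac)
lemma dot_minus_right: "dot n z (- x) = - dot n z x" by (simp add: dot_def sum_negf)
lemmas dot_simps = dot_add_left dot_diff_left dot_scaleR_left dot_minus_left dot_add_right dot_diff_right dot_scaleR_right dot_minus_right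

lemma dot_self_nonneg: "0 \<le> dot n x x" by (simp add: dot_def sum_nonneg)

lemma dot_self_eq_0:
  assumes "x \<in> Espace n" "dot n x x = 0" shows "x = 0"
proof
  fix i
  have "\<forall>j<n. x j * x j = 0" using assms(2) unfolding dot_def by (subst (asm) sum_nonneg_eq_0_iff) auto
  then show "x i = 0 i" using assms(1) by (cases "i < n") auto
qed

lemma dot_Cauchy_Schwarz: "(dot n x y)\<^sup>2 \<le> dot n x x * dot n y y"
  unfolding dot_def using Cauchy_Schwarz_ineq_sum[of x y "{..<n}"] by (simp add: power2_eq_square)

lemma continuous_on_dot:
  assumes "continuous_on A f" "continuous_on A g"
  shows "continuous_on A (\<lambda>x. dot n (f x) (g x))"
  unfolding dot_def
  by (rule continuous_on_sum, rule continuous_on_mult)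
     (rule continuous_on_product_then_coordinatewise[OF assms(1)], rule continuous_on_product_then_coordinatewise[OF assms(2)])

lemma Eball_0_eq:
  assumes "r \<ge> 0" shows "Eball n 0 r = {x \<in> Espace n. dot n x x \<le> r\<^sup>2}"
proof -
  have "L2_set (x - 0) {..<n} \<le> r \<longleftrightarrow> dot n x x \<le> r\<^sup>2" for x
    using real_sqrt_le_iff[of "dot n x x" "r\<^sup>2"] assms by (simp add: L2_set_def dot_def power2_eq_square)
  then show ?thesis by (simp only: Eball_def topspace_Euclidean_space_eq)
qed

lemma compact_box_E: "compact (box_E n b)"
proof -
  have "compact {x. \<forall>i. x i \<in> (if i < n then {- b i..b i} else {0::real})}"
    by (intro compact_Pi_UNIV) auto
  also have "{x. \<forall>i. x i \<in> (if i < n then {- b i..b i} else {0::real})} = box_E n b"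
  proof (intro Set.set_eqI iffI)
    fix x assume "x \<in> {x. \<forall>i. x i \<in> (if i < n then {- b i..b i} else {0::real})}"
    then have *: "\<And>i. x i \<in> (if i < n then {- b i..b i} else {0::real})" by simp
    show "x \<in> box_E n b" unfolding box_E_def
    proof (intro CollectI conjI allI impI)
      fix i assume "n \<le> i" then show "x i = 0" using *[of i] by simp
    next
      fix i assume "i < n" then show "\<bar>x i\<bar> \<le> b i" using *[of i] by auto
    qed
  next
    fix x assume "x \<in> box_E n b"
    then show "x \<in> {x. \<forall>i. x i \<in> (if i < n then {- b i..b i} else {0::real})}"
      by (auto simp: box_E_def abs_le_interval)
  qed
  finally show ?thesis .
qed

lemma coord_sq_le_dot: "i < n \<Longrightarrow> (x i)\<^sup>2 \<le> dot n x x"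
  unfolding dot_def power2_eq_square by (rule member_le_sum[of i "{..<n}" "\<lambda>i. x i * x i"]) auto

lemma compact_Eball_0:
  assumes "r \<ge> 0" shows "compact (Eball n 0 r)"
proof -
  have "Eball n 0 r = box_E n (\<lambda>_. r) \<inter> {x. dot n x x \<le> r\<^sup>2}"
  proof -
    have "\<bar>x i\<bar> \<le> r" if "dot n x x \<le> r\<^sup>2" "i < n" for x i
      using abs_le_square_iff[of "x i" r] order_trans[OF coord_sq_le_dot that(1)] that(2) assms by simp
    then have "x \<in> Eball n 0 r \<longleftrightarrow> x \<in> box_E n (\<lambda>_. r) \<and> dot n x x \<le> r\<^sup>2" for x
      unfolding Eball_0_eq[OF assms] box_E_def by auto
    then show ?thesis by auto
  qed
  also have "compact \<dots>"
    by (rule compact_Int_closed[OF compact_box_E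
          closed_Collect_le[OF continuous_on_dot[OF continuous_on_id continuous_on_id] continuous_on_const]])
  finally show ?thesis .
qed

lemma dot_apply_mat:
  assumes "A \<in> carrier_mat n n"
  shows "dot n (apply_mat A x) y = dot n x (apply_mat A\<^sup>T y)"
proof -
  have "dot n (apply_mat A x) y = (\<Sum>i<n. \<Sum>j<n. A $$ (i,j) * x j * y i)"
    using assms by (auto simp: dot_def apply_mat_def sum_distrib_right intro!: sum.cong)
  also have "\<dots> = (\<Sum>j<n. x j * (\<Sum>i<n. A $$ (i,j) * y i))"
    by (subst sum.swap) (simp add: sum_distrib_left mult_ac)
  also have "\<dots> = dot n x (apply_mat A\<^sup>T y)"
    using assms by (auto simp: dot_def apply_mat_def intro!: sum.cong)
  finally show ?thesis .
qed

definition polar :: "nat \<Rightarrow> (nat \<Rightarrow> real) set \<Rightarrow> (nat \<Rightarrow> real) set"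
  where "polar n K = {v \<in> Espace n. \<forall>x\<in>K. dot n x v \<le> 1}"

text \<open>
  If \<open>x \<notin> K\<close>, let \<open>p\<close> be the nearest point of \<open>K\<close> and \<open>w = x - p\<close>. Then \<open>K\<close> lies in the half-space
  \<open>\<langle>y, w\<rangle> \<le> \<langle>p, w\<rangle>\<close>, where \<open>\<langle>p, w\<rangle> > 0\<close> because \<open>K\<close> contains a ball around \<open>0\<close>. Hence
  \<open>w / \<langle>p, w\<rangle>\<close> belongs to the polar body, and it separates \<open>x\<close> from \<open>K\<close>.
\<close>

lemma bipolar:
  assumes K: "compact K" "convex K" "K \<subseteq> Espace n" and B: "r > 0" "Eball n 0 r \<subseteq> K"
    and x: "x \<in> Espace n" "\<And>v. v \<in> polar n K \<Longrightarrow> dot n x v \<le> 1"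
  shows "x \<in> K"
proof (rule ccontr)
  assume xK: "x \<notin> K"
  have 0: "0 \<in> K" using B by (auto simp: Eball_0_eq dot_def)
  have "continuous_on K (\<lambda>y. dot n (x - y) (x - y))"
  proof -
    have "continuous_on K (\<lambda>y. x i - y i)" for i
      by (intro continuous_intros continuous_on_subset[OF continuous_on_product_coordinates]) simp
    then have "continuous_on K (\<lambda>y. x - y)"
      by (intro continuous_on_coordinatewise_then_product) simp
    then show ?thesis by (intro continuous_on_dot)
  qed
  then obtain p where p: "p \<in> K" "\<And>y. y \<in> K \<Longrightarrow> dot n (x - p) (x - p) \<le> dot n (x - y) (x - y)"
    using continuous_attains_inf[OF K(1), of "\<lambda>y. dot n (x - y) (x - y)"] 0 by blast
  define w where "w = x - p"
  have wE: "w \<in> Espace n" using x(1) K(3) p(1) by (auto simp: w_def)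
  have w0: "dot n w w > 0"
    using dot_self_eq_0[OF wE] dot_self_nonneg[of n w] p(1) xK by (force simp: w_def less_le)
  have le: "dot n y w \<le> dot n p w" if y: "y \<in> K" for y
  proof (rule ccontr)
    assume "\<not> ?thesis"
    then have g: "dot n (y - p) w > 0" by (simp add: dot_simps)
    define a where "a = dot n (y - p) w"
    define b where "b = dot n (y - p) (y - p)"
    \<comment> \<open>Moving from \<open>p\<close> by \<open>t (y - p)\<close> changes the squared distance to \<open>x\<close> by
      \<open>t (t b - 2 a)\<close>, which is negative for this \<open>t\<close>.\<close>
    define t where "t = min 1 (a / (b + 1))"
    have b: "b \<ge> 0" unfolding b_def by (rule dot_self_nonneg)
    have a: "a > 0" using g by (simp add: a_def)
    have t: "0 < t" "t \<le> 1" "t \<le> a / (b + 1)" using a b by (auto simp: t_def)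
    then have t3: "t * (b + 1) \<le> a" using b by (simp add: pos_le_divide_eq)
    have "(1 - t) *\<^sub>R p + t *\<^sub>R y \<in> K" using K(2) p(1) y t by (simp add: convex_alt)
    moreover have "x - ((1 - t) *\<^sub>R p + t *\<^sub>R y) = w - t *\<^sub>R (y - p)"
      by (rule ext) (simp add: w_def algebra_simps)
    ultimately have "dot n w w \<le> dot n (w - t *\<^sub>R (y - p)) (w - t *\<^sub>R (y - p))"
      using p(2)[of "(1 - t) *\<^sub>R p + t *\<^sub>R y"] by (simp only: w_def)
    also have "\<dots> = dot n w w - 2 * t * a + t\<^sup>2 * b"
    proof -
      have "dot n (w - t *\<^sub>R z) (w - t *\<^sub>R z) = dot n w w - 2 * t * dot n z w + t\<^sup>2 * dot n z z" for z
        using dot_commute[of n w z] by (simp add: dot_simps power2_eq_square algebra_simps)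
      then show ?thesis by (simp only: a_def b_def)
    qed
    finally have "t * (2 * a) \<le> t * (t * b)" by (simp add: power2_eq_square)
    then have "2 * a \<le> t * b" using t(1) by simp
    moreover have "t * b \<le> t * (b + 1)" using t by (intro mult_left_mono) auto
    ultimately show False using t3 a by linarith
  qed
  define s where "s = dot n p w"
  have s: "s > 0"
  proof -
    define y where "y = (r / sqrt (dot n w w)) *\<^sub>R w"
    have "dot n y y = r\<^sup>2" using w0 by (simp add: y_def dot_simps power2_eq_square)
    moreover have "y \<in> Espace n" using wE by (simp add: y_def)
    ultimately have "y \<in> K" using B by (auto simp: Eball_0_eq)
    then have "dot n y w \<le> s" unfolding s_def by (rule le)
    moreover have "dot n y w > 0" using w0 B(1) by (simp add: y_def dot_simps)
    ultimately show ?thesis by linarith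
  qed
  have "(1 / s) *\<^sub>R w \<in> polar n K"
    unfolding polar_def using wE le s by (auto simp: dot_simps s_def[symmetric] divide_le_eq)
  from x(2)[OF this] have "dot n x w \<le> s" using s by (simp add: dot_simps divide_le_eq)
  moreover have "dot n x w = s + dot n w w" by (simp add: s_def w_def dot_simps)
  ultimately show False using w0 by simp
qed

section \<open>Tilted uniform distributions on an interval\<close>

text \<open>
  Let \<open>Y\<close> be uniform on \<open>[-1, 1]\<close> and \<open>Z\<close> an independent standard normal variable. Up to normalisation,
  \<open>exp (l s y - l\<^sup>2 y\<^sup>2 / 2)\<close> is the conditional density of \<open>Y\<close> given \<open>l Y + Z = s\<close>, so that
  \<open>tilted_mean k l s\<close> is the conditional \<open>k\<close>-th moment.
\<close>

definition tilted_moment :: "nat \<Rightarrow> real \<Rightarrow> real \<Rightarrow> real"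
  where "tilted_moment k l s = integral {-1..1} (\<lambda>y. y ^ k * exp (l * s * y - l\<^sup>2 * y\<^sup>2 / 2))"

definition tilted_mean :: "nat \<Rightarrow> real \<Rightarrow> real \<Rightarrow> real"
  where "tilted_mean k l s = tilted_moment k l s / tilted_moment 0 l s"

lemma tilted_integrable: "(\<lambda>y. y ^ k * exp (l * s * y - l\<^sup>2 * y\<^sup>2 / 2)) integrable_on {-1..1::real}"
  by (intro integrable_continuous_real continuous_intros) auto

lemma tilted_moment_deriv_s:
  "((\<lambda>s. tilted_moment k l s) has_field_derivative l * tilted_moment (Suc k) l s) (at s)"
proof -
  have "((\<lambda>s. integral (cbox (-1) 1) (\<lambda>y. y ^ k * exp (l * s * y - l\<^sup>2 * y\<^sup>2 / 2)))
      has_field_derivative integral (cbox (-1) 1) (\<lambda>y. l * (y ^ Suc k * exp (l * s * y - l\<^sup>2 * y\<^sup>2 / 2)))) (at s within UNIV)"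
  proof (rule leibniz_rule_field_derivative)
    show "continuous_on (UNIV \<times> cbox (-1::real) 1) (\<lambda>(x, t). l * (t ^ Suc k * exp (l * x * t - l\<^sup>2 * t\<^sup>2 / 2)))"
      by (auto simp: case_prod_beta' intro!: continuous_intros)
  qed (auto intro!: derivative_eq_intros tilted_integrable[simplified])
  then show ?thesis by (simp add: tilted_moment_def integral_mult_right)
qed

lemma tilted_moment_deriv_l:
  "((\<lambda>l. tilted_moment k l s) has_field_derivative
     s * tilted_moment (Suc k) l s - l * tilted_moment (Suc (Suc k)) l s) (at l)"
proof -
  have "((\<lambda>l. integral (cbox (-1) 1) (\<lambda>y. y ^ k * exp (l * s * y - l\<^sup>2 * y\<^sup>2 / 2)))
      has_field_derivative integral (cbox (-1) 1) (\<lambda>y. s * (y ^ Suc k * exp (l * s * y - l\<^sup>2 * y\<^sup>2 / 2))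
          - l * (y ^ Suc (Suc k) * exp (l * s * y - l\<^sup>2 * y\<^sup>2 / 2)))) (at l within UNIV)"
  proof (rule leibniz_rule_field_derivative)
    show "continuous_on (UNIV \<times> cbox (-1::real) 1) (\<lambda>(l, y). s * (y ^ Suc k * exp (l * s * y - l\<^sup>2 * y\<^sup>2 / 2))
          - l * (y ^ Suc (Suc k) * exp (l * s * y - l\<^sup>2 * y\<^sup>2 / 2)))"
      by (auto simp: case_prod_beta' intro!: continuous_intros)
  next
    fix x t :: real
    show "((\<lambda>l. t ^ k * exp (l * s * t - l\<^sup>2 * t\<^sup>2 / 2)) has_field_derivative
      s * (t ^ Suc k * exp (x * s * t - x\<^sup>2 * t\<^sup>2 / 2)) - x * (t ^ Suc (Suc k) * exp (x * s * t - x\<^sup>2 * t\<^sup>2 / 2)))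
      (at x within UNIV)"
      by (auto intro!: derivative_eq_intros simp: algebra_simps power2_eq_square)
  qed (use tilted_integrable in auto)
  also have "integral (cbox (-1) 1) (\<lambda>y. s * (y ^ Suc k * exp (l * s * y - l\<^sup>2 * y\<^sup>2 / 2))
          - l * (y ^ Suc (Suc k) * exp (l * s * y - l\<^sup>2 * y\<^sup>2 / 2)))
      = s * tilted_moment (Suc k) l s - l * tilted_moment (Suc (Suc k)) l s"
    unfolding tilted_moment_def cbox_interval
    by (subst integral_diff) (intro integrable_on_mult_right tilted_integrable, intro integrable_on_mult_right tilted_integrable,
        simp add: integral_mult_right)
  finally show ?thesis by (simp add: tilted_moment_def)
qed

text \<open>
  By \<open>e\<^sup>x \<ge> 1 + x\<close> with \<open>x = l s y\<close>: the linear term integrates to zero over \<open>[-1, 1]\<close>.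
\<close>

lemma tilted_moment0_ge: "tilted_moment 0 l s \<ge> 2 * exp (- (l\<^sup>2 / 2))"
proof -
  have "((\<lambda>y::real. exp (- (l\<^sup>2 / 2)) * (1 + l * s * y)) has_integral
      (exp (- (l\<^sup>2 / 2)) * (1 + l * s * 1 / 2) - exp (- (l\<^sup>2 / 2)) * (-1 + l * s * 1 / 2))) {-1..1}"
  proof -
    have "((\<lambda>y::real. exp (- (l\<^sup>2 / 2)) * (1 + l * s * y)) has_integral
      ((\<lambda>y. exp (- (l\<^sup>2 / 2)) * (y + l * s * y\<^sup>2 / 2)) 1 - (\<lambda>y. exp (- (l\<^sup>2 / 2)) * (y + l * s * y\<^sup>2 / 2)) (-1))) {-1..1}"
      by (intro fundamental_theorem_of_calculus)
         (auto intro!: derivative_eq_intros simp flip: has_real_derivative_iff_has_vector_derivative)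
    then show ?thesis by simp
  qed
  then have i: "((\<lambda>y::real. exp (- (l\<^sup>2 / 2)) * (1 + l * s * y)) has_integral 2 * exp (- (l\<^sup>2 / 2))) {-1..1}"
    by (simp add: algebra_simps)
  have "integral {-1..1} (\<lambda>y::real. exp (- (l\<^sup>2 / 2)) * (1 + l * s * y)) \<le> tilted_moment 0 l s"
    unfolding tilted_moment_def
  proof (rule integral_le)
    show "(\<lambda>y::real. exp (- (l\<^sup>2 / 2)) * (1 + l * s * y)) integrable_on {-1..1}" using i by blast
    show "(\<lambda>y. y ^ 0 * exp (l * s * y - l\<^sup>2 * y\<^sup>2 / 2)) integrable_on {-1..1}" by (rule tilted_integrable)
    fix y :: real assume y: "y \<in> {-1..1}"
    then have "y\<^sup>2 \<le> 1" by (simp add: abs_square_le_1 abs_le_iff)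
    then have "l\<^sup>2 * y\<^sup>2 \<le> l\<^sup>2 * 1" by (intro mult_left_mono) auto
    then have "exp (- (l\<^sup>2 / 2)) * exp (l * s * y) \<le> exp (l * s * y - l\<^sup>2 * y\<^sup>2 / 2)"
      by (simp flip: exp_add)
    moreover have "exp (- (l\<^sup>2 / 2)) * (1 + l * s * y) \<le> exp (- (l\<^sup>2 / 2)) * exp (l * s * y)"
      using exp_ge_add_one_self[of "l * s * y"] by (intro mult_left_mono) auto
    ultimately show "exp (- (l\<^sup>2 / 2)) * (1 + l * s * y) \<le> y ^ 0 * exp (l * s * y - l\<^sup>2 * y\<^sup>2 / 2)"
      unfolding power_0 mult_1 by (rule order_trans[rotated])
  qed
  then show ?thesis using integral_unique[OF i] by simp
qed

lemma tilted_moment0_pos: "tilted_moment 0 l s > 0"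
  using tilted_moment0_ge[of l s] by (meson exp_gt_zero less_le_trans mult_pos_pos zero_less_numeral)

lemma tilted_moment0_le: "tilted_moment 0 l s \<le> 2 * exp (\<bar>l\<bar> * \<bar>s\<bar>)"
proof -
  have "tilted_moment 0 l s \<le> integral {-1..1} (\<lambda>y::real. exp (\<bar>l\<bar> * \<bar>s\<bar>))"
    unfolding tilted_moment_def
  proof (rule integral_le[OF tilted_integrable])
    fix y :: real assume y: "y \<in> {-1..1}"
    have "l * s * y \<le> \<bar>l * s * y\<bar>" by simp
    also have "\<dots> \<le> \<bar>l\<bar> * \<bar>s\<bar> * 1"
      unfolding abs_mult using y by (intro mult_left_mono) auto
    finally have "l * s * y - l\<^sup>2 * y\<^sup>2 / 2 \<le> \<bar>l\<bar> * \<bar>s\<bar> - 0"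
      by (intro diff_mono) auto
    then show "y ^ 0 * exp (l * s * y - l\<^sup>2 * y\<^sup>2 / 2) \<le> exp (\<bar>l\<bar> * \<bar>s\<bar>)" by simp
  qed auto
  then show ?thesis by simp
qed

lemma tilted_moment_abs_le: "\<bar>tilted_moment k l s\<bar> \<le> tilted_moment 0 l s"
proof -
  have "norm (tilted_moment k l s) \<le> tilted_moment 0 l s"
    unfolding tilted_moment_def
  proof (rule integral_norm_bound_integral[OF tilted_integrable tilted_integrable])
    fix y :: real assume y: "y \<in> {-1..1}"
    then have "\<bar>y\<bar> ^ k \<le> 1" by (intro power_le_one) auto
    then show "norm (y ^ k * exp (l * s * y - l\<^sup>2 * y\<^sup>2 / 2)) \<le> y ^ 0 * exp (l * s * y - l\<^sup>2 * y\<^sup>2 / 2)"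
      by (simp add: abs_mult power_abs)
  qed
  then show ?thesis by simp
qed

lemma tilted_mean_abs_le: "\<bar>tilted_mean k l s\<bar> \<le> 1"
  using tilted_moment_abs_le[of k l s] tilted_moment0_pos[of l s]
  by (simp add: tilted_mean_def abs_divide)

lemma tilted_mean_0 [simp]: "tilted_mean 0 l s = 1"
  using tilted_moment0_pos[of l s] by (simp add: tilted_mean_def)

text \<open>
  The tilted distributions form an exponential family in \<open>s\<close>: the derivative of a mean is \<open>l\<close> times
  the covariance with \<open>y\<close>.
\<close>

lemma tilted_mean_deriv_s:
  "((\<lambda>s. tilted_mean k l s) has_field_derivative
     l * (tilted_mean (Suc k) l s - tilted_mean k l s * tilted_mean 1 l s)) (at s)"
proof -
  note p = tilted_moment0_pos[of l s]
  have "((\<lambda>s. tilted_moment k l s / tilted_moment 0 l s) has_field_derivative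
     (l * tilted_moment (Suc k) l s * tilted_moment 0 l s - tilted_moment k l s * (l * tilted_moment (Suc 0) l s))
       / (tilted_moment 0 l s * tilted_moment 0 l s)) (at s)"
    using p by (intro DERIV_divide tilted_moment_deriv_s) auto
  moreover have "(l * tilted_moment (Suc k) l s * tilted_moment 0 l s - tilted_moment k l s * (l * tilted_moment (Suc 0) l s))
       / (tilted_moment 0 l s * tilted_moment 0 l s) = l * (tilted_mean (Suc k) l s - tilted_mean k l s * tilted_mean 1 l s)"
    using p by (simp add: tilted_mean_def field_simps)
  ultimately show ?thesis unfolding tilted_mean_def[abs_def] by metis
qed

lemma continuous_on_tilted_moment [continuous_intros]:
  "continuous_on A f \<Longrightarrow> continuous_on A (\<lambda>x. tilted_moment k l (f x))"
  by (rule continuous_on_compose2[OF DERIV_continuous_on[OF has_field_derivative_at_within[OF tilted_moment_deriv_s]]]) auto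

lemma continuous_on_tilted_mean [continuous_intros]:
  "continuous_on A f \<Longrightarrow> continuous_on A (\<lambda>x. tilted_mean k l (f x))"
  by (rule continuous_on_compose2[OF DERIV_continuous_on[OF has_field_derivative_at_within[OF tilted_mean_deriv_s]]]) auto

text \<open>
  The fourth cumulant in terms of the raw moments. Since the \<open>k\<close>-th derivative of the mean in \<open>s\<close> is
  \<open>l\<^sup>k\<close> times the cumulant of order \<open>k + 1\<close>, it governs the third derivative of the mean.
\<close>

definition tilted_cumulant4 :: "real \<Rightarrow> real \<Rightarrow> real"
  where "tilted_cumulant4 l s = tilted_mean 4 l s - 4 * tilted_mean 3 l s * tilted_mean 1 l s
     - 3 * (tilted_mean 2 l s)\<^sup>2 + 12 * tilted_mean 2 l s * (tilted_mean 1 l s)\<^sup>2 - 6 * (tilted_mean 1 l s) ^ 4"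

lemma tilted_mean1_deriv1:
  "((\<lambda>s. tilted_mean 1 l s) has_field_derivative l * (tilted_mean 2 l s - (tilted_mean 1 l s)\<^sup>2)) (at s)"
  using tilted_mean_deriv_s[of 1 l s] by (simp add: power2_eq_square numeral_2_eq_2)

lemma tilted_mean1_deriv2:
  "((\<lambda>s. l * (tilted_mean 2 l s - (tilted_mean 1 l s)\<^sup>2)) has_field_derivative
     l\<^sup>2 * (tilted_mean 3 l s - 3 * tilted_mean 2 l s * tilted_mean 1 l s + 2 * (tilted_mean 1 l s) ^ 3)) (at s)"
proof -
  have d2: "((\<lambda>s. tilted_mean 2 l s) has_field_derivative l * (tilted_mean 3 l s - tilted_mean 2 l s * tilted_mean 1 l s)) (at s)"
    using tilted_mean_deriv_s[of 2 l s] by (simp add: eval_nat_numeral)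
  show ?thesis
    by (auto intro!: derivative_eq_intros d2 tilted_mean1_deriv1[unfolded One_nat_def])
       (simp add: algebra_simps power2_eq_square power3_eq_cube)
qed

lemma tilted_mean1_deriv3:
  "((\<lambda>s. l\<^sup>2 * (tilted_mean 3 l s - 3 * tilted_mean 2 l s * tilted_mean 1 l s + 2 * (tilted_mean 1 l s) ^ 3))
     has_field_derivative l ^ 3 * tilted_cumulant4 l s) (at s)"
proof -
  have d2: "((\<lambda>s. tilted_mean 2 l s) has_field_derivative l * (tilted_mean 3 l s - tilted_mean 2 l s * tilted_mean 1 l s)) (at s)"
    using tilted_mean_deriv_s[of 2 l s] by (simp add: eval_nat_numeral)
  have d3: "((\<lambda>s. tilted_mean 3 l s) has_field_derivative l * (tilted_mean 4 l s - tilted_mean 3 l s * tilted_mean 1 l s)) (at s)"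
    using tilted_mean_deriv_s[of 3 l s] by (simp add: eval_nat_numeral)
  show ?thesis
    by (auto intro!: derivative_eq_intros d2 d3 tilted_mean1_deriv1[unfolded One_nat_def])
       (simp add: tilted_cumulant4_def algebra_simps power2_eq_square power3_eq_cube power4_eq_xxxx)
qed

lemma tilted_mean_lipschitz:
  assumes "l \<ge> 0"
  shows "\<bar>tilted_mean k l s - tilted_mean k l 0\<bar> \<le> 2 * l * \<bar>s\<bar>"
proof -
  have bd: "norm (l * (tilted_mean (Suc k) l x - tilted_mean k l x * tilted_mean 1 l x)) \<le> 2 * l" for x
  proof -
    have "\<bar>tilted_mean k l x * tilted_mean 1 l x\<bar> \<le> 1 * 1"
      unfolding abs_mult by (intro mult_mono tilted_mean_abs_le) auto
    then have "\<bar>tilted_mean (Suc k) l x - tilted_mean k l x * tilted_mean 1 l x\<bar> \<le> 2"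
      using tilted_mean_abs_le[of "Suc k" l x] by linarith
    then have "l * \<bar>tilted_mean (Suc k) l x - tilted_mean k l x * tilted_mean 1 l x\<bar> \<le> l * 2"
      using assms by (rule mult_left_mono)
    then show ?thesis using assms by (simp add: abs_mult)
  qed
  have "norm (tilted_mean k l s - tilted_mean k l 0) \<le> 2 * l * norm (s - 0)"
    by (rule field_differentiable_bound[of UNIV]) (use bd tilted_mean_deriv_s in \<open>auto\<close>)
  then show ?thesis by simp
qed

lemma tilted_mean_odd_at_0:
  assumes "odd k"
  shows "tilted_mean k l 0 = 0"
proof -
  have "integral {-1..1} (\<lambda>y::real. (-y) ^ k * exp (l * 0 * (-y) - l\<^sup>2 * (-y)\<^sup>2 / 2)) = tilted_moment k l 0"
    unfolding tilted_moment_def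
    using Henstock_Kurzweil_Integration.integral_reflect_real[of 1 "-1" "\<lambda>y. y ^ k * exp (l * 0 * y - l\<^sup>2 * y\<^sup>2 / 2)"]
    unfolding minus_minus .
  also have "(\<lambda>y::real. (-y) ^ k * exp (l * 0 * (-y) - l\<^sup>2 * (-y)\<^sup>2 / 2)) = (\<lambda>y. - (y ^ k * exp (l * 0 * y - l\<^sup>2 * y\<^sup>2 / 2)))"
    using assms by (auto simp: fun_eq_iff)
  finally have "tilted_moment k l 0 = 0" by (simp add: tilted_moment_def)
  then show ?thesis by (simp add: tilted_mean_def)
qed

lemma has_integral_power_unit: "((\<lambda>y::real. y ^ (2 * k)) has_integral 2 / real (2 * k + 1)) {-1..1}"
proof (rule has_integral_eq_rhs)
  define N where "N = real (Suc (2 * k))"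
  have N: "N > 0" by (simp add: N_def)
  show "((\<lambda>y::real. y ^ (2 * k)) has_integral ((\<lambda>y. y ^ Suc (2 * k) / N) 1 - (\<lambda>y. y ^ Suc (2 * k) / N) (-1))) {-1..1}"
  proof (rule fundamental_theorem_of_calculus)
    fix x :: real
    have "((\<lambda>y. y ^ Suc (2 * k) / N) has_real_derivative N * x ^ (2 * k) / N) (at x within {-1..1})"
      unfolding N_def by (intro DERIV_cdivide) (rule derivative_eq_intros refl | simp del: power_Suc of_nat_Suc)+
    then show "((\<lambda>y. y ^ Suc (2 * k) / N) has_vector_derivative x ^ (2 * k)) (at x within {-1..1})"
      using N by (simp add: has_real_derivative_iff_has_vector_derivative)
  qed simp
  have "real (2 * k + 1) = N" by (simp add: N_def)
  moreover have "(\<lambda>y. y ^ Suc (2 * k) / N) 1 - (\<lambda>y. y ^ Suc (2 * k) / N) (-1) = 2 / N"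
    by (simp flip: add_divide_distrib)
  ultimately show "2 / real (2 * k + 1) = (\<lambda>y. y ^ Suc (2 * k) / N) 1 - (\<lambda>y. y ^ Suc (2 * k) / N) (-1)"
    by (simp only:)
qed

lemma tilted_moment_even_at_0:
  "exp (- (l\<^sup>2 / 2)) * (2 / real (2 * k + 1)) \<le> tilted_moment (2 * k) l 0"
  "tilted_moment (2 * k) l 0 \<le> 2 / real (2 * k + 1)"
proof -
  have *: "((\<lambda>y::real. exp (- (l\<^sup>2 / 2)) * y ^ (2 * k)) has_integral exp (- (l\<^sup>2 / 2)) * (2 / real (2 * k + 1))) {-1..1}"
    by (intro has_integral_mult_right has_integral_power_unit)
  show "exp (- (l\<^sup>2 / 2)) * (2 / real (2 * k + 1)) \<le> tilted_moment (2 * k) l 0"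
    unfolding tilted_moment_def
  proof (rule has_integral_le[OF * integrable_integral[OF tilted_integrable]])
    fix y :: real assume y: "y \<in> {-1..1}"
    then have "y\<^sup>2 \<le> 1" by (simp add: abs_square_le_1 abs_le_iff)
    then have "l\<^sup>2 * y\<^sup>2 \<le> l\<^sup>2 * 1" by (intro mult_left_mono) auto
    then have "exp (- (l\<^sup>2 / 2)) \<le> exp (l * 0 * y - l\<^sup>2 * y\<^sup>2 / 2)" by simp
    then show "exp (- (l\<^sup>2 / 2)) * y ^ (2 * k) \<le> y ^ (2 * k) * exp (l * 0 * y - l\<^sup>2 * y\<^sup>2 / 2)"
      by (subst mult.commute) (intro mult_left_mono, auto)
  qed
  show "tilted_moment (2 * k) l 0 \<le> 2 / real (2 * k + 1)"
    unfolding tilted_moment_def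
  proof (rule has_integral_le[OF integrable_integral[OF tilted_integrable] has_integral_power_unit])
    fix y :: real
    have "exp (l * 0 * y - l\<^sup>2 * y\<^sup>2 / 2) \<le> 1" by simp
    then show "y ^ (2 * k) * exp (l * 0 * y - l\<^sup>2 * y\<^sup>2 / 2) \<le> y ^ (2 * k)"
      by (intro mult_left_le) auto
  qed
qed

text \<open>
  For \<open>l = 0\<close> the distribution is uniform on \<open>[-1, 1]\<close>, with fourth cumulant
  \<open>1/5 - 3 (1/3)\<^sup>2 = -2/15\<close>. For small \<open>l\<close> the moments at \<open>s = 0\<close> change by a factor close to \<open>1\<close>,
  which the gap between \<open>13/100\<close> and \<open>2/15\<close> absorbs, and each moment is Lipschitz in \<open>s\<close> with
  constant \<open>2 l\<close>; the five terms of the cumulant add up to \<open>2 + 8 + 12 + 24 = 46\<close>, the last one being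
  nonpositive.
\<close>

lemma tilted_cumulant4_le:
  assumes l: "0 \<le> l" "l \<le> 1 / 1000"
  shows "tilted_cumulant4 l s \<le> - 13 / 100 + 46 * l * \<bar>s\<bar>"
proof -
  define t where "t = l * \<bar>s\<bar>"
  have t: "t \<ge> 0" using l by (simp add: t_def)
  define m where "m k = tilted_mean k l s" for k
  define e where "e = exp (- (l\<^sup>2 / 2))"
  have e1: "e \<ge> 1 - 1 / 1000"
  proof -
    have "l\<^sup>2 \<le> (1/1000)\<^sup>2" using l by (intro power_mono) auto
    then show ?thesis using exp_ge_add_one_self[of "- (l\<^sup>2 / 2)"] by (simp add: power2_eq_square e_def)
  qed
  have m4: "m 4 \<le> 201 / 1000 + 2 * t"
  proof -
    have "tilted_moment 4 l 0 \<le> 2 / 5" using tilted_moment_even_at_0(2)[of 2 l] by simp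
    moreover have "tilted_moment 0 l 0 \<ge> 2 * (1 - 1 / 1000)"
      using tilted_moment0_ge[of l 0, folded e_def] by (rule order_trans[rotated]) (use e1 in simp)
    ultimately have "tilted_moment 4 l 0 \<le> 201/1000 * tilted_moment 0 l 0" by argo
    then have "tilted_mean 4 l 0 \<le> 201 / 1000"
      unfolding tilted_mean_def using tilted_moment0_pos[of l 0] by (simp add: divide_le_eq)
    then show ?thesis using tilted_mean_lipschitz[OF l(1), of 4 s] by (simp add: m_def t_def)
  qed
  have m2: "m 2 \<ge> 333 / 1000 - 2 * t"
  proof -
    have "tilted_moment 2 l 0 \<ge> e * (2 / 3)" using tilted_moment_even_at_0(1)[of l 1] by (simp add: e_def)
    moreover have "tilted_moment 0 l 0 \<le> 2"
      using tilted_moment_even_at_0(2)[of 0 l] by simp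
    ultimately have "tilted_moment 2 l 0 \<ge> 333/1000 * tilted_moment 0 l 0" using e1 by argo
    then have "tilted_mean 2 l 0 \<ge> 333 / 1000"
      unfolding tilted_mean_def using tilted_moment0_pos[of l 0] by (simp add: le_divide_eq)
    then show ?thesis using tilted_mean_lipschitz[OF l(1), of 2 s] by (simp add: m_def t_def)
  qed
  have m1: "\<bar>m 1\<bar> \<le> 2 * t" using tilted_mean_lipschitz[OF l(1), of 1 s] by (simp add: m_def t_def tilted_mean_odd_at_0)
  have m3: "\<bar>m 3\<bar> \<le> 2 * t" using tilted_mean_lipschitz[OF l(1), of 3 s] by (simp add: m_def t_def tilted_mean_odd_at_0)
  have b: "\<bar>m k\<bar> \<le> 1" for k by (simp add: m_def tilted_mean_abs_le)
  have "- (m 3 * m 1) \<le> \<bar>m 3 * m 1\<bar>" by simp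
  also have "\<dots> \<le> 2 * t * 1" unfolding abs_mult using t by (intro mult_mono m3 b) auto
  finally have i1: "- (m 3 * m 1) \<le> 2 * t" by simp
  have i2: "(m 2)\<^sup>2 \<ge> (333/1000)\<^sup>2 - 4 * t"
  proof (cases "m 2 \<ge> 333/1000")
    case True
    then have "(m 2)\<^sup>2 \<ge> (333/1000)\<^sup>2" by (intro power_mono) auto
    then show ?thesis using t by simp
  next
    case False
    have "(333/1000)\<^sup>2 - (m 2)\<^sup>2 = (333/1000 - m 2) * (333/1000 + m 2)" by (simp add: power2_eq_square algebra_simps)
    also have "\<dots> \<le> (333/1000 - m 2) * 2"
      using False b[of 2] by (intro mult_left_mono) (auto simp: abs_le_iff)
    also have "\<dots> \<le> (2 * t) * 2"
      using m2 by (intro mult_right_mono) auto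
    finally show ?thesis by simp
  qed
  have "m 2 * (m 1)\<^sup>2 \<le> \<bar>m 2 * m 1 * m 1\<bar>" by (simp add: power2_eq_square mult.assoc)
  also have "\<dots> \<le> 1 * (2 * t) * 1" unfolding abs_mult using t by (intro mult_mono m1 b) auto
  finally have i3: "m 2 * (m 1)\<^sup>2 \<le> 2 * t" by simp
  have i4: "(m 1) ^ 4 \<ge> 0" by simp
  have "tilted_cumulant4 l s = m 4 + 4 * (- (m 3 * m 1)) - 3 * (m 2)\<^sup>2 + 12 * (m 2 * (m 1)\<^sup>2) - 6 * (m 1) ^ 4"
    by (simp add: tilted_cumulant4_def m_def)
  also have "\<dots> \<le> 201/1000 - 3 * (333/1000)\<^sup>2 + 46 * t"
    using m4 i1 i2 i3 i4 by argo
  also have "\<dots> \<le> - 13/100 + 46 * t" by (simp add: power2_eq_square)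
  finally show ?thesis by (simp add: t_def)
qed

section \<open>Gaussian integration by parts\<close>

definition gauss_density :: "nat \<Rightarrow> (nat \<Rightarrow> real) \<Rightarrow> real"
  where "gauss_density n x = (\<Prod>k<n. std_normal_density (x k))"

definition gauss_expect :: "nat \<Rightarrow> ((nat \<Rightarrow> real) \<Rightarrow> real) \<Rightarrow> real"
  where "gauss_expect n F = (\<integral>x. F x * gauss_density n x \<partial>PiL n)"

text \<open>
  A class of functions on \<open>\<real>\<^sup>n\<close> that is closed under sums and products and whose members are integrable
  against the Gaussian density; all expectations below are taken in it.
\<close>

definition moderate :: "nat \<Rightarrow> ((nat \<Rightarrow> real) \<Rightarrow> real) \<Rightarrow> bool"
  where "moderate n F \<longleftrightarrow> F \<in> borel_measurable (PiL n) \<and>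
    (\<exists>C\<ge>0. \<exists>a\<ge>0. \<forall>x. \<bar>F x\<bar> \<le> C * exp (a * (\<Sum>k<n. \<bar>x k\<bar>)))"

lemma gauss_density_nonneg [simp]: "0 \<le> gauss_density n x"
  by (simp add: gauss_density_def prod_nonneg)

lemma measurable_PiL_coord: "k < n \<Longrightarrow> (\<lambda>x. x k) \<in> borel_measurable (PiL n)"
proof -
  assume "k < n"
  then have "(\<lambda>x. x k) \<in> measurable (PiL n) lborel" by (intro measurable_component_singleton) simp
  then show ?thesis by simp
qed

lemma measurable_gauss_density [measurable]: "gauss_density n \<in> borel_measurable (PiL n)"
  unfolding gauss_density_def
  by (intro borel_measurable_prod measurable_compose[OF measurable_PiL_coord]) auto

lemma moderateI:
  assumes "F \<in> borel_measurable (PiL n)" "0 \<le> a" "\<And>x. \<bar>F x\<bar> \<le> C * exp (a * (\<Sum>k<n. \<bar>x k\<bar>))"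
  shows "moderate n F"
proof -
  have "\<bar>F x\<bar> \<le> \<bar>C\<bar> * exp (a * (\<Sum>k<n. \<bar>x k\<bar>))" for x
    by (rule order_trans[OF assms(3)]) (intro mult_right_mono, auto)
  then show ?thesis unfolding moderate_def using assms(1,2) by (intro conjI exI[of _ "\<bar>C\<bar>"] exI[of _ a]) auto
qed

lemma moderate_bounded:
  "F \<in> borel_measurable (PiL n) \<Longrightarrow> (\<And>x. \<bar>F x\<bar> \<le> C) \<Longrightarrow> moderate n F"
  by (rule moderateI[of _ _ 0 C]) auto

lemma moderate_const [simp]: "moderate n (\<lambda>_. c)"
  by (rule moderate_bounded[of _ _ "\<bar>c\<bar>"]) auto

lemma moderate_add:
  assumes "moderate n F" "moderate n G"
  shows "moderate n (\<lambda>x. F x + G x)"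
proof -
  obtain C a where F: "F \<in> borel_measurable (PiL n)" "C \<ge> 0" "a \<ge> 0" "\<And>x. \<bar>F x\<bar> \<le> C * exp (a * (\<Sum>k<n. \<bar>x k\<bar>))"
    using assms(1) by (auto simp: moderate_def)
  obtain D b where G: "G \<in> borel_measurable (PiL n)" "D \<ge> 0" "b \<ge> 0" "\<And>x. \<bar>G x\<bar> \<le> D * exp (b * (\<Sum>k<n. \<bar>x k\<bar>))"
    using assms(2) by (auto simp: moderate_def)
  show ?thesis
  proof (rule moderateI[of _ _ "max a b" "C + D"])
    show "(\<lambda>x. F x + G x) \<in> borel_measurable (PiL n)" using F G by measurable
    fix x :: "nat \<Rightarrow> real"
    let ?s = "\<Sum>k<n. \<bar>x k\<bar>"
    have s: "0 \<le> ?s" by (intro sum_nonneg) auto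
    have "\<bar>F x + G x\<bar> \<le> C * exp (a * ?s) + D * exp (b * ?s)" using F(4)[of x] G(4)[of x] by linarith
    also have "\<dots> \<le> C * exp (max a b * ?s) + D * exp (max a b * ?s)"
      using s F(2) G(2) by (intro add_mono mult_left_mono) (auto intro!: mult_right_mono)
    finally show "\<bar>F x + G x\<bar> \<le> (C + D) * exp (max a b * ?s)" by (simp add: algebra_simps)
  qed (use F(3) in auto)
qed

lemma moderate_mult:
  assumes "moderate n F" "moderate n G"
  shows "moderate n (\<lambda>x. F x * G x)"
proof -
  obtain C a where F: "F \<in> borel_measurable (PiL n)" "C \<ge> 0" "a \<ge> 0" "\<And>x. \<bar>F x\<bar> \<le> C * exp (a * (\<Sum>k<n. \<bar>x k\<bar>))"
    using assms(1) by (auto simp: moderate_def)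
  obtain D b where G: "G \<in> borel_measurable (PiL n)" "D \<ge> 0" "b \<ge> 0" "\<And>x. \<bar>G x\<bar> \<le> D * exp (b * (\<Sum>k<n. \<bar>x k\<bar>))"
    using assms(2) by (auto simp: moderate_def)
  show ?thesis
  proof (rule moderateI[of _ _ "a + b" "C * D"])
    show "(\<lambda>x. F x * G x) \<in> borel_measurable (PiL n)" using F G by measurable
    fix x :: "nat \<Rightarrow> real"
    let ?s = "\<Sum>k<n. \<bar>x k\<bar>"
    have "\<bar>F x * G x\<bar> \<le> (C * exp (a * ?s)) * (D * exp (b * ?s))"
      unfolding abs_mult using F(2) by (intro mult_mono F G) auto
    then show "\<bar>F x * G x\<bar> \<le> C * D * exp ((a + b) * ?s)" by (simp add: distrib_right exp_add mult_ac)
  qed (use F(3) G(3) in auto)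
qed

lemma moderate_minus: "moderate n F \<Longrightarrow> moderate n (\<lambda>x. - F x)"
  using moderate_mult[of n "\<lambda>_. -1" F] by simp

lemma moderate_diff: "moderate n F \<Longrightarrow> moderate n G \<Longrightarrow> moderate n (\<lambda>x. F x - G x)"
  using moderate_add[of n F "\<lambda>x. - G x"] moderate_minus[of n G] by simp

lemma moderate_sum: "(\<And>i. i \<in> I \<Longrightarrow> moderate n (F i)) \<Longrightarrow> moderate n (\<lambda>x. \<Sum>i\<in>I. F i x)"
  by (induction I rule: infinite_finite_induct) (auto intro!: moderate_add)

lemma moderate_power: "moderate n F \<Longrightarrow> moderate n (\<lambda>x. F x ^ k)"
  by (induction k) (auto intro!: moderate_mult)

lemma moderate_coord:
  assumes "k < n" shows "moderate n (\<lambda>x. x k)"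
proof (rule moderateI[of _ _ 1 1])
  fix x :: "nat \<Rightarrow> real"
  have "\<bar>x k\<bar> \<le> (\<Sum>k<n. \<bar>x k\<bar>)" using assms by (intro member_le_sum) auto
  also have "\<dots> \<le> exp (\<Sum>k<n. \<bar>x k\<bar>)" using exp_ge_add_one_self[of "\<Sum>k<n. \<bar>x k\<bar>"] by linarith
  finally show "\<bar>x k\<bar> \<le> 1 * exp (1 * (\<Sum>k<n. \<bar>x k\<bar>))" by simp
qed (use measurable_PiL_coord[OF assms] in auto)

text \<open>
  Completing the square turns \<open>e\<^sup>a\<^sup>x\<close> times the normal density into a multiple of a shifted normal density,
  and \<open>exp (a|x|) \<le> exp (a x) + exp (- a x)\<close>.
\<close>

lemma integrable_exp_abs_normal: "integrable lborel (\<lambda>x::real. exp (a * \<bar>x\<bar>) * std_normal_density x)"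
proof -
  have e: "exp (b * x) * std_normal_density x = exp (b\<^sup>2 / 2) * normal_density b 1 x" for b x :: real
  proof -
    have "b * x - x\<^sup>2 / 2 = b\<^sup>2 / 2 - (x - b)\<^sup>2 / 2" by (simp add: power2_eq_square field_simps)
    then have "exp (b * x) * exp (- x\<^sup>2 / 2) = exp (b\<^sup>2 / 2) * exp (- (x - b)\<^sup>2 / 2)" by (simp flip: exp_add)
    then show ?thesis by (simp add: normal_density_def)
  qed
  have "integrable lborel (\<lambda>x. exp (a * x) * std_normal_density x + exp ((-a) * x) * std_normal_density x)"
    unfolding e by (intro Bochner_Integration.integrable_add integrable_mult_right) auto
  then show ?thesis
  proof (rule Bochner_Integration.integrable_bound)
    show "AE x in lborel. norm (exp (a * \<bar>x\<bar>) * std_normal_density x)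
      \<le> norm (exp (a * x) * std_normal_density x + exp ((-a) * x) * std_normal_density x)"
    proof (rule AE_I2)
      fix x :: real
      have "0 \<le> exp (a * x) * std_normal_density x" "0 \<le> exp ((-a) * x) * std_normal_density x" by auto
      then show "norm (exp (a * \<bar>x\<bar>) * std_normal_density x)
        \<le> norm (exp (a * x) * std_normal_density x + exp ((-a) * x) * std_normal_density x)"
        by (cases "x \<ge> 0") auto
    qed
  qed auto
qed

lemma integrable_moderate:
  assumes "moderate n F"
  shows "integrable (PiL n) (\<lambda>x. F x * gauss_density n x)"
proof -
  interpret product_sigma_finite "\<lambda>_::nat. lborel :: real measure" by (rule product_sigma_finite_lborel)
  obtain C a where F: "F \<in> borel_measurable (PiL n)" "C \<ge> 0" "a \<ge> 0" "\<And>x. \<bar>F x\<bar> \<le> C * exp (a * (\<Sum>k<n. \<bar>x k\<bar>))"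
    using assms(1) by (auto simp: moderate_def)
  have "integrable (PiL n) (\<lambda>x. \<Prod>k<n. exp (a * \<bar>x k\<bar>) * std_normal_density (x k))"
    by (intro product_integrable_prod integrable_exp_abs_normal) auto
  then have "integrable (PiL n) (\<lambda>x. C * (\<Prod>k<n. exp (a * \<bar>x k\<bar>) * std_normal_density (x k)))"
    by (rule integrable_mult_right)
  then show ?thesis
  proof (rule Bochner_Integration.integrable_bound)
    show "(\<lambda>x. F x * gauss_density n x) \<in> borel_measurable (PiL n)" using F by measurable
    show "AE x in PiL n. norm (F x * gauss_density n x) \<le> norm (C * (\<Prod>k<n. exp (a * \<bar>x k\<bar>) * std_normal_density (x k)))"
    proof (rule AE_I2)
      fix x
      have "norm (F x * gauss_density n x) \<le> C * exp (a * (\<Sum>k<n. \<bar>x k\<bar>)) * gauss_density n x"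
        using F(4)[of x] by (simp add: abs_mult mult_right_mono)
      also have "\<dots> = C * (\<Prod>k<n. exp (a * \<bar>x k\<bar>) * std_normal_density (x k))"
        by (simp add: gauss_density_def prod.distrib exp_sum sum_distrib_left)
      also have "\<dots> \<le> norm (C * (\<Prod>k<n. exp (a * \<bar>x k\<bar>) * std_normal_density (x k)))" by simp
      finally show "norm (F x * gauss_density n x) \<le> norm (C * (\<Prod>k<n. exp (a * \<bar>x k\<bar>) * std_normal_density (x k)))" .
    qed
  qed
qed

lemma gauss_expect_add:
  "moderate n F \<Longrightarrow> moderate n G \<Longrightarrow> gauss_expect n (\<lambda>x. F x + G x) = gauss_expect n F + gauss_expect n G"
  unfolding gauss_expect_def distrib_right by (intro Bochner_Integration.integral_add integrable_moderate)

lemma gauss_expect_diff: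
  "moderate n F \<Longrightarrow> moderate n G \<Longrightarrow> gauss_expect n (\<lambda>x. F x - G x) = gauss_expect n F - gauss_expect n G"
  unfolding gauss_expect_def left_diff_distrib by (intro Bochner_Integration.integral_diff integrable_moderate)

lemma gauss_expect_cmult: "gauss_expect n (\<lambda>x. c * F x) = c * gauss_expect n F"
  unfolding gauss_expect_def mult.assoc by simp

lemma gauss_expect_sum:
  assumes "\<And>i. i \<in> I \<Longrightarrow> moderate n (F i)"
  shows "gauss_expect n (\<lambda>x. \<Sum>i\<in>I. F i x) = (\<Sum>i\<in>I. gauss_expect n (F i))"
  unfolding gauss_expect_def sum_distrib_right using assms by (intro Bochner_Integration.integral_sum integrable_moderate)

lemma gauss_expect_mono:
  "moderate n F \<Longrightarrow> moderate n G \<Longrightarrow> (\<And>x. F x \<le> G x) \<Longrightarrow> gauss_expect n F \<le> gauss_expect n G"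
  unfolding gauss_expect_def by (intro integral_mono integrable_moderate mult_right_mono) auto

lemma gauss_expect_const: "gauss_expect n (\<lambda>_. c) = c"
proof -
  interpret product_sigma_finite "\<lambda>_::nat. lborel :: real measure" by (rule product_sigma_finite_lborel)
  have "(\<integral>x. gauss_density n x \<partial>PiL n) = 1"
    unfolding gauss_density_def by (subst product_integral_prod) auto
  then show ?thesis by (simp add: gauss_expect_def)
qed

lemma std_normal_density_exp_tendsto_0:
  "((\<lambda>x::real. exp (a * x) * std_normal_density x) \<longlongrightarrow> 0) at_top"
  unfolding std_normal_density_def
  by (cases a "0::real" rule: linorder_cases; real_asymp)

text \<open>
  If \<open>\<phi>\<close> is the normal density, then \<open>(f \<phi>)' = (f' - x f) \<phi>\<close>, and \<open>f \<phi>\<close> vanishes at infinity by the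
  growth condition.
\<close>

lemma normal_integral_by_parts:
  fixes f f' :: "real \<Rightarrow> real"
  assumes f: "\<And>x. (f has_field_derivative f' x) (at x)" and cont: "continuous_on UNIV f'"
    and bf: "\<And>x. \<bar>f x\<bar> \<le> C * exp (a * \<bar>x\<bar>)" and bf': "\<And>x. \<bar>f' x\<bar> \<le> C * exp (a * \<bar>x\<bar>)"
  shows "(\<integral>x. (x * f x - f' x) * std_normal_density x \<partial>lborel) = 0"
proof -
  define g where "g = (\<lambda>x. f x * std_normal_density x)"
  define g' where "g' = (\<lambda>x. (f' x - x * f x) * std_normal_density x)"
  have contf: "continuous_on UNIV f" by (rule DERIV_continuous_on[OF has_field_derivative_at_within[OF f]])
  have dn: "(std_normal_density has_field_derivative - x * std_normal_density x) (at x)" for x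
  proof -
    have "((\<lambda>x. c * exp (- x\<^sup>2 / 2)) has_field_derivative - x * (c * exp (- x\<^sup>2 / 2))) (at x)" for c
      by (auto intro!: derivative_eq_intros)
    then show ?thesis unfolding std_normal_density_def[abs_def] .
  qed
  have dg: "(g has_field_derivative g' x) (at x)" for x
    unfolding g_def g'_def by (rule DERIV_cong[OF DERIV_mult[OF f dn]]) (simp add: algebra_simps)
  have contn: "continuous_on UNIV std_normal_density"
    by (rule DERIV_continuous_on[OF has_field_derivative_at_within[OF dn]])
  have contg': "continuous_on UNIV g'"
    unfolding g'_def by (intro continuous_intros contf cont contn)
  have C: "C \<ge> 0" using order_trans[OF abs_ge_zero bf[of 0]] by simp
  have intg': "integrable lborel g'"
  proof (rule Bochner_Integration.integrable_bound)
    show "integrable lborel (\<lambda>x. 2 * C * (exp ((a + 1) * \<bar>x\<bar>) * std_normal_density x))"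
      by (intro integrable_mult_right integrable_exp_abs_normal)
    show "g' \<in> borel_measurable lborel" using contg' by (simp add: borel_measurable_continuous_onI)
    show "AE x in lborel. norm (g' x) \<le> norm (2 * C * (exp ((a + 1) * \<bar>x\<bar>) * std_normal_density x))"
    proof (rule AE_I2)
      fix x :: real
      have e: "1 \<le> exp \<bar>x\<bar>" "\<bar>x\<bar> \<le> exp \<bar>x\<bar>" using exp_ge_add_one_self[of "\<bar>x\<bar>"] by linarith+
      have "\<bar>f' x - x * f x\<bar> \<le> \<bar>f' x\<bar> * 1 + \<bar>x\<bar> * \<bar>f x\<bar>"
        using abs_triangle_ineq4[of "f' x" "x * f x"] by (simp add: abs_mult)
      also have "\<dots> \<le> (C * exp (a * \<bar>x\<bar>)) * exp \<bar>x\<bar> + exp \<bar>x\<bar> * (C * exp (a * \<bar>x\<bar>))"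
        using C e by (intro add_mono mult_mono bf bf') auto
      also have "\<dots> = 2 * C * exp ((a + 1) * \<bar>x\<bar>)" by (simp add: distrib_right exp_add)
      finally have "\<bar>f' x - x * f x\<bar> * std_normal_density x \<le> 2 * C * exp ((a + 1) * \<bar>x\<bar>) * std_normal_density x"
        by (intro mult_right_mono) auto
      then show "norm (g' x) \<le> norm (2 * C * (exp ((a + 1) * \<bar>x\<bar>) * std_normal_density x))"
        using C by (simp add: g'_def abs_mult)
    qed
  qed
  have top: "(g \<longlongrightarrow> 0) at_top"
  proof (rule Lim_null_comparison)
    show "\<forall>\<^sub>F x in at_top. norm (g x) \<le> C * (exp (a * x) * std_normal_density x)"
      using eventually_ge_at_top[of 0]
    proof eventually_elim
      case (elim x)
      have "norm (g x) \<le> C * exp (a * \<bar>x\<bar>) * std_normal_density x"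
        unfolding g_def using bf[of x] by (simp add: abs_mult mult_right_mono)
      with elim show ?case by simp
    qed
    show "((\<lambda>x. C * (exp (a * x) * std_normal_density x)) \<longlongrightarrow> 0) at_top"
      using tendsto_mult_right_zero[OF std_normal_density_exp_tendsto_0] .
  qed
  have "((\<lambda>x. g (- x)) \<longlongrightarrow> 0) at_top"
  proof (rule Lim_null_comparison)
    show "\<forall>\<^sub>F x in at_top. norm (g (-x)) \<le> C * (exp (a * x) * std_normal_density x)"
      using eventually_ge_at_top[of 0]
    proof eventually_elim
      case (elim x)
      have "norm (g (-x)) \<le> C * exp (a * \<bar>-x\<bar>) * std_normal_density (-x)"
        unfolding g_def using bf[of "-x"] by (simp add: abs_mult mult_right_mono)
      with elim show ?case by (simp add: std_normal_density_def)
    qed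
    show "((\<lambda>x. C * (exp (a * x) * std_normal_density x)) \<longlongrightarrow> 0) at_top"
      using tendsto_mult_right_zero[OF std_normal_density_exp_tendsto_0] .
  qed
  then have bot: "(g \<longlongrightarrow> 0) at_bot" by (simp add: filterlim_at_bot_mirror)
  have "(LBINT x=-\<infinity>..\<infinity>. g' x) = 0 - 0"
  proof (rule interval_integral_FTC_integrable[where F = g])
    show "(g has_vector_derivative g' x) (at x)" for x
      using dg by (simp add: has_real_derivative_iff_has_vector_derivative)
    show "isCont g' x" for x using contg' by (simp add: continuous_on_eq_continuous_at)
    show "set_integrable lborel (einterval (-\<infinity>) \<infinity>) g'" using intg' by (simp add: set_integrable_def)
    show "((g \<circ> real_of_ereal) \<longlongrightarrow> 0) (at_right (-\<infinity>))" using bot by (simp add: ereal_tendsto_simps)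
    show "((g \<circ> real_of_ereal) \<longlongrightarrow> 0) (at_left \<infinity>)" using top by (simp add: ereal_tendsto_simps)
  qed simp
  then have "(\<integral>x. g' x \<partial>lborel) = 0"
    by (simp add: interval_lebesgue_integral_def set_lebesgue_integral_def)
  then have "(\<integral>x. - g' x \<partial>lborel) = 0" by simp
  also have "(\<lambda>x. - g' x) = (\<lambda>x. (x * f x - f' x) * std_normal_density x)"
    by (simp add: g'_def fun_eq_iff algebra_simps)
  finally show ?thesis .
qed

text \<open>
  Stein's identity in the coordinate \<open>k\<close>; Fubini reduces it to the one-dimensional case.
\<close>

lemma gauss_integral_by_parts:
  assumes k: "k < n" and F: "moderate n F" and F': "moderate n F'"
    and d: "\<And>x s. ((\<lambda>s. F (x(k := s))) has_field_derivative F' (x(k := s))) (at s)"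
    and c: "\<And>x. continuous_on UNIV (\<lambda>s. F' (x(k := s)))"
  shows "gauss_expect n (\<lambda>x. x k * F x) = gauss_expect n F'"
proof -
  interpret product_sigma_finite "\<lambda>_::nat. lborel :: real measure" by (rule product_sigma_finite_lborel)
  define I where "I = {..<n} - {k}"
  have I: "finite I" "k \<notin> I" "insert k I = {..<n}" using k by (auto simp: I_def)
  obtain C a where B: "C \<ge> 0" "a \<ge> 0" "\<And>x. \<bar>F x\<bar> \<le> C * exp (a * (\<Sum>k<n. \<bar>x k\<bar>))"
    using F by (auto simp: moderate_def)
  obtain C' a' where B': "C' \<ge> 0" "a' \<ge> 0" "\<And>x. \<bar>F' x\<bar> \<le> C' * exp (a' * (\<Sum>k<n. \<bar>x k\<bar>))"
    using F' by (auto simp: moderate_def)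
  have gd: "gauss_density n (x(k := s)) = (\<Prod>j\<in>I. std_normal_density (x j)) * std_normal_density s" for x s
    unfolding gauss_density_def I(3)[symmetric] using I(1,2)
    by (subst prod.insert) (auto intro!: prod.cong)
  have sm: "(\<Sum>j<n. \<bar>(x(k := s)) j\<bar>) = \<bar>s\<bar> + (\<Sum>j\<in>I. \<bar>x j\<bar>)" for x s
  proof -
    have "(\<Sum>j\<in>I. \<bar>(x(k := s)) j\<bar>) = (\<Sum>j\<in>I. \<bar>x j\<bar>)" using I(2) by (intro sum.cong) auto
    then show ?thesis unfolding I(3)[symmetric] using I(1,2) by (subst sum.insert) simp_all
  qed
  have m: "moderate n (\<lambda>x. x k * F x - F' x)" by (intro moderate_diff moderate_mult moderate_coord k F F')
  have "gauss_expect n (\<lambda>x. x k * F x - F' x) = (\<integral>x. (x k * F x - F' x) * gauss_density n x \<partial>PiM (insert k I) (\<lambda>_. lborel))"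
    unfolding gauss_expect_def I(3) ..
  also have "\<dots> = (\<integral>x. (\<integral>s. (s * F (x(k := s)) - F' (x(k := s))) * gauss_density n (x(k := s)) \<partial>lborel) \<partial>PiM I (\<lambda>_. lborel))"
    using product_integral_insert[OF I(1,2), of "\<lambda>x. (x k * F x - F' x) * gauss_density n x"] integrable_moderate[OF m]
    unfolding I(3) by simp
  also have "\<dots> = (\<integral>x. 0 \<partial>(PiM I (\<lambda>_. lborel) :: (nat \<Rightarrow> real) measure))"
  proof (rule Bochner_Integration.integral_cong[OF refl])
    fix x :: "nat \<Rightarrow> real"
    let ?S = "\<Sum>j\<in>I. \<bar>x j\<bar>"
    let ?C = "C * exp (a * ?S) + C' * exp (a' * ?S)"
    have "(\<integral>s. (s * F (x(k := s)) - F' (x(k := s))) * std_normal_density s \<partial>lborel) = 0"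
    proof (rule normal_integral_by_parts[OF d c])
      fix s :: real
      have e: "exp (b * (\<bar>s\<bar> + ?S)) \<le> exp (b * ?S) * exp (max a a' * \<bar>s\<bar>)" if "b \<le> max a a'" for b
      proof -
        have "b * \<bar>s\<bar> \<le> max a a' * \<bar>s\<bar>" using that by (intro mult_right_mono) auto
        then show ?thesis by (simp flip: exp_add add: distrib_left)
      qed
      have "C * exp (a * (\<bar>s\<bar> + ?S)) \<le> C * (exp (a * ?S) * exp (max a a' * \<bar>s\<bar>))"
        using B(1) by (intro mult_left_mono e) auto
      moreover have "C' * exp (a' * (\<bar>s\<bar> + ?S)) \<le> C' * (exp (a' * ?S) * exp (max a a' * \<bar>s\<bar>))"
        using B'(1) by (intro mult_left_mono e) auto
      moreover have "0 \<le> C * (exp (a * ?S) * exp (max a a' * \<bar>s\<bar>))" "0 \<le> C' * (exp (a' * ?S) * exp (max a a' * \<bar>s\<bar>))"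
        using B(1) B'(1) by auto
      ultimately show "\<bar>F (x(k := s))\<bar> \<le> ?C * exp (max a a' * \<bar>s\<bar>)" "\<bar>F' (x(k := s))\<bar> \<le> ?C * exp (max a a' * \<bar>s\<bar>)"
        using B(3)[of "x(k := s)"] B'(3)[of "x(k := s)"] unfolding sm by (simp_all add: distrib_right mult.assoc)
    qed
    then have "(\<Prod>j\<in>I. std_normal_density (x j)) * (\<integral>s. (s * F (x(k := s)) - F' (x(k := s))) * std_normal_density s \<partial>lborel) = 0"
      by simp
    then have "(\<integral>s. (\<Prod>j\<in>I. std_normal_density (x j)) * ((s * F (x(k := s)) - F' (x(k := s))) * std_normal_density s) \<partial>lborel) = 0"
      by simp
    then show "(\<integral>s. (s * F (x(k := s)) - F' (x(k := s))) * gauss_density n (x(k := s)) \<partial>lborel) = 0"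
      unfolding gd by (simp only: mult_ac)
  qed
  finally have "gauss_expect n (\<lambda>x. x k * F x - F' x) = 0" by simp
  then show ?thesis
    using gauss_expect_diff[of n "\<lambda>x. x k * F x" F'] by (simp add: moderate_mult moderate_coord k F F')
qed

section \<open>Decompositions of the identity and their defect\<close>

text \<open>
  A growth condition on functions of one variable under which their compositions with the linear
  functionals \<open>coeff i\<close> are \<open>moderate\<close>.
\<close>

definition exp_bounded :: "(real \<Rightarrow> real) \<Rightarrow> bool"
  where "exp_bounded a \<longleftrightarrow> continuous_on UNIV a \<and> (\<exists>C\<ge>0. \<exists>b\<ge>0. \<forall>s. \<bar>a s\<bar> \<le> C * exp (b * \<bar>s\<bar>))"

lemma exp_bounded_bounded:
  assumes "continuous_on UNIV a" "\<And>s. \<bar>a s\<bar> \<le> C"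
  shows "exp_bounded a"
proof -
  have "C \<ge> 0" using assms(2)[of 0] by linarith
  then show ?thesis using assms unfolding exp_bounded_def by (intro conjI exI[of _ C] exI[of _ "0::real"]) auto
qed

lemma exp_bounded_const [simp]: "exp_bounded (\<lambda>_. c)"
  by (rule exp_bounded_bounded[of _ "\<bar>c\<bar>"]) auto

lemma exp_bounded_mult:
  assumes "exp_bounded f" "exp_bounded g" shows "exp_bounded (\<lambda>s. f s * g s)"
proof -
  obtain C a where F: "continuous_on UNIV f" "C \<ge> 0" "a \<ge> 0" "\<And>x. \<bar>f x\<bar> \<le> C * exp (a * \<bar>x\<bar>)"
    using assms(1) by (auto simp: exp_bounded_def)
  obtain D b where G: "continuous_on UNIV g" "D \<ge> 0" "b \<ge> 0" "\<And>x. \<bar>g x\<bar> \<le> D * exp (b * \<bar>x\<bar>)"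
    using assms(2) by (auto simp: exp_bounded_def)
  have "\<bar>f x * g x\<bar> \<le> C * D * exp ((a + b) * \<bar>x\<bar>)" for x
  proof -
    have "\<bar>f x * g x\<bar> \<le> (C * exp (a * \<bar>x\<bar>)) * (D * exp (b * \<bar>x\<bar>))"
      unfolding abs_mult using F(2) by (intro mult_mono F G) auto
    moreover have "exp ((a + b) * \<bar>x\<bar>) = exp (a * \<bar>x\<bar>) * exp (b * \<bar>x\<bar>)"
      by (simp add: distrib_right exp_add)
    ultimately show ?thesis by (simp only: mult_ac)
  qed
  then show ?thesis unfolding exp_bounded_def using F G
    by (intro conjI exI[of _ "C * D"] exI[of _ "a + b"]) (auto intro!: continuous_intros)
qed

lemma exp_bounded_ident: "exp_bounded (\<lambda>s. s)"
  unfolding exp_bounded_def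
proof (intro conjI exI[of _ "1::real"] allI)
  fix s :: real
  show "\<bar>s\<bar> \<le> 1 * exp (1 * \<bar>s\<bar>)" using exp_ge_add_one_self[of "\<bar>s\<bar>"] unfolding mult_1 by linarith
qed auto

lemma exp_bounded_power: "exp_bounded (\<lambda>s. s ^ k)"
  by (induction k) (auto intro!: exp_bounded_mult exp_bounded_ident)

text \<open>
  The contact points and weights of John's theorem: unit vectors \<open>u\<^sub>i\<close> with \<open>\<Sum> c\<^sub>i u\<^sub>i \<otimes> u\<^sub>i\<close> equal to
  the identity. In the space of functions on \<open>I\<close> with the inner product weighted by \<open>c\<close>, the analysis map
  \<open>coeff\<close> is then an isometry of \<open>\<real>\<^sup>n\<close> and \<open>synth\<close> is its adjoint. Thus \<open>defect f g\<close> is the inner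
  product of the components of \<open>f\<close> and \<open>g\<close> orthogonal to the range of \<open>coeff\<close>. The number
  \<open>frame_defect\<close> is zero exactly if any two of the vectors are orthogonal, equal or opposite, as for
  the contact points of a cube.
\<close>

locale weighted_frame =
  fixes n :: nat and I :: "'i set" and c :: "'i \<Rightarrow> real" and u :: "'i \<Rightarrow> nat \<Rightarrow> real"
  assumes finite_I: "finite I"
    and weight_pos: "i \<in> I \<Longrightarrow> 0 < c i"
    and unit: "i \<in> I \<Longrightarrow> (\<Sum>k<n. (u i k)\<^sup>2) = 1"
    and frame: "j < n \<Longrightarrow> k < n \<Longrightarrow> (\<Sum>i\<in>I. c i * u i j * u i k) = (if j = k then 1 else 0)"
begin

definition coeff :: "'i \<Rightarrow> (nat \<Rightarrow> real) \<Rightarrow> real" where "coeff i x = (\<Sum>k<n. u i k * x k)"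
definition gram :: "'i \<Rightarrow> 'i \<Rightarrow> real" where "gram i j = (\<Sum>k<n. u i k * u j k)"
definition synth :: "('i \<Rightarrow> real) \<Rightarrow> nat \<Rightarrow> real" where "synth f k = (\<Sum>i\<in>I. c i * f i * u i k)"
definition defect :: "('i \<Rightarrow> real) \<Rightarrow> ('i \<Rightarrow> real) \<Rightarrow> real"
  where "defect f g = (\<Sum>i\<in>I. c i * f i * g i) - (\<Sum>k<n. synth f k * synth g k)"
definition frame_defect :: real
  where "frame_defect = (\<Sum>i\<in>I. \<Sum>j\<in>I. c i * c j * ((gram i j)\<^sup>2 - (gram i j) ^ 4))"

lemma gram_sym: "gram i j = gram j i" by (simp add: gram_def mult.commute)
lemma gram_self: "i \<in> I \<Longrightarrow> gram i i = 1" using unit by (simp add: gram_def power2_eq_square)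
lemma gram_coeff: "gram i j = coeff i (u j)" by (simp add: gram_def coeff_def)

lemma sum_weight: "(\<Sum>i\<in>I. c i) = real n"
proof -
  have "(\<Sum>i\<in>I. c i) = (\<Sum>i\<in>I. c i * (\<Sum>k<n. (u i k)\<^sup>2))" by (intro sum.cong) (auto simp: unit)
  also have "\<dots> = (\<Sum>k<n. \<Sum>i\<in>I. c i * u i k * u i k)"
    by (subst sum.swap) (simp add: sum_distrib_left power2_eq_square mult.assoc)
  also have "\<dots> = real n" by (simp add: frame)
  finally show ?thesis .
qed

lemma parseval: "(\<Sum>i\<in>I. c i * coeff i x * coeff i y) = (\<Sum>k<n. x k * y k)"
proof -
  have "(\<Sum>i\<in>I. c i * coeff i x * coeff i y) = (\<Sum>i\<in>I. \<Sum>j<n. \<Sum>k<n. (c i * u i j * u i k) * (x j * y k))"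
    unfolding coeff_def mult.assoc sum_product by (simp add: sum_distrib_left mult_ac)
  also have "\<dots> = (\<Sum>j<n. \<Sum>k<n. (\<Sum>i\<in>I. c i * u i j * u i k) * (x j * y k))"
    unfolding sum_distrib_right by (subst sum.swap) (intro sum.cong refl, rule sum.swap)
  also have "\<dots> = (\<Sum>j<n. \<Sum>k<n. if j = k then x j * y k else 0)"
    by (intro sum.cong refl) (auto simp: frame)
  finally show ?thesis by simp
qed

lemma sum_gram_sq: "j \<in> I \<Longrightarrow> (\<Sum>i\<in>I. c i * (gram j i)\<^sup>2) = 1"
proof -
  assume j: "j \<in> I"
  have "gram j i = coeff i (u j)" for i by (metis gram_sym gram_coeff)
  then show ?thesis using parseval[of "u j" "u j"] unit[OF j] by (simp add: power2_eq_square mult.assoc)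
qed

lemma coeff_synth: "(\<Sum>i\<in>I. c i * f i * coeff i x) = (\<Sum>k<n. synth f k * x k)"
  unfolding coeff_def synth_def sum_distrib_left sum_distrib_right
  by (subst sum.swap) (simp add: mult_ac)

lemma synth_pair: "(\<Sum>k<n. synth f k * synth g k) = (\<Sum>i\<in>I. \<Sum>j\<in>I. c i * c j * f i * g j * gram i j)"
proof -
  have "(\<Sum>k<n. synth f k * synth g k) = (\<Sum>i\<in>I. c i * f i * coeff i (synth g))" by (simp add: coeff_synth)
  also have "\<dots> = (\<Sum>i\<in>I. c i * f i * (\<Sum>j\<in>I. c j * g j * coeff j (u i)))"
  proof -
    have "(\<Sum>j\<in>I. c j * g j * coeff j (u i)) = coeff i (synth g)" for i
      unfolding coeff_synth by (simp add: coeff_def mult.commute)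
    then show ?thesis by (simp only:)
  qed
  finally show ?thesis by (simp add: gram_coeff[symmetric] gram_sym sum_distrib_left mult_ac)
qed

text \<open>
  The defect is the squared norm of \<open>f\<close> minus its orthogonal projection.
\<close>

lemma defect_nonneg: "0 \<le> defect f f"
proof -
  have "0 \<le> (\<Sum>i\<in>I. c i * (f i - coeff i (synth f))\<^sup>2)"
    using weight_pos by (intro sum_nonneg mult_nonneg_nonneg) (auto intro: less_imp_le)
  also have "\<dots> = (\<Sum>i\<in>I. c i * f i * f i) - 2 * (\<Sum>i\<in>I. c i * f i * coeff i (synth f)) + (\<Sum>i\<in>I. c i * coeff i (synth f) * coeff i (synth f))"
    by (simp add: power2_eq_square algebra_simps sum.distrib sum_subtractf sum_distrib_left)
  also have "\<dots> = defect f f" by (simp add: defect_def parseval coeff_synth)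
  finally show ?thesis .
qed

text \<open>
  Expand the defect of \<open>f - t g\<close>. The inequality is linear in the two defects that involve \<open>g\<close>, so it
  can be integrated with \<open>f\<close> and \<open>g\<close> random and \<open>t\<close> a constant.
\<close>

lemma defect_ge: "defect f f \<ge> 2 * t * defect f g - t\<^sup>2 * defect g g"
proof -
  have s: "synth (\<lambda>i. f i - t * g i) k = synth f k - t * synth g k" for k
    by (simp add: synth_def algebra_simps sum_subtractf sum_distrib_left)
  have "0 \<le> defect (\<lambda>i. f i - t * g i) (\<lambda>i. f i - t * g i)" by (rule defect_nonneg)
  also have "\<dots> = defect f f - 2 * t * defect f g + t\<^sup>2 * defect g g"
    unfolding defect_def s
    by (simp add: power2_eq_square algebra_simps sum.distrib sum_subtractf sum_distrib_left)
  finally show ?thesis by simp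
qed

lemma abs_u_le: "i \<in> I \<Longrightarrow> k < n \<Longrightarrow> \<bar>u i k\<bar> \<le> 1"
proof -
  assume "i \<in> I" "k < n"
  then have "(u i k)\<^sup>2 \<le> 1" unfolding unit[OF \<open>i \<in> I\<close>, symmetric] by (intro member_le_sum) auto
  then show ?thesis by (simp add: abs_square_le_1)
qed

lemma abs_coeff_le: "i \<in> I \<Longrightarrow> \<bar>coeff i x\<bar> \<le> (\<Sum>k<n. \<bar>x k\<bar>)"
  unfolding coeff_def
  by (rule order_trans[OF sum_abs]) (auto intro!: sum_mono mult_left_le_one_le simp: abs_mult abs_u_le)

lemma gram_sq_le_1: "i \<in> I \<Longrightarrow> j \<in> I \<Longrightarrow> (gram i j)\<^sup>2 \<le> 1"
proof -
  assume ij: "i \<in> I" "j \<in> I"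
  have "(gram i j)\<^sup>2 \<le> (\<Sum>k<n. (u i k)\<^sup>2) * (\<Sum>k<n. (u j k)\<^sup>2)"
    unfolding gram_def by (rule Cauchy_Schwarz_ineq_sum)
  then show ?thesis using ij by (simp add: unit)
qed

lemma gram_term_nonneg: "i \<in> I \<Longrightarrow> j \<in> I \<Longrightarrow> 0 \<le> (gram i j)\<^sup>2 - (gram i j) ^ 4"
proof -
  assume "i \<in> I" "j \<in> I"
  then have "(gram i j)\<^sup>2 * (gram i j)\<^sup>2 \<le> (gram i j)\<^sup>2 * 1" by (intro mult_left_mono gram_sq_le_1) auto
  then show ?thesis by (simp flip: power_add)
qed

lemma measurable_coeff: "coeff i \<in> borel_measurable (PiL n)"
  unfolding coeff_def[abs_def] by (intro borel_measurable_sum borel_measurable_times measurable_PiL_coord) auto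

lemma moderate_coeff_comp:
  assumes "exp_bounded a" "i \<in> I" shows "moderate n (\<lambda>x. a (coeff i x))"
proof -
  obtain C b where F: "continuous_on UNIV a" "C \<ge> 0" "b \<ge> 0" "\<And>x. \<bar>a x\<bar> \<le> C * exp (b * \<bar>x\<bar>)"
    using assms(1) by (auto simp: exp_bounded_def)
  show ?thesis
  proof (rule moderateI[OF _ F(3)])
    show "(\<lambda>x. a (coeff i x)) \<in> borel_measurable (PiL n)"
      using measurable_compose[OF measurable_coeff borel_measurable_continuous_onI[OF F(1)]] .
    fix x
    have "C * exp (b * \<bar>coeff i x\<bar>) \<le> C * exp (b * (\<Sum>k<n. \<bar>x k\<bar>))"
      using F(2,3) abs_coeff_le[OF assms(2)] by (intro mult_left_mono) (auto intro!: mult_left_mono)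
    with F(4) show "\<bar>a (coeff i x)\<bar> \<le> C * exp (b * (\<Sum>k<n. \<bar>x k\<bar>))" by (rule order_trans)
  qed
qed

lemma coeff_update: "k < n \<Longrightarrow> coeff i (x(k := s)) = coeff i x + u i k * (s - x k)"
proof -
  assume k: "k < n"
  have "coeff i (x(k := s)) = u i k * s + (\<Sum>j\<in>{..<n}-{k}. u i j * x j)"
    unfolding coeff_def using k by (subst sum.remove[of _ k]) auto
  moreover have "coeff i x = u i k * x k + (\<Sum>j\<in>{..<n}-{k}. u i j * x j)"
    unfolding coeff_def using k by (subst sum.remove[of _ k]) auto
  ultimately show ?thesis by (simp add: algebra_simps)
qed

lemma coeff_comp_deriv:
  assumes "\<And>s. (a has_field_derivative a' s) (at s)" "k < n"
  shows "((\<lambda>s. a (coeff i (x(k := s)))) has_field_derivative u i k * a' (coeff i (x(k := s)))) (at s)"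
proof -
  have "((\<lambda>s. coeff i x + u i k * (s - x k)) has_field_derivative u i k) (at s)"
    by (auto intro!: derivative_eq_intros)
  from DERIV_chain2[OF assms(1) this]
  show ?thesis unfolding coeff_update[OF assms(2)] by (simp add: mult.commute)
qed

lemma continuous_coeff_comp:
  assumes "continuous_on UNIV a" "k < n"
  shows "continuous_on UNIV (\<lambda>s. a (coeff i (x(k := s))))"
  unfolding coeff_update[OF assms(2)]
  by (rule continuous_on_compose2[OF assms(1)]) (auto intro!: continuous_intros)

text \<open>
  For a standard Gaussian vector \<open>X\<close> the variables \<open>\<langle>u\<^sub>i, X\<rangle>\<close> and \<open>\<langle>u\<^sub>j, X\<rangle>\<close> are jointly Gaussian
  with variances \<open>1\<close> and covariance \<open>gram i j\<close>.
\<close>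

lemma gauss_pair_by_parts:
  assumes i: "i \<in> I" and j: "j \<in> I"
    and a: "\<And>s. (a has_field_derivative a' s) (at s)" and b: "\<And>s. (b has_field_derivative b' s) (at s)"
    and eb: "exp_bounded a" "exp_bounded a'" "exp_bounded b" "exp_bounded b'"
  shows "gauss_expect n (\<lambda>x. coeff j x * (a (coeff i x) * b (coeff j x)))
    = gram i j * gauss_expect n (\<lambda>x. a' (coeff i x) * b (coeff j x)) + gauss_expect n (\<lambda>x. a (coeff i x) * b' (coeff j x))"
proof -
  note M = moderate_coeff_comp[OF _ i] moderate_coeff_comp[OF _ j]
  let ?F = "\<lambda>x. a (coeff i x) * b (coeff j x)"
  let ?G = "\<lambda>x. a' (coeff i x) * b (coeff j x)"
  let ?H = "\<lambda>x. a (coeff i x) * b' (coeff j x)"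
  have mF: "moderate n ?F" and mG: "moderate n ?G" and mH: "moderate n ?H"
    using eb by (auto intro!: moderate_mult M)
  have ibp: "gauss_expect n (\<lambda>x. x k * ?F x) = u i k * gauss_expect n ?G + u j k * gauss_expect n ?H" if k: "k < n" for k
  proof -
    have "gauss_expect n (\<lambda>x. x k * ?F x) = gauss_expect n (\<lambda>x. u i k * ?G x + u j k * ?H x)"
    proof (rule gauss_integral_by_parts[OF k mF])
      show "moderate n (\<lambda>x. u i k * ?G x + u j k * ?H x)"
        by (intro moderate_add moderate_mult[OF moderate_const] mG mH)
      fix x s
      show "((\<lambda>s. ?F (x(k := s))) has_field_derivative (u i k * ?G (x(k := s)) + u j k * ?H (x(k := s)))) (at s)"
        by (rule DERIV_cong[OF DERIV_mult[OF coeff_comp_deriv[OF a k] coeff_comp_deriv[OF b k]]]) (simp add: algebra_simps)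
    next
      fix x
      show "continuous_on UNIV (\<lambda>s. u i k * ?G (x(k := s)) + u j k * ?H (x(k := s)))"
        using eb by (intro continuous_intros continuous_coeff_comp[OF _ k]) (auto simp: exp_bounded_def)
    qed
    also have "\<dots> = u i k * gauss_expect n ?G + u j k * gauss_expect n ?H"
      by (subst gauss_expect_add) (auto intro!: moderate_mult[OF moderate_const] mG mH simp: gauss_expect_cmult)
    finally show ?thesis .
  qed
  have "gauss_expect n (\<lambda>x. coeff j x * ?F x) = gauss_expect n (\<lambda>x. \<Sum>k<n. u j k * (x k * ?F x))"
    by (simp add: coeff_def sum_distrib_right mult.assoc)
  also have "\<dots> = (\<Sum>k<n. u j k * gauss_expect n (\<lambda>x. x k * ?F x))"
    by (subst gauss_expect_sum) (auto intro!: moderate_mult[OF moderate_const] moderate_mult moderate_coord mF simp: gauss_expect_cmult)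
  also have "\<dots> = (\<Sum>k<n. u j k * (u i k * gauss_expect n ?G + u j k * gauss_expect n ?H))"
    by (intro sum.cong) (auto simp: ibp)
  also have "\<dots> = gram i j * gauss_expect n ?G + (\<Sum>k<n. (u j k)\<^sup>2) * gauss_expect n ?H"
    unfolding gram_def sum_distrib_right sum.distrib[symmetric]
    by (intro sum.cong) (auto simp: algebra_simps power2_eq_square)
  finally show ?thesis by (simp add: unit[OF j])
qed

lemma gauss_expect_coeff_sq: "i \<in> I \<Longrightarrow> gauss_expect n (\<lambda>x. (coeff i x)\<^sup>2) = 1"
  using gauss_pair_by_parts[of i i "\<lambda>_. 1" "\<lambda>_. 0" "\<lambda>s. s" "\<lambda>_. 1"]
  by (simp add: exp_bounded_ident gauss_expect_const power2_eq_square)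

text \<open>
  Repeated integration by parts. In terms of Hermite polynomials, \<open>s\<^sup>3 = H\<^sub>3(s) + 3 H\<^sub>1(s)\<close>, and
  correlating with \<open>H\<^sub>k\<close> extracts the \<open>k\<close>-th derivative and the \<open>k\<close>-th power of the covariance.
\<close>

lemma gauss_expect_cube:
  assumes i: "i \<in> I" and j: "j \<in> I"
    and d: "\<And>s. (a has_field_derivative a1 s) (at s)" "\<And>s. (a1 has_field_derivative a2 s) (at s)" "\<And>s. (a2 has_field_derivative a3 s) (at s)"
    and eb: "exp_bounded a" "exp_bounded a1" "exp_bounded a2" "exp_bounded a3"
  shows "gauss_expect n (\<lambda>x. a (coeff i x) * coeff j x ^ 3)
    = (gram i j) ^ 3 * gauss_expect n (\<lambda>x. a3 (coeff i x)) + 3 * gram i j * gauss_expect n (\<lambda>x. a1 (coeff i x))"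
proof -
  let ?E = "gauss_expect n"
  note P = gauss_pair_by_parts[OF i j]
  have sq: "\<And>s::real. ((\<lambda>s. s\<^sup>2) has_field_derivative 2 * s) (at s)" by (auto intro!: derivative_eq_intros)
  have e1: "?E (\<lambda>x. coeff j x * (a (coeff i x) * (coeff j x)\<^sup>2))
      = gram i j * ?E (\<lambda>x. a1 (coeff i x) * (coeff j x)\<^sup>2) + ?E (\<lambda>x. a (coeff i x) * (2 * coeff j x))"
    by (rule P[OF d(1) sq eb(1,2)]) (auto intro!: exp_bounded_power exp_bounded_mult exp_bounded_ident)
  have e2: "?E (\<lambda>x. coeff j x * (a1 (coeff i x) * coeff j x))
      = gram i j * ?E (\<lambda>x. a2 (coeff i x) * coeff j x) + ?E (\<lambda>x. a1 (coeff i x) * 1)"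
    by (rule P[OF d(2) DERIV_ident eb(2,3)]) (auto intro!: exp_bounded_ident)
  have e3: "?E (\<lambda>x. coeff j x * (a2 (coeff i x) * 1)) = gram i j * ?E (\<lambda>x. a3 (coeff i x) * 1) + ?E (\<lambda>x. a2 (coeff i x) * 0)"
    by (rule P[OF d(3) DERIV_const eb(3,4)]) auto
  have e4: "?E (\<lambda>x. coeff j x * (a (coeff i x) * 1)) = gram i j * ?E (\<lambda>x. a1 (coeff i x) * 1) + ?E (\<lambda>x. a (coeff i x) * 0)"
    by (rule P[OF d(1) DERIV_const eb(1,2)]) auto
  have r1: "(\<lambda>x. a (coeff i x) * coeff j x ^ 3) = (\<lambda>x. coeff j x * (a (coeff i x) * (coeff j x)\<^sup>2))"
    by (simp add: fun_eq_iff power3_eq_cube power2_eq_square)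
  have r2: "(\<lambda>x. a1 (coeff i x) * (coeff j x)\<^sup>2) = (\<lambda>x. coeff j x * (a1 (coeff i x) * coeff j x))"
    by (simp add: fun_eq_iff power2_eq_square)
  have r3: "(\<lambda>x. a2 (coeff i x) * coeff j x) = (\<lambda>x. coeff j x * (a2 (coeff i x) * 1))"
    by (simp add: fun_eq_iff)
  have r4: "(\<lambda>x. a (coeff i x) * (2 * coeff j x)) = (\<lambda>x. 2 * (coeff j x * (a (coeff i x) * 1)))"
    by (simp add: fun_eq_iff)
  have z: "?E (\<lambda>x. 0) = 0" by (rule gauss_expect_const)
  show ?thesis
    unfolding r1 e1 r2 e2 r3 e3 r4 gauss_expect_cmult e4 using z by (simp add: algebra_simps power3_eq_cube)
qed

lemma moderate_defect:
  "(\<And>i. i \<in> I \<Longrightarrow> moderate n (\<lambda>x. f x i)) \<Longrightarrow> (\<And>i. i \<in> I \<Longrightarrow> moderate n (\<lambda>x. g x i)) \<Longrightarrow> moderate n (\<lambda>x. defect (f x) (g x))"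
  unfolding defect_def synth_def
  by (intro moderate_diff moderate_sum moderate_mult moderate_const) auto

text \<open>
  The linear part \<open>3 s\<close> of \<open>s\<^sup>3\<close> lies in the range of \<open>coeff\<close>, so it does not contribute to the defect;
  in the computation, \<open>\<Sum>\<^sub>j c\<^sub>j (gram i j)\<^sup>2 = 1\<close> cancels the terms with \<open>a1\<close>. The third Hermite part
  leaves \<open>1 - \<Sum>\<^sub>j c\<^sub>j (gram i j)\<^sup>4\<close> with the mean of the third derivative.
\<close>

lemma gauss_expect_defect_cube:
  assumes d: "\<And>s. (a has_field_derivative a1 s) (at s)" "\<And>s. (a1 has_field_derivative a2 s) (at s)" "\<And>s. (a2 has_field_derivative a3 s) (at s)"
    and eb: "exp_bounded a" "exp_bounded a1" "exp_bounded a2" "exp_bounded a3"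
  shows "gauss_expect n (\<lambda>x. defect (\<lambda>i. a (coeff i x)) (\<lambda>i. coeff i x ^ 3))
    = (\<Sum>i\<in>I. \<Sum>j\<in>I. c i * c j * ((gram i j)\<^sup>2 - (gram i j) ^ 4) * gauss_expect n (\<lambda>x. a3 (coeff i x)))"
proof -
  let ?E = "gauss_expect n"
  define A1 where "A1 i = ?E (\<lambda>x. a1 (coeff i x))" for i
  define A3 where "A3 i = ?E (\<lambda>x. a3 (coeff i x))" for i
  have cube: "?E (\<lambda>x. a (coeff i x) * coeff j x ^ 3) = (gram i j) ^ 3 * A3 i + 3 * gram i j * A1 i" if "i \<in> I" "j \<in> I" for i j
    unfolding A1_def A3_def by (rule gauss_expect_cube[OF that d eb])
  have mod: "moderate n (\<lambda>x. a (coeff i x) * coeff j x ^ 3)" if "i \<in> I" "j \<in> I" for i j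
    using moderate_coeff_comp[OF eb(1) that(1)] moderate_coeff_comp[OF exp_bounded_power[of 3] that(2)] by (rule moderate_mult)
  have "?E (\<lambda>x. defect (\<lambda>i. a (coeff i x)) (\<lambda>i. coeff i x ^ 3)) =
     ?E (\<lambda>x. (\<Sum>i\<in>I. c i * (a (coeff i x) * coeff i x ^ 3)) - (\<Sum>i\<in>I. \<Sum>j\<in>I. (c i * c j * gram i j) * (a (coeff i x) * coeff j x ^ 3)))"
    unfolding defect_def synth_pair by (simp add: mult_ac)
  also have "\<dots> = (\<Sum>i\<in>I. c i * ?E (\<lambda>x. a (coeff i x) * coeff i x ^ 3)) - (\<Sum>i\<in>I. \<Sum>j\<in>I. (c i * c j * gram i j) * ?E (\<lambda>x. a (coeff i x) * coeff j x ^ 3))"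
  proof -
    have m: "moderate n (\<lambda>x. (c i * c j * gram i j) * (a (coeff i x) * coeff j x ^ 3))" if "i \<in> I" "j \<in> I" for i j
      using that by (intro moderate_mult[OF moderate_const] mod)
    have m': "moderate n (\<lambda>x. c i * (a (coeff i x) * coeff i x ^ 3))" if "i \<in> I" for i
      using that by (intro moderate_mult[OF moderate_const] mod)
    have "?E (\<lambda>x. \<Sum>i\<in>I. \<Sum>j\<in>I. (c i * c j * gram i j) * (a (coeff i x) * coeff j x ^ 3))
      = (\<Sum>i\<in>I. ?E (\<lambda>x. \<Sum>j\<in>I. (c i * c j * gram i j) * (a (coeff i x) * coeff j x ^ 3)))"
      by (intro gauss_expect_sum moderate_sum m)
    also have "\<dots> = (\<Sum>i\<in>I. \<Sum>j\<in>I. (c i * c j * gram i j) * ?E (\<lambda>x. a (coeff i x) * coeff j x ^ 3))"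
    proof (rule sum.cong[OF refl])
      fix i assume "i \<in> I"
      then show "?E (\<lambda>x. \<Sum>j\<in>I. (c i * c j * gram i j) * (a (coeff i x) * coeff j x ^ 3))
        = (\<Sum>j\<in>I. (c i * c j * gram i j) * ?E (\<lambda>x. a (coeff i x) * coeff j x ^ 3))"
        by (subst gauss_expect_sum) (auto intro!: m simp: gauss_expect_cmult)
    qed
    moreover have "?E (\<lambda>x. \<Sum>i\<in>I. c i * (a (coeff i x) * coeff i x ^ 3)) = (\<Sum>i\<in>I. c i * ?E (\<lambda>x. a (coeff i x) * coeff i x ^ 3))"
      by (subst gauss_expect_sum) (auto intro!: m' simp: gauss_expect_cmult)
    ultimately show ?thesis by (subst gauss_expect_diff) (auto intro!: moderate_sum m m')
  qed
  also have "\<dots> = (\<Sum>i\<in>I. c i * (A3 i + 3 * A1 i)) - (\<Sum>i\<in>I. \<Sum>j\<in>I. (c i * c j * gram i j) * ((gram i j) ^ 3 * A3 i + 3 * gram i j * A1 i))"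
    by (intro arg_cong2[of _ _ _ _ minus] sum.cong refl) (auto simp: cube gram_self)
  also have "\<dots> = (\<Sum>i\<in>I. c i * (A3 i + 3 * A1 i) - (\<Sum>j\<in>I. (c i * c j * gram i j) * ((gram i j) ^ 3 * A3 i + 3 * gram i j * A1 i)))"
    by (rule sum_subtractf[symmetric])
  also have "\<dots> = (\<Sum>i\<in>I. \<Sum>j\<in>I. c i * c j * ((gram i j)\<^sup>2 - (gram i j) ^ 4) * A3 i)"
  proof (rule sum.cong[OF refl])
    fix i assume i: "i \<in> I"
    have "(\<Sum>j\<in>I. (c i * c j * gram i j) * ((gram i j) ^ 3 * A3 i + 3 * gram i j * A1 i))
        = c i * A3 i * (\<Sum>j\<in>I. c j * (gram i j) ^ 4) + 3 * c i * A1 i * (\<Sum>j\<in>I. c j * (gram i j)\<^sup>2)"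
      unfolding sum_distrib_left sum.distrib[symmetric]
      by (intro sum.cong refl) (simp add: algebra_simps eval_nat_numeral)
    moreover have "(\<Sum>j\<in>I. c i * c j * ((gram i j)\<^sup>2 - (gram i j) ^ 4) * A3 i)
        = c i * A3 i * (\<Sum>j\<in>I. c j * (gram i j)\<^sup>2) - c i * A3 i * (\<Sum>j\<in>I. c j * (gram i j) ^ 4)"
      unfolding sum_distrib_left sum_subtractf[symmetric]
      by (intro sum.cong refl) (simp add: algebra_simps)
    ultimately show "c i * (A3 i + 3 * A1 i) - (\<Sum>j\<in>I. (c i * c j * gram i j) * ((gram i j) ^ 3 * A3 i + 3 * gram i j * A1 i))
      = (\<Sum>j\<in>I. c i * c j * ((gram i j)\<^sup>2 - (gram i j) ^ 4) * A3 i)"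
      using sum_gram_sq[OF i] by (simp add: algebra_simps)
  qed
  finally show ?thesis by (simp add: A3_def)
qed

lemma gauss_expect_defect_cube_cube:
  "gauss_expect n (\<lambda>x. defect (\<lambda>i. coeff i x ^ 3) (\<lambda>i. coeff i x ^ 3)) = 6 * frame_defect"
proof -
  have "gauss_expect n (\<lambda>x. defect (\<lambda>i. coeff i x ^ 3) (\<lambda>i. coeff i x ^ 3))
    = (\<Sum>i\<in>I. \<Sum>j\<in>I. c i * c j * ((gram i j)\<^sup>2 - (gram i j) ^ 4) * gauss_expect n (\<lambda>x. 6))"
  proof (rule gauss_expect_defect_cube)
    show "((\<lambda>s. s ^ 3) has_field_derivative 3 * s\<^sup>2) (at s)" for s :: real by (auto intro!: derivative_eq_intros)
    show "((\<lambda>s. 3 * s\<^sup>2) has_field_derivative 6 * s) (at s)" for s :: real by (auto intro!: derivative_eq_intros)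
    show "((\<lambda>s. 6 * s) has_field_derivative 6) (at s)" for s :: real by (auto intro!: derivative_eq_intros)
  qed (auto intro!: exp_bounded_power exp_bounded_mult exp_bounded_ident)
  then show ?thesis by (simp add: gauss_expect_const frame_defect_def sum_distrib_left mult_ac)
qed

lemma exp_bounded_tilted_mean: "exp_bounded (\<lambda>s. tilted_mean k l s)"
  by (rule exp_bounded_bounded[of _ 1]) (auto intro!: continuous_intros tilted_mean_abs_le)

lemma exp_bounded_diff: "exp_bounded f \<Longrightarrow> exp_bounded g \<Longrightarrow> exp_bounded (\<lambda>s. f s - g s)"
proof -
  assume "exp_bounded f" "exp_bounded g"
  then obtain C a D b where F: "continuous_on UNIV f" "C \<ge> 0" "a \<ge> 0" "\<And>x. \<bar>f x\<bar> \<le> C * exp (a * \<bar>x\<bar>)"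
    and G: "continuous_on UNIV g" "D \<ge> 0" "b \<ge> 0" "\<And>x. \<bar>g x\<bar> \<le> D * exp (b * \<bar>x\<bar>)"
    by (auto simp: exp_bounded_def)
  have "\<bar>f x - g x\<bar> \<le> (C + D) * exp ((a + b) * \<bar>x\<bar>)" for x
  proof -
    define E where "E = exp ((a + b) * \<bar>x\<bar>)"
    have "C * exp (a * \<bar>x\<bar>) \<le> C * E" "D * exp (b * \<bar>x\<bar>) \<le> D * E"
      unfolding E_def using F(2,3) G(2,3) by (auto intro!: mult_left_mono mult_right_mono)
    then have "\<bar>f x - g x\<bar> \<le> C * E + D * E" using F(4)[of x] G(4)[of x] by linarith
    then show ?thesis unfolding E_def[symmetric] by (simp only: distrib_right)
  qed
  then show ?thesis unfolding exp_bounded_def using F G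
    by (intro conjI exI[of _ "C + D"] exI[of _ "a + b"]) (auto intro!: continuous_intros)
qed

lemma exp_bounded_tilted_power: "exp_bounded (\<lambda>s. tilted_mean k l s ^ m)"
  by (induction m) (auto intro!: exp_bounded_mult exp_bounded_tilted_mean)

lemma exp_bounded_add: "exp_bounded f \<Longrightarrow> exp_bounded g \<Longrightarrow> exp_bounded (\<lambda>s. f s + g s)"
  using exp_bounded_diff[of f "\<lambda>s. (-1) * g s"] exp_bounded_mult[of "\<lambda>_. -1" g] by simp

text \<open>
  Since \<open>2 |s| \<le> 1 + s\<^sup>2\<close> and \<open>\<langle>u\<^sub>i, X\<rangle>\<close> has variance \<open>1\<close>, the pointwise bound on the cumulant
  integrates to \<open>-13/100 + 46 l\<close>.
\<close>

lemma expect_third_derivative: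
  assumes i: "i \<in> I" and l: "0 \<le> l" "l \<le> 1 / 1000"
  shows "gauss_expect n (\<lambda>x. l ^ 3 * tilted_cumulant4 l (coeff i x)) \<le> - (l ^ 3 / 15)"
proof -
  have eb: "exp_bounded (\<lambda>s. tilted_cumulant4 l s)"
    unfolding tilted_cumulant4_def
    by (intro exp_bounded_diff exp_bounded_add exp_bounded_mult exp_bounded_tilted_power exp_bounded_tilted_mean exp_bounded_const)
  have m2: "moderate n (\<lambda>x. (coeff i x)\<^sup>2)" by (rule moderate_coeff_comp[OF exp_bounded_power i])
  have "gauss_expect n (\<lambda>x. tilted_cumulant4 l (coeff i x)) \<le> gauss_expect n (\<lambda>x. (- 13 / 100 + 23 * l) + 23 * l * (coeff i x)\<^sup>2)"
  proof (rule gauss_expect_mono)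
    show "moderate n (\<lambda>x. tilted_cumulant4 l (coeff i x))" by (rule moderate_coeff_comp[OF eb i])
    show "moderate n (\<lambda>x. (- 13 / 100 + 23 * l) + 23 * l * (coeff i x)\<^sup>2)"
      by (intro moderate_add moderate_mult[OF moderate_const] m2 moderate_const)
    fix x
    have "2 * \<bar>coeff i x\<bar> \<le> 1 + (coeff i x)\<^sup>2"
      using zero_le_power2[of "1 - \<bar>coeff i x\<bar>"] by (simp add: power2_eq_square algebra_simps)
    then have "23 * l * (2 * \<bar>coeff i x\<bar>) \<le> 23 * l * (1 + (coeff i x)\<^sup>2)" using l by (intro mult_left_mono) auto
    then show "tilted_cumulant4 l (coeff i x) \<le> (- 13 / 100 + 23 * l) + 23 * l * (coeff i x)\<^sup>2"
      using tilted_cumulant4_le[OF l, of "coeff i x"] by (simp add: algebra_simps)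
  qed
  also have "\<dots> = - 13 / 100 + 46 * l"
    by (subst gauss_expect_add) (auto intro!: moderate_mult[OF moderate_const] m2 simp: gauss_expect_const gauss_expect_cmult gauss_expect_coeff_sq[OF i])
  also have "\<dots> \<le> - 1 / 15" using l by simp
  finally have "l ^ 3 * gauss_expect n (\<lambda>x. tilted_cumulant4 l (coeff i x)) \<le> l ^ 3 * (- 1 / 15)"
    using l by (intro mult_left_mono) auto
  then show ?thesis by (simp add: gauss_expect_cmult)
qed

text \<open>
  The vector of tilted means is tested against the vector of cubes by \<open>defect_ge\<close>: their mutual defect has
  expectation at most \<open>-(l\<^sup>3 / 15) F\<close> and the defect of the cubes has expectation \<open>6 F\<close>, where \<open>F\<close> is
  the frame defect.
\<close>

lemma expect_defect_ge:
  assumes l: "0 \<le> l" "l \<le> 1 / 1000"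
  shows "gauss_expect n (\<lambda>x. defect (\<lambda>i. tilted_mean 1 l (coeff i x)) (\<lambda>i. tilted_mean 1 l (coeff i x))) \<ge> l ^ 6 / 1350 * frame_defect"
proof -
  let ?m = "\<lambda>x i. tilted_mean 1 l (coeff i x)"
  let ?w = "\<lambda>x i. coeff i x ^ 3"
  \<comment> \<open>This value maximises \<open>-2 t l\<^sup>3 / 15 - 6 t\<^sup>2\<close>.\<close>
  define t where "t = - (l ^ 3 / 90)"
  note eb = exp_bounded_diff exp_bounded_add exp_bounded_mult exp_bounded_tilted_power exp_bounded_tilted_mean exp_bounded_const
  have md: "moderate n (\<lambda>x. defect (?m x) (?m x))" "moderate n (\<lambda>x. defect (?m x) (?w x))" "moderate n (\<lambda>x. defect (?w x) (?w x))"
    by (intro moderate_defect moderate_coeff_comp[OF exp_bounded_tilted_mean] moderate_coeff_comp[OF exp_bounded_power]; assumption)+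
  have md2: "moderate n (\<lambda>x. 2 * t * defect (?m x) (?w x))" and md3: "moderate n (\<lambda>x. t\<^sup>2 * defect (?w x) (?w x))"
    by (rule moderate_mult[OF moderate_const md(2)], rule moderate_mult[OF moderate_const md(3)])
  have "gauss_expect n (\<lambda>x. defect (?m x) (?w x))
     = (\<Sum>i\<in>I. \<Sum>j\<in>I. c i * c j * ((gram i j)\<^sup>2 - (gram i j) ^ 4) * gauss_expect n (\<lambda>x. l ^ 3 * tilted_cumulant4 l (coeff i x)))"
  proof (rule gauss_expect_defect_cube[OF tilted_mean1_deriv1 tilted_mean1_deriv2 tilted_mean1_deriv3])
    show "exp_bounded (\<lambda>s. l ^ 3 * tilted_cumulant4 l s)" unfolding tilted_cumulant4_def by (intro eb)
  qed (intro eb)+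
  also have "\<dots> \<le> (\<Sum>i\<in>I. \<Sum>j\<in>I. c i * c j * ((gram i j)\<^sup>2 - (gram i j) ^ 4) * (- (l ^ 3 / 15)))"
    using weight_pos gram_term_nonneg
    by (intro sum_mono mult_left_mono expect_third_derivative l mult_nonneg_nonneg) (auto intro: less_imp_le)
  also have "\<dots> = - (l ^ 3 / 15) * frame_defect"
    by (simp add: frame_defect_def sum_distrib_left mult_ac)
  finally have mw: "gauss_expect n (\<lambda>x. defect (?m x) (?w x)) \<le> - (l ^ 3 / 15) * frame_defect" .
  have "l ^ 6 / 1350 * frame_defect = 2 * t * (- (l ^ 3 / 15) * frame_defect) - t\<^sup>2 * (6 * frame_defect)"
    by (simp add: t_def power2_eq_square field_simps flip: power_add)
  also have "\<dots> \<le> 2 * t * gauss_expect n (\<lambda>x. defect (?m x) (?w x)) - t\<^sup>2 * (6 * frame_defect)"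
    using mw l by (intro diff_right_mono mult_left_mono_neg) (auto simp: t_def)
  also have "\<dots> = gauss_expect n (\<lambda>x. 2 * t * defect (?m x) (?w x) - t\<^sup>2 * defect (?w x) (?w x))"
    by (simp only: gauss_expect_diff[OF md2 md3] gauss_expect_cmult gauss_expect_defect_cube_cube)
  also have "\<dots> \<le> gauss_expect n (\<lambda>x. defect (?m x) (?m x))"
    by (rule gauss_expect_mono[OF moderate_diff[OF md2 md3] md(1) defect_ge])
  finally show ?thesis .
qed

end

section \<open>Gaussian interpolation\<close>

text \<open>
  By the mean value inequality \<open>w\<close> dominates the difference quotients.
\<close>

lemma DERIV_under_integral:
  fixes f f' :: "real \<Rightarrow> 'a \<Rightarrow> real"
  assumes e: "e > 0"
    and d: "\<And>t x. \<bar>t - t0\<bar> < e \<Longrightarrow> ((\<lambda>t. f t x) has_field_derivative f' t x) (at t)"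
    and b: "\<And>t x. \<bar>t - t0\<bar> < e \<Longrightarrow> \<bar>f' t x\<bar> \<le> w x"
    and w: "integrable M w" and i: "\<And>t. integrable M (f t)" and m: "f' t0 \<in> borel_measurable M"
  shows "((\<lambda>t. \<integral>x. f t x \<partial>M) has_field_derivative (\<integral>x. f' t0 x \<partial>M)) (at t0)"
  unfolding has_field_derivative_iff tendsto_at_iff_sequentially
proof (intro allI impI)
  fix X :: "nat \<Rightarrow> real" assume X: "\<forall>i. X i \<in> UNIV - {t0}" "X \<longlonglongrightarrow> t0"
  have "\<forall>\<^sub>F i in sequentially. dist (X i) t0 < e" using X(2) e by (rule tendstoD)
  then obtain N where N: "\<And>i. i \<ge> N \<Longrightarrow> \<bar>X i - t0\<bar> < e"
    by (auto simp: eventually_sequentially dist_real_def)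
  define Y where "Y i = X (i + N)" for i
  have Y: "\<And>i. Y i \<noteq> t0" "\<And>i. \<bar>Y i - t0\<bar> < e" using X N by (auto simp: Y_def)
  have Yl: "Y \<longlonglongrightarrow> t0" unfolding Y_def using X(2) by (rule LIMSEQ_ignore_initial_segment)
  have "(\<lambda>i. \<integral>x. (f (Y i) x - f t0 x) / (Y i - t0) \<partial>M) \<longlonglongrightarrow> (\<integral>x. f' t0 x \<partial>M)"
  proof (rule integral_dominated_convergence[OF m _ w])
    show "(\<lambda>x. (f (Y i) x - f t0 x) / (Y i - t0)) \<in> borel_measurable M" for i
      using borel_measurable_integrable[OF i] by measurable
    show "AE x in M. (\<lambda>i. (f (Y i) x - f t0 x) / (Y i - t0)) \<longlonglongrightarrow> f' t0 x"
    proof (rule AE_I2)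
      fix x
      have "((\<lambda>t. (f t x - f t0 x) / (t - t0)) \<longlongrightarrow> f' t0 x) (at t0)"
        using d[of t0 x] e by (simp add: has_field_derivative_iff)
      then show "(\<lambda>i. (f (Y i) x - f t0 x) / (Y i - t0)) \<longlonglongrightarrow> f' t0 x"
        using Yl Y(1) by (auto simp: tendsto_at_iff_sequentially comp_def)
    qed
    show "AE x in M. norm ((f (Y i) x - f t0 x) / (Y i - t0)) \<le> w x" for i
    proof (rule AE_I2)
      fix x
      have "norm (f (Y i) x - f t0 x) \<le> w x * norm (Y i - t0)"
      proof (rule field_differentiable_bound)
        show "convex (ball t0 e)" by simp
        show "Y i \<in> ball t0 e" using Y(2)[of i] by (simp add: dist_real_def abs_minus_commute)
        show "t0 \<in> ball t0 e" using e by simp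
        fix t assume "t \<in> ball t0 e"
        then have t: "\<bar>t - t0\<bar> < e" by (simp add: dist_real_def abs_minus_commute)
        show "((\<lambda>t. f t x) has_field_derivative f' t x) (at t within ball t0 e)"
          using d[OF t] by (rule has_field_derivative_at_within)
        show "norm (f' t x) \<le> w x" using b[OF t] by simp
      qed
      then show "norm ((f (Y i) x - f t0 x) / (Y i - t0)) \<le> w x"
        using Y(1)[of i] by (simp add: divide_le_eq abs_divide)
    qed
  qed
  moreover have "(\<integral>x. (f (Y i) x - f t0 x) / (Y i - t0) \<partial>M) = ((\<integral>x. f (Y i) x \<partial>M) - (\<integral>x. f t0 x \<partial>M)) / (Y i - t0)" for i
    by (simp only: integral_divide_zero Bochner_Integration.integral_diff[OF i i])
  ultimately have "(\<lambda>j. ((\<integral>x. f (X (j + N)) x \<partial>M) - (\<integral>x. f t0 x \<partial>M)) / (X (j + N) - t0)) \<longlonglongrightarrow> (\<integral>x. f' t0 x \<partial>M)"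
    by (simp only: Y_def)
  then show "((\<lambda>y. ((\<integral>x. f y x \<partial>M) - (\<integral>x. f t0 x \<partial>M)) / (y - t0)) \<circ> X) \<longlonglongrightarrow> (\<integral>x. f' t0 x \<partial>M)"
    unfolding comp_def by (rule LIMSEQ_offset)
qed

context weighted_frame
begin

text \<open>
  The product over \<open>i\<close> of \<open>tilted_moment 0 l \<langle>u\<^sub>i, x\<rangle>\<close> raised to the real power \<open>c\<^sub>i\<close>.
\<close>

definition flow :: "real \<Rightarrow> (nat \<Rightarrow> real) \<Rightarrow> real"
  where "flow l x = exp (\<Sum>i\<in>I. c i * ln (tilted_moment 0 l (coeff i x)))"

abbreviation mean_at :: "nat \<Rightarrow> real \<Rightarrow> (nat \<Rightarrow> real) \<Rightarrow> 'i \<Rightarrow> real"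
  where "mean_at k l x i \<equiv> tilted_mean k l (coeff i x)"

lemma flow_pos: "0 < flow l x" by (simp add: flow_def)

lemma exp_n_ln2: "exp (real n * ln 2) = 2 ^ n"
  by (simp add: exp_of_nat_mult)

lemma flow_le: "flow l x \<le> 2 ^ n * exp (real n * \<bar>l\<bar> * (\<Sum>k<n. \<bar>x k\<bar>))"
proof -
  let ?T = "\<Sum>k<n. \<bar>x k\<bar>"
  have "ln (tilted_moment 0 l (coeff i x)) \<le> ln 2 + \<bar>l\<bar> * ?T" if i: "i \<in> I" for i
  proof -
    have "ln (tilted_moment 0 l (coeff i x)) \<le> ln (2 * exp (\<bar>l\<bar> * \<bar>coeff i x\<bar>))"
      using tilted_moment0_pos tilted_moment0_le by (subst ln_le_cancel_iff) auto
    also have "\<dots> = ln 2 + \<bar>l\<bar> * \<bar>coeff i x\<bar>" by (simp add: ln_mult)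
    also have "\<dots> \<le> ln 2 + \<bar>l\<bar> * ?T" using abs_coeff_le[OF i] by (simp add: mult_left_mono)
    finally show ?thesis .
  qed
  then have "(\<Sum>i\<in>I. c i * ln (tilted_moment 0 l (coeff i x))) \<le> (\<Sum>i\<in>I. c i * (ln 2 + \<bar>l\<bar> * ?T))"
    using weight_pos by (intro sum_mono mult_left_mono) (auto intro: less_imp_le)
  also have "\<dots> = real n * ln 2 + real n * \<bar>l\<bar> * ?T"
    unfolding sum_distrib_right[symmetric] sum_weight by (simp add: algebra_simps)
  finally have "flow l x \<le> exp (real n * ln 2 + real n * \<bar>l\<bar> * ?T)" by (simp add: flow_def)
  then show ?thesis by (simp add: exp_add exp_n_ln2)
qed

lemma flow_ge: "flow l x \<ge> 2 ^ n * exp (- (real n * (l\<^sup>2 / 2)))"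
proof -
  have "ln (tilted_moment 0 l (coeff i x)) \<ge> ln 2 - l\<^sup>2 / 2" for i
  proof -
    have "ln (2 * exp (- (l\<^sup>2 / 2))) \<le> ln (tilted_moment 0 l (coeff i x))"
      using tilted_moment0_pos tilted_moment0_ge by (subst ln_le_cancel_iff) auto
    then show ?thesis by (simp add: ln_mult)
  qed
  then have "(\<Sum>i\<in>I. c i * ln (tilted_moment 0 l (coeff i x))) \<ge> (\<Sum>i\<in>I. c i * (ln 2 - l\<^sup>2 / 2))"
    using weight_pos by (intro sum_mono mult_left_mono) (auto intro: less_imp_le)
  moreover have "(\<Sum>i\<in>I. c i * (ln 2 - l\<^sup>2 / 2)) = real n * ln 2 + - (real n * (l\<^sup>2 / 2))"
    unfolding sum_distrib_right[symmetric] sum_weight by (simp add: algebra_simps)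
  ultimately have "flow l x \<ge> exp (real n * ln 2 + - (real n * (l\<^sup>2 / 2)))" by (simp add: flow_def)
  then show ?thesis by (simp only: exp_add exp_n_ln2)
qed

lemma continuous_ln_moment: "continuous_on UNIV (\<lambda>s. ln (tilted_moment 0 l s))"
  using tilted_moment0_pos by (intro continuous_intros) (auto simp: less_imp_neq[symmetric])

lemma measurable_flow: "flow l \<in> borel_measurable (PiL n)"
proof -
  have "(\<lambda>x. ln (tilted_moment 0 l (coeff i x))) \<in> borel_measurable (PiL n)" for i
    by (rule measurable_compose[OF measurable_coeff borel_measurable_continuous_onI[OF continuous_ln_moment]])
  then show ?thesis unfolding flow_def[abs_def]
    by (intro borel_measurable_exp[THEN measurable_compose[rotated]] borel_measurable_sum borel_measurable_times) auto
qed

lemma moderate_flow: "moderate n (flow l)"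
proof (rule moderateI[OF measurable_flow])
  show "0 \<le> real n * \<bar>l\<bar>" by simp
  show "\<bar>flow l x\<bar> \<le> 2 ^ n * exp (real n * \<bar>l\<bar> * (\<Sum>k<n. \<bar>x k\<bar>))" for x
    using flow_le[of l x] flow_pos[of l x] by simp
qed

lemma moderate_mean: "i \<in> I \<Longrightarrow> moderate n (\<lambda>x. mean_at k l x i)"
  by (rule moderate_coeff_comp[OF exp_bounded_tilted_mean])

lemma moderate_coeff: "i \<in> I \<Longrightarrow> moderate n (\<lambda>x. coeff i x)"
  by (rule moderate_coeff_comp[OF exp_bounded_ident])

lemma moderate_synth: "moderate n (\<lambda>x. synth (mean_at k l x) j)"
  unfolding synth_def by (intro moderate_sum moderate_mult moderate_mean moderate_const)

definition flow_deriv :: "real \<Rightarrow> (nat \<Rightarrow> real) \<Rightarrow> real"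
  where "flow_deriv l x = flow l x * (\<Sum>i\<in>I. c i * (coeff i x * mean_at 1 l x i - l * mean_at 2 l x i))"

lemma moderate_flow_deriv: "moderate n (flow_deriv l)"
  unfolding flow_deriv_def[abs_def]
  by (intro moderate_mult moderate_flow moderate_sum moderate_diff moderate_mean moderate_const moderate_coeff)

lemma flow_has_deriv: "((\<lambda>l. flow l x) has_field_derivative flow_deriv l x) (at l)"
proof -
  have "((\<lambda>l. ln (tilted_moment 0 l s)) has_field_derivative (s * tilted_mean 1 l s - l * tilted_mean 2 l s)) (at l)" for s
  proof -
    have "((\<lambda>l. ln (tilted_moment 0 l s)) has_field_derivative
       inverse (tilted_moment 0 l s) * (s * tilted_moment (Suc 0) l s - l * tilted_moment (Suc (Suc 0)) l s)) (at l)"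
      by (rule DERIV_chain2[OF DERIV_ln[OF tilted_moment0_pos] tilted_moment_deriv_l])
    then show ?thesis
      by (simp add: tilted_mean_def numeral_2_eq_2 divide_inverse algebra_simps)
  qed
  then have "((\<lambda>l. \<Sum>i\<in>I. c i * ln (tilted_moment 0 l (coeff i x))) has_field_derivative
      (\<Sum>i\<in>I. c i * (coeff i x * mean_at 1 l x i - l * mean_at 2 l x i))) (at l)"
    by (intro DERIV_sum DERIV_cmult)
  from DERIV_chain2[OF DERIV_exp this] show ?thesis unfolding flow_def flow_deriv_def .
qed

lemma flow_deriv_bound:
  assumes "\<bar>l\<bar> \<le> L"
  shows "\<bar>flow_deriv l x\<bar> \<le> (2 ^ n * exp (real n * L * (\<Sum>k<n. \<bar>x k\<bar>))) * (real n * ((\<Sum>k<n. \<bar>x k\<bar>) + L))"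
proof -
  let ?T = "\<Sum>k<n. \<bar>x k\<bar>"
  have T: "0 \<le> ?T" by (intro sum_nonneg) auto
  have "\<bar>\<Sum>i\<in>I. c i * (coeff i x * mean_at 1 l x i - l * mean_at 2 l x i)\<bar> \<le> (\<Sum>i\<in>I. c i * (?T + L))"
  proof (rule order_trans[OF sum_abs sum_mono])
    fix i assume i: "i \<in> I"
    have "\<bar>coeff i x * mean_at 1 l x i\<bar> \<le> ?T * 1"
      unfolding abs_mult using T by (intro mult_mono abs_coeff_le i tilted_mean_abs_le) auto
    moreover have "\<bar>l * mean_at 2 l x i\<bar> \<le> L * 1"
      unfolding abs_mult using assms by (intro mult_mono tilted_mean_abs_le) auto
    ultimately have "\<bar>coeff i x * mean_at 1 l x i - l * mean_at 2 l x i\<bar> \<le> ?T + L" by linarith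
    then show "\<bar>c i * (coeff i x * mean_at 1 l x i - l * mean_at 2 l x i)\<bar> \<le> c i * (?T + L)"
      using weight_pos[OF i] by (simp add: abs_mult)
  qed
  also have "\<dots> = real n * (?T + L)" unfolding sum_distrib_right[symmetric] sum_weight ..
  finally have s: "\<bar>\<Sum>i\<in>I. c i * (coeff i x * mean_at 1 l x i - l * mean_at 2 l x i)\<bar> \<le> real n * (?T + L)" .
  have "\<bar>flow l x\<bar> \<le> 2 ^ n * exp (real n * \<bar>l\<bar> * ?T)" using flow_le[of l x] flow_pos[of l x] by simp
  also have "\<dots> \<le> 2 ^ n * exp (real n * L * ?T)"
    using assms T by (intro mult_left_mono) (auto intro!: mult_right_mono mult_left_mono)
  finally show ?thesis unfolding flow_deriv_def abs_mult using s by (intro mult_mono) auto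
qed

lemma gauss_expect_flow_deriv:
  "((\<lambda>l. gauss_expect n (flow l)) has_field_derivative gauss_expect n (flow_deriv l)) (at l)"
  unfolding gauss_expect_def
proof (rule DERIV_under_integral[where e = 1])
  define L where "L = \<bar>l\<bar> + 1"
  let ?w = "\<lambda>x. (2 ^ n * exp (real n * L * (\<Sum>k<n. \<bar>x k\<bar>))) * (real n * ((\<Sum>k<n. \<bar>x k\<bar>) + L))"
  have abs: "moderate n (\<lambda>x. \<bar>x k\<bar>)" if "k < n" for k
    using moderate_coord[OF that] unfolding moderate_def by auto
  have "moderate n (\<lambda>x. exp (real n * L * (\<Sum>k<n. \<bar>x k\<bar>)))"
  proof (rule moderateI[of _ _ "real n * L" 1])
    show "(\<lambda>x. exp (real n * L * (\<Sum>k<n. \<bar>x k\<bar>))) \<in> borel_measurable (PiL n)"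
      using abs by (intro borel_measurable_exp[THEN measurable_compose[rotated]] borel_measurable_sum borel_measurable_times)
        (auto simp: moderate_def)
  qed (auto simp: L_def)
  then have "moderate n ?w"
    by (intro moderate_mult[OF moderate_mult[OF moderate_const] moderate_mult[OF moderate_const]] moderate_add moderate_sum abs moderate_const) auto
  then show "integrable (PiL n) (\<lambda>x. ?w x * gauss_density n x)" by (rule integrable_moderate)
  fix t x assume t: "\<bar>t - l\<bar> < 1"
  show "((\<lambda>t. flow t x * gauss_density n x) has_field_derivative flow_deriv t x * gauss_density n x) (at t)"
    by (rule DERIV_cmult_right[OF flow_has_deriv])
  have "\<bar>flow_deriv t x\<bar> \<le> ?w x" using t by (intro flow_deriv_bound) (auto simp: L_def)
  then show "\<bar>flow_deriv t x * gauss_density n x\<bar> \<le> ?w x * gauss_density n x"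
    by (simp add: abs_mult mult_right_mono)
next
  show "integrable (PiL n) (\<lambda>x. flow t x * gauss_density n x)" for t
    by (rule integrable_moderate[OF moderate_flow])
  show "(\<lambda>x. flow_deriv l x * gauss_density n x) \<in> borel_measurable (PiL n)"
    by (rule borel_measurable_integrable[OF integrable_moderate[OF moderate_flow_deriv]])
qed simp

text \<open>
  Integration by parts for the vector field \<open>flow \<cdot> synth m\<close>, where \<open>m\<close> is the vector of tilted
  means. The gradient of \<open>flow\<close> is \<open>l \<cdot> flow \<cdot> synth m\<close>, and the divergence of \<open>synth m\<close> is \<open>l\<close> times the
  sum of the variances weighted by \<open>c\<close>.
\<close>

lemma flow_by_parts:
  "gauss_expect n (\<lambda>x. flow l x * (\<Sum>i\<in>I. c i * mean_at 1 l x i * coeff i x))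
    = gauss_expect n (\<lambda>x. flow l x * (l * (\<Sum>k<n. (synth (mean_at 1 l x) k)\<^sup>2) + l * (\<Sum>i\<in>I. c i * (mean_at 2 l x i - (mean_at 1 l x i)\<^sup>2))))"
proof -
  let ?V = "\<lambda>x k. synth (mean_at 1 l x) k"
  let ?q = "\<lambda>x i. mean_at 2 l x i - (mean_at 1 l x i)\<^sup>2"
  define F where "F k x = flow l x * ?V x k" for k x
  define F' where "F' k x = flow l x * (l * (?V x k)\<^sup>2 + l * (\<Sum>i\<in>I. c i * ?q x i * (u i k)\<^sup>2))" for k x
  have mF: "moderate n (F k)" for k
    unfolding F_def by (intro moderate_mult moderate_flow moderate_synth)
  have mF': "moderate n (F' k)" for k
    unfolding F'_def by (intro moderate_mult moderate_flow moderate_synth moderate_add moderate_const moderate_power moderate_sum moderate_diff moderate_mean)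
  have ibp: "gauss_expect n (\<lambda>x. x k * F k x) = gauss_expect n (F' k)" if k: "k < n" for k
  proof (rule gauss_integral_by_parts[OF k mF mF'])
    fix x :: "nat \<Rightarrow> real" and s :: real
    let ?y = "x(k := s)"
    have dm: "((\<lambda>s. mean_at 1 l (x(k := s)) i) has_field_derivative u i k * (l * ?q ?y i)) (at s)" for i
      by (rule coeff_comp_deriv[OF tilted_mean1_deriv1 k])
    have dV: "((\<lambda>s. ?V (x(k := s)) k) has_field_derivative l * (\<Sum>i\<in>I. c i * ?q ?y i * (u i k)\<^sup>2)) (at s)"
    proof -
      have "((\<lambda>s. ?V (x(k := s)) k) has_field_derivative (\<Sum>i\<in>I. c i * (u i k * (l * ?q ?y i)) * u i k)) (at s)"
        unfolding synth_def by (intro DERIV_sum DERIV_cmult_right DERIV_cmult dm)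
      also have "(\<Sum>i\<in>I. c i * (u i k * (l * ?q ?y i)) * u i k) = l * (\<Sum>i\<in>I. c i * ?q ?y i * (u i k)\<^sup>2)"
        unfolding sum_distrib_left by (intro sum.cong) (auto simp: power2_eq_square)
      finally show ?thesis .
    qed
    have dl: "((\<lambda>s. ln (tilted_moment 0 l s)) has_field_derivative l * tilted_mean 1 l s) (at s)" for s
    proof -
      have "((\<lambda>s. ln (tilted_moment 0 l s)) has_field_derivative inverse (tilted_moment 0 l s) * (l * tilted_moment (Suc 0) l s)) (at s)"
        by (rule DERIV_chain2[OF DERIV_ln[OF tilted_moment0_pos] tilted_moment_deriv_s])
      then show ?thesis by (simp add: tilted_mean_def field_simps)
    qed
    have "((\<lambda>s. \<Sum>i\<in>I. c i * ln (tilted_moment 0 l (coeff i (x(k := s))))) has_field_derivative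
        (\<Sum>i\<in>I. c i * (u i k * (l * mean_at 1 l ?y i)))) (at s)"
      by (intro DERIV_sum DERIV_cmult coeff_comp_deriv[OF dl k])
    also have "(\<Sum>i\<in>I. c i * (u i k * (l * mean_at 1 l ?y i))) = l * ?V ?y k"
      unfolding synth_def sum_distrib_left by (intro sum.cong) auto
    finally have "((\<lambda>s. flow l (x(k := s))) has_field_derivative flow l ?y * (l * ?V ?y k)) (at s)"
      unfolding flow_def by (rule DERIV_chain2[OF DERIV_exp])
    from DERIV_mult[OF this dV]
    show "((\<lambda>s. F k (x(k := s))) has_field_derivative F' k ?y) (at s)"
      unfolding F_def F'_def by (rule DERIV_cong) (simp add: power2_eq_square algebra_simps)
  next
    fix x :: "nat \<Rightarrow> real"
    have cm: "continuous_on UNIV (\<lambda>s. mean_at j l (x(k := s)) i)" for i j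
      by (rule continuous_coeff_comp[OF _ k]) (intro continuous_intros)
    have cl: "continuous_on UNIV (\<lambda>s. ln (tilted_moment 0 l (coeff i (x(k := s)))))" for i
      by (rule continuous_coeff_comp[OF continuous_ln_moment k])
    show "continuous_on UNIV (\<lambda>s. F' k (x(k := s)))"
      unfolding F'_def flow_def synth_def by (intro continuous_intros cm cl)
  qed
  have "gauss_expect n (\<lambda>x. flow l x * (\<Sum>i\<in>I. c i * mean_at 1 l x i * coeff i x)) = gauss_expect n (\<lambda>x. \<Sum>k<n. x k * F k x)"
    unfolding coeff_synth F_def by (simp add: sum_distrib_left mult_ac)
  also have "\<dots> = (\<Sum>k<n. gauss_expect n (\<lambda>x. x k * F k x))"
    by (intro gauss_expect_sum moderate_mult mF moderate_coord) auto
  also have "\<dots> = (\<Sum>k<n. gauss_expect n (F' k))" by (intro sum.cong) (auto simp: ibp)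
  also have "\<dots> = gauss_expect n (\<lambda>x. \<Sum>k<n. F' k x)" by (intro gauss_expect_sum[symmetric] mF')
  also have "(\<lambda>x. \<Sum>k<n. F' k x) = (\<lambda>x. flow l x * (l * (\<Sum>k<n. (?V x k)\<^sup>2) + l * (\<Sum>i\<in>I. c i * ?q x i)))"
  proof
    fix x
    have "(\<Sum>k<n. \<Sum>i\<in>I. c i * ?q x i * (u i k)\<^sup>2) = (\<Sum>i\<in>I. c i * ?q x i * (\<Sum>k<n. (u i k)\<^sup>2))"
      unfolding sum_distrib_left by (rule sum.swap)
    also have "\<dots> = (\<Sum>i\<in>I. c i * ?q x i)" by (intro sum.cong) (auto simp: unit)
    finally show "(\<Sum>k<n. F' k x) = flow l x * (l * (\<Sum>k<n. (?V x k)\<^sup>2) + l * (\<Sum>i\<in>I. c i * ?q x i))"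
      unfolding F'_def by (simp add: sum_distrib_left[symmetric] sum.distrib)
  qed
  finally show ?thesis .
qed

lemma moderate_defect_mean: "moderate n (\<lambda>x. defect (mean_at 1 l x) (mean_at 1 l x))"
  by (intro moderate_defect moderate_mean)

text \<open>
  Differentiation in \<open>l\<close> under the product gives \<open>\<Sum> c\<^sub>i (\<langle>u\<^sub>i, x\<rangle> m\<^sub>i - l q\<^sub>i)\<close> with first moments \<open>m\<^sub>i\<close>
  and second moments \<open>q\<^sub>i\<close>. After integration by parts of the first summand the second moments cancel,
  and what remains is \<open>-l\<close> times the defect of \<open>m\<close>.
\<close>

theorem expect_flow_deriv:
  "gauss_expect n (flow_deriv l) = - l * gauss_expect n (\<lambda>x. flow l x * defect (mean_at 1 l x) (mean_at 1 l x))"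
proof -
  let ?A = "\<lambda>x. flow l x * (\<Sum>i\<in>I. c i * mean_at 1 l x i * coeff i x)"
  let ?B = "\<lambda>x. flow l x * (\<Sum>i\<in>I. c i * (l * mean_at 2 l x i))"
  let ?C = "\<lambda>x. flow l x * (l * (\<Sum>k<n. (synth (mean_at 1 l x) k)\<^sup>2) + l * (\<Sum>i\<in>I. c i * (mean_at 2 l x i - (mean_at 1 l x i)\<^sup>2)))"
  have mA: "moderate n ?A" and mB: "moderate n ?B" and mC: "moderate n ?C"
    by (intro moderate_mult moderate_flow moderate_sum moderate_mean moderate_const moderate_coeff moderate_add moderate_diff moderate_power moderate_synth; assumption)+
  have "gauss_expect n (flow_deriv l) = gauss_expect n (\<lambda>x. ?A x - ?B x)"
    by (intro arg_cong[of _ _ "gauss_expect n"] ext) (simp add: flow_deriv_def algebra_simps sum_subtractf)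
  also have "\<dots> = gauss_expect n ?A - gauss_expect n ?B" by (rule gauss_expect_diff[OF mA mB])
  also have "\<dots> = gauss_expect n ?C - gauss_expect n ?B" unfolding flow_by_parts ..
  also have "\<dots> = gauss_expect n (\<lambda>x. ?C x - ?B x)" by (rule gauss_expect_diff[OF mC mB, symmetric])
  also have "\<dots> = gauss_expect n (\<lambda>x. (- l) * (flow l x * defect (mean_at 1 l x) (mean_at 1 l x)))"
    by (intro arg_cong[of _ _ "gauss_expect n"] ext)
       (simp add: defect_def algebra_simps sum_subtractf sum_negf sum_distrib_left power2_eq_square)
  finally show ?thesis by (simp only: gauss_expect_cmult)
qed

lemma frame_defect_nonneg: "0 \<le> frame_defect"
  unfolding frame_defect_def using weight_pos gram_term_nonneg
  by (intro sum_nonneg mult_nonneg_nonneg) (auto intro: less_imp_le)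

lemma expect_flow_deriv_nonpos: "l \<ge> 0 \<Longrightarrow> gauss_expect n (flow_deriv l) \<le> 0"
proof -
  assume l: "l \<ge> 0"
  have "gauss_expect n (\<lambda>_. 0) \<le> gauss_expect n (\<lambda>x. flow l x * defect (mean_at 1 l x) (mean_at 1 l x))"
    by (intro gauss_expect_mono moderate_const moderate_mult moderate_flow moderate_defect_mean mult_nonneg_nonneg defect_nonneg less_imp_le[OF flow_pos])
  then show ?thesis unfolding expect_flow_deriv using l by (simp add: gauss_expect_const)
qed

text \<open>
  The factor \<open>flow\<close> is bounded below by a constant, and the expectation of the remaining defect is known
  from \<open>expect_defect_ge\<close>; \<open>l \<le> 1/1000\<close> is the range in which the third derivative is controlled.
\<close>

lemma expect_flow_deriv_le:
  assumes l: "1 / 2000 \<le> l" "l \<le> 1 / 1000"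
  shows "gauss_expect n (flow_deriv l) \<le> - (2 ^ n * exp (- real n) * (1 / 2000) ^ 7 / 1350 * frame_defect)"
proof -
  have l0: "0 \<le> l" using l by simp
  have "2 ^ n * exp (- real n) * (l ^ 6 / 1350 * frame_defect) \<le> 2 ^ n * exp (- (real n * (l\<^sup>2 / 2))) * (l ^ 6 / 1350 * frame_defect)"
  proof (intro mult_right_mono mult_left_mono)
    have "l\<^sup>2 \<le> 1\<^sup>2" using l by (intro power_mono) auto
    then have "real n * (l\<^sup>2 / 2) \<le> real n * 1" by (intro mult_left_mono) auto
    then show "exp (- real n) \<le> exp (- (real n * (l\<^sup>2 / 2)))" by simp
  qed (use frame_defect_nonneg in auto)
  also have "\<dots> \<le> 2 ^ n * exp (- (real n * (l\<^sup>2 / 2))) * gauss_expect n (\<lambda>x. defect (mean_at 1 l x) (mean_at 1 l x))"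
    using expect_defect_ge[OF l0 l(2)] by (intro mult_left_mono) auto
  also have "\<dots> = gauss_expect n (\<lambda>x. 2 ^ n * exp (- (real n * (l\<^sup>2 / 2))) * defect (mean_at 1 l x) (mean_at 1 l x))"
    by (rule gauss_expect_cmult[symmetric])
  also have "\<dots> \<le> gauss_expect n (\<lambda>x. flow l x * defect (mean_at 1 l x) (mean_at 1 l x))"
    by (intro gauss_expect_mono moderate_const moderate_mult moderate_flow moderate_defect_mean mult_right_mono flow_ge defect_nonneg)
  finally have g: "2 ^ n * exp (- real n) * (l ^ 6 / 1350 * frame_defect) \<le> gauss_expect n (\<lambda>x. flow l x * defect (mean_at 1 l x) (mean_at 1 l x))" .
  have "2 ^ n * exp (- real n) * (1 / 2000) ^ 7 / 1350 * frame_defect = (1/2000) * (2 ^ n * exp (- real n) * ((1/2000) ^ 6 / 1350 * frame_defect))"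
    by (simp add: power_one_over)
  also have "\<dots> \<le> l * (2 ^ n * exp (- real n) * (l ^ 6 / 1350 * frame_defect))"
    using l frame_defect_nonneg by (intro mult_mono divide_right_mono power_mono) auto
  also have "\<dots> \<le> l * gauss_expect n (\<lambda>x. flow l x * defect (mean_at 1 l x) (mean_at 1 l x))"
    using g l0 by (rule mult_left_mono)
  finally show ?thesis unfolding expect_flow_deriv by simp
qed

lemma flow_0: "flow 0 x = 2 ^ n"
proof -
  have "tilted_moment 0 0 s = 2" for s by (simp add: tilted_moment_def)
  then show ?thesis by (simp add: flow_def sum_distrib_right[symmetric] sum_weight exp_n_ln2)
qed

text \<open>
  The decrease of the expected flow over \<open>[1/2000, 1/1000]\<close>, relative to \<open>2\<^sup>n\<close> and per unit of frame defect:
  the length \<open>1/2000\<close> times the rate in \<open>expect_flow_deriv_le\<close>.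
\<close>

definition gain :: real where "gain = exp (- real n) * (1 / 2000) ^ 8 / 1350"

theorem expect_flow_le:
  assumes l: "1 / 1000 \<le> l"
  shows "gauss_expect n (flow l) \<le> 2 ^ n * (1 - gain * frame_defect)"
proof -
  let ?k = "2 ^ n * exp (- real n) * (1 / 2000) ^ 7 / 1350 * frame_defect"
  let ?\<Phi> = "\<lambda>l. gauss_expect n (flow l)"
  have mono: "?\<Phi> b \<le> ?\<Phi> a" if "0 \<le> a" "a \<le> b" for a b
    using that(2)
  proof (rule DERIV_nonpos_imp_nonincreasing)
    fix t assume "a \<le> t" "t \<le> b"
    then show "\<exists>y. (?\<Phi> has_real_derivative y) (at t) \<and> y \<le> 0"
      using gauss_expect_flow_deriv[of t] expect_flow_deriv_nonpos[of t] that by auto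
  qed
  \<comment> \<open>The expectation decreases at rate at least \<open>?k\<close> on this interval and is nonincreasing elsewhere.\<close>
  have "?\<Phi> (1/1000) + ?k * (1/1000) \<le> ?\<Phi> (1/2000) + ?k * (1/2000)"
  proof (rule DERIV_nonpos_imp_nonincreasing[of "1/2000" "1/1000" "\<lambda>t. ?\<Phi> t + ?k * t"])
    fix t :: real assume t: "1/2000 \<le> t" "t \<le> 1/1000"
    have "((\<lambda>t. ?\<Phi> t + ?k * t) has_real_derivative gauss_expect n (flow_deriv t) + ?k * 1) (at t)"
      by (intro DERIV_add gauss_expect_flow_deriv DERIV_cmult DERIV_ident)
    then show "\<exists>y. ((\<lambda>t. ?\<Phi> t + ?k * t) has_real_derivative y) (at t) \<and> y \<le> 0"
      using expect_flow_deriv_le[OF t] by (intro exI[of _ "gauss_expect n (flow_deriv t) + ?k * 1"]) simp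
  qed simp
  moreover have "?\<Phi> l \<le> ?\<Phi> (1/1000)" using l by (intro mono) auto
  moreover have "?\<Phi> (1/2000) \<le> ?\<Phi> 0" by (intro mono) auto
  moreover have "?\<Phi> 0 = 2 ^ n" unfolding flow_0[abs_def] by (rule gauss_expect_const)
  moreover have "2 ^ n * (1 - gain * frame_defect) = 2 ^ n - ?k * (1/2000)"
    by (simp add: gain_def power_one_over algebra_simps)
  ultimately show ?thesis by argo
qed

end

section \<open>The volume bound with deficit\<close>

definition normal_mass :: "real \<Rightarrow> real"
  where "normal_mass R = (\<integral>z. indicator {-R..R} z * std_normal_density z \<partial>lborel)"

lemma normal_mass_tendsto: "(normal_mass \<longlongrightarrow> 1) at_top"
proof -
  have "((\<lambda>R. \<integral>z. indicator {-R..R} z * std_normal_density z \<partial>lborel) \<longlongrightarrow> (\<integral>z. std_normal_density z \<partial>lborel)) at_top"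
  proof (rule integral_dominated_convergence_at_top[where w = std_normal_density])
    show "AE z in lborel. ((\<lambda>R. indicator {-R..R} z * std_normal_density z) \<longlongrightarrow> std_normal_density z) at_top"
    proof (rule AE_I2)
      fix z :: real
      have "\<forall>\<^sub>F R in at_top. indicator {-R..R} z * std_normal_density z = std_normal_density z"
        using eventually_ge_at_top[of "\<bar>z\<bar>"] by eventually_elim (auto simp: indicator_def)
      then show "((\<lambda>R. indicator {-R..R} z * std_normal_density z) \<longlongrightarrow> std_normal_density z) at_top"
        by (rule tendsto_eventually)
    qed
    show "\<forall>\<^sub>F R in at_top. AE z in lborel. norm (indicator {-R..R} z * std_normal_density z) \<le> std_normal_density z"
      by (intro always_eventually allI AE_I2) (auto simp: indicator_def)
  qed auto
  then show ?thesis by (simp add: normal_mass_def[abs_def])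
qed

text \<open>
  If \<open>\<phi>\<close> is the normal density, then \<open>tilted_moment 0 l s \<cdot> \<phi>(s)\<close> is the integral of \<open>\<phi>(s - l y)\<close>
  over \<open>[-1, 1]\<close>. For \<open>s = l t\<close> with \<open>|t| \<le> 1 - \<kappa>\<close> the interval swept by \<open>s - l y\<close> contains
  \<open>[-l \<kappa>, l \<kappa>]\<close>.
\<close>

lemma tilted_moment_ge_normal_mass:
  assumes l: "l > 0" and t: "\<bar>t\<bar> \<le> 1 - \<kappa>"
  shows "tilted_moment 0 l (l * t) * std_normal_density (l * t) \<ge> normal_mass (l * \<kappa>) / l"
proof -
  have eq: "exp (l * (l * t) * y - l\<^sup>2 * y\<^sup>2 / 2) * std_normal_density (l * t) = std_normal_density (- (l * t) + l * y)" for y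
  proof -
    have "l * (l * t) * y - l\<^sup>2 * y\<^sup>2 / 2 + - (l * t)\<^sup>2 / 2 = - (- (l * t) + l * y)\<^sup>2 / 2"
      by (simp add: power2_eq_square field_simps)
    then have "exp (l * (l * t) * y - l\<^sup>2 * y\<^sup>2 / 2) * exp (- (l * t)\<^sup>2 / 2) = exp (- (- (l * t) + l * y)\<^sup>2 / 2)"
      by (simp only: exp_add[symmetric])
    then show ?thesis unfolding std_normal_density_def by (simp add: mult_ac)
  qed
  have "set_integrable lborel {-1..1} (\<lambda>y. y ^ 0 * exp (l * (l * t) * y - l\<^sup>2 * y\<^sup>2 / 2))"
    by (rule borel_integrable_atLeastAtMost') (intro continuous_intros, auto)
  from set_borel_integral_eq_integral(2)[OF this]
  have "tilted_moment 0 l (l * t) = (\<integral>y. indicator {-1..1} y * exp (l * (l * t) * y - l\<^sup>2 * y\<^sup>2 / 2) \<partial>lborel)"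
    by (simp add: tilted_moment_def set_lebesgue_integral_def)
  then have "tilted_moment 0 l (l * t) * std_normal_density (l * t)
      = (\<integral>y. indicator {-1..1} y * std_normal_density (- (l * t) + l * y) \<partial>lborel)"
    by (simp only: integral_mult_left_zero[symmetric] mult.assoc[of "indicator _ _"] eq)
  also have "\<dots> = (1 / l) * (\<integral>z. indicator {-1..1} (t + z / l) * std_normal_density z \<partial>lborel)"
  proof -
    have "t + (- (l * t) + l * y) / l = y" for y using l by (simp add: field_simps)
    then show ?thesis
      using l lborel_integral_real_affine[of l "\<lambda>z. indicator {-1..1} (t + z / l) * std_normal_density z" "- (l * t)"]
      by simp
  qed
  also have "\<dots> \<ge> (1 / l) * normal_mass (l * \<kappa>)"
    unfolding normal_mass_def
  proof (intro mult_left_mono integral_mono)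
    show "integrable lborel (\<lambda>z. indicator {- (l * \<kappa>)..l * \<kappa>} z * std_normal_density z)"
      by (rule Bochner_Integration.integrable_bound[where f = std_normal_density]) (auto simp: indicator_def)
    show "integrable lborel (\<lambda>z. indicator {-1..1} (t + z / l) * std_normal_density z)"
    proof (rule Bochner_Integration.integrable_bound[where f = std_normal_density])
      show "(\<lambda>z. indicator {-1..1} (t + z / l) * std_normal_density z) \<in> borel_measurable lborel"
        using l by (intro borel_measurable_times measurable_compose[OF _ borel_measurable_indicator, where N = borel]) auto
    qed (auto simp: indicator_def)
    fix z :: real
    have "indicator {- (l * \<kappa>)..l * \<kappa>} z \<le> (indicator {-1..1} (t + z / l) :: real)"
    proof (cases "\<bar>z\<bar> \<le> l * \<kappa>")
      case True
      then have "\<bar>z / l\<bar> \<le> \<kappa>" using l by (simp add: abs_divide divide_le_eq mult.commute)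
      then have "\<bar>t + z / l\<bar> \<le> 1" using t by linarith
      then show ?thesis by (auto simp: indicator_def abs_le_iff)
    qed (auto simp: indicator_def abs_le_iff)
    then show "indicator {- (l * \<kappa>)..l * \<kappa>} z * std_normal_density z \<le> indicator {-1..1} (t + z / l) * std_normal_density z"
      by (intro mult_right_mono) auto
  qed (use l in auto)
  finally show ?thesis by simp
qed

lemma vol_eq_PiL: "S \<in> sets borel \<Longrightarrow> vol n S = measure (PiL n) (pad n -` S \<inter> space (PiL n))"
  unfolding vol_def lebesgue_E_eq by (rule measure_distr[OF measurable_pad])

lemma emeasure_eq_PiL: "S \<in> sets borel \<Longrightarrow> emeasure (lebesgue_E n) S = emeasure (PiL n) (pad n -` S \<inter> space (PiL n))"
  unfolding lebesgue_E_eq by (rule emeasure_distr[OF measurable_pad])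

context weighted_frame
begin

lemma coeff_pad: "coeff i (pad n x) = coeff i x"
  by (simp add: coeff_def pad_def)

text \<open>
  By \<open>\<Sum> c\<^sub>i \<langle>u\<^sub>i, x\<rangle>\<^sup>2 = |x|\<^sup>2\<close> and \<open>\<Sum> c\<^sub>i = n\<close> the Gaussian density factorises into the
  one-dimensional densities at \<open>\<langle>u\<^sub>i, x\<rangle>\<close> with exponents \<open>c\<^sub>i\<close>, exactly as the flow does, so the
  one-dimensional estimate applies to each factor.
\<close>

lemma flow_density_ge:
  assumes l: "l > 0" and J: "normal_mass (l * \<kappa>) > 0"
    and x: "\<And>i. i \<in> I \<Longrightarrow> \<bar>coeff i x\<bar> \<le> l * (1 - \<kappa>)"
  shows "flow l x * gauss_density n x \<ge> (normal_mass (l * \<kappa>) / l) ^ n"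
proof -
  let ?J = "normal_mass (l * \<kappa>)"
  have sn: "std_normal_density z = exp (- z\<^sup>2 / 2 - ln (sqrt (2 * pi)))" for z
    by (simp add: std_normal_density_def exp_diff)
  have "gauss_density n x = exp (\<Sum>k<n. (- (x k)\<^sup>2 / 2 - ln (sqrt (2 * pi))))"
    by (simp add: gauss_density_def sn exp_sum)
  also have "(\<Sum>k<n. (- (x k)\<^sup>2 / 2 - ln (sqrt (2 * pi)))) = - (\<Sum>k<n. x k * x k) / 2 - real n * ln (sqrt (2 * pi))"
    by (simp add: sum_subtractf sum_negf sum_divide_distrib power2_eq_square)
  also have "\<dots> = (\<Sum>i\<in>I. c i * (- (coeff i x)\<^sup>2 / 2 - ln (sqrt (2 * pi))))"
    unfolding parseval[symmetric] sum_weight[symmetric]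
    by (simp add: sum_subtractf sum_negf sum_divide_distrib sum_distrib_right power2_eq_square algebra_simps)
  finally have gd: "gauss_density n x = exp (\<Sum>i\<in>I. c i * (- (coeff i x)\<^sup>2 / 2 - ln (sqrt (2 * pi))))" .
  have "ln (?J / l) \<le> ln (tilted_moment 0 l (coeff i x)) + (- (coeff i x)\<^sup>2 / 2 - ln (sqrt (2 * pi)))" if i: "i \<in> I" for i
  proof -
    have t: "\<bar>coeff i x / l\<bar> \<le> 1 - \<kappa>" using x[OF i] l by (simp add: abs_divide divide_le_eq mult.commute)
    have "?J / l \<le> tilted_moment 0 l (coeff i x) * std_normal_density (coeff i x)"
      using tilted_moment_ge_normal_mass[OF l t] l by simp
    then have "ln (?J / l) \<le> ln (tilted_moment 0 l (coeff i x) * std_normal_density (coeff i x))"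
      using J l tilted_moment0_pos[of l "coeff i x"] by (subst ln_le_cancel_iff) (auto intro!: mult_pos_pos normal_density_pos)
    also have "\<dots> = ln (tilted_moment 0 l (coeff i x)) + (- (coeff i x)\<^sup>2 / 2 - ln (sqrt (2 * pi)))"
      using tilted_moment0_pos[of l "coeff i x"] by (simp add: sn ln_mult)
    finally show ?thesis .
  qed
  then have "(\<Sum>i\<in>I. c i * ln (?J / l)) \<le> (\<Sum>i\<in>I. c i * (ln (tilted_moment 0 l (coeff i x)) + (- (coeff i x)\<^sup>2 / 2 - ln (sqrt (2 * pi)))))"
    using weight_pos by (intro sum_mono mult_left_mono) (auto intro: less_imp_le)
  then have "exp (real n * ln (?J / l)) \<le> flow l x * gauss_density n x"
    unfolding gd flow_def exp_add[symmetric] sum.distrib[symmetric] distrib_left[symmetric]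
    by (simp add: sum_weight sum_distrib_right[symmetric])
  moreover have "exp (real n * ln (?J / l)) = (?J / l) ^ n"
    using J l by (simp add: exp_of_nat_mult)
  ultimately show ?thesis by simp
qed

text \<open>
  On the dilate \<open>l (1 - \<kappa>) K\<close> the integrand is at least \<open>(normal_mass (l \<kappa>) / l)\<^sup>n\<close>, and the dilation
  contributes \<open>(l (1 - \<kappa>))\<^sup>n\<close> to the volume.
\<close>

lemma gauss_expect_flow_ge:
  assumes K: "K \<in> sets borel" "K \<subseteq> Espace n" "emeasure (lebesgue_E n) K < \<infinity>"
    and contact: "\<And>x i. x \<in> K \<Longrightarrow> i \<in> I \<Longrightarrow> \<bar>coeff i x\<bar> \<le> 1"
    and l: "l > 0" and \<kappa>: "0 < \<kappa>" "\<kappa> < 1" and J: "normal_mass (l * \<kappa>) > 0"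
  shows "gauss_expect n (flow l) \<ge> (normal_mass (l * \<kappa>)) ^ n * ((1 - \<kappa>) ^ n * vol n K)"
proof -
  let ?J = "normal_mass (l * \<kappa>)"
  define s where "s = l * (1 - \<kappa>)"
  have s: "s > 0" using l \<kappa> by (simp add: s_def)
  define S where "S = (\<lambda>x. s *\<^sub>R x) ` K"
  have Sb: "S \<in> sets borel" unfolding S_def using K s by (intro borel_scale_image) auto
  define A where "A = pad n -` S \<inter> space (PiL n)"
  have A: "A \<in> sets (PiL n)" unfolding A_def by (rule measurable_sets[OF measurable_pad Sb])
  have "emeasure (lebesgue_E n) S < \<infinity>"
    unfolding S_def using K s by (simp add: emeasure_scale_image ennreal_mult_less_top)
  then have fin: "emeasure (PiL n) A < \<infinity>"
    unfolding A_def emeasure_eq_PiL[OF Sb] .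
  have "(?J / l) ^ n * measure (PiL n) A = (\<integral>x. indicator A x * (?J / l) ^ n \<partial>PiL n)"
    using fin A by simp
  also have "\<dots> \<le> gauss_expect n (flow l)"
    unfolding gauss_expect_def
  proof (rule integral_mono)
    show "integrable (PiL n) (\<lambda>x. indicator A x * (?J / l) ^ n)" using A fin by simp
    show "integrable (PiL n) (\<lambda>x. flow l x * gauss_density n x)" by (rule integrable_moderate[OF moderate_flow])
    fix x
    show "indicator A x * (?J / l) ^ n \<le> flow l x * gauss_density n x"
    proof (cases "x \<in> A")
      case True
      then obtain y where y: "y \<in> K" "pad n x = s *\<^sub>R y" by (auto simp: A_def S_def)
      have "coeff i x = s * coeff i y" for i
        unfolding coeff_pad[of i x, symmetric] y(2) by (simp add: coeff_def sum_distrib_left mult_ac)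
      then have "\<bar>coeff i x\<bar> \<le> s" if "i \<in> I" for i
        using contact[OF y(1) that] s by (simp add: abs_mult mult_left_le)
      then have "\<bar>coeff i x\<bar> \<le> l * (1 - \<kappa>)" if "i \<in> I" for i
        using that by (simp add: s_def)
      from flow_density_ge[OF l J this] True show ?thesis by simp
    qed (use less_imp_le[OF flow_pos] in simp)
  qed
  also have "measure (PiL n) A = s ^ n * vol n K"
    unfolding A_def vol_eq_PiL[OF Sb, symmetric] unfolding S_def by (rule vol_scale_image[OF K(1,2) s])
  also have "(?J / l) ^ n * (s ^ n * vol n K) = ?J ^ n * ((1 - \<kappa>) ^ n * vol n K)"
    using l by (simp add: s_def power_divide power_mult_distrib)
  finally show ?thesis .
qed

text \<open>
  The upper bound for the expected flow holds for all large \<open>l\<close>. In the limit \<open>l \<rightarrow> \<infinity>\<close> the lower bound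
  tends to \<open>(1 - \<kappa>)\<^sup>n V(K)\<close>, and then \<open>\<kappa> \<rightarrow> 0\<close>.
\<close>

theorem vol_le_frame_defect:
  assumes K: "K \<in> sets borel" "K \<subseteq> Espace n" "emeasure (lebesgue_E n) K < \<infinity>"
    and contact: "\<And>x i. x \<in> K \<Longrightarrow> i \<in> I \<Longrightarrow> \<bar>coeff i x\<bar> \<le> 1"
  shows "vol n K \<le> 2 ^ n * (1 - gain * frame_defect)"
proof -
  let ?B = "2 ^ n * (1 - gain * frame_defect)"
  have le: "(1 - \<kappa>) ^ n * vol n K \<le> ?B" if \<kappa>: "0 < \<kappa>" "\<kappa> < 1" for \<kappa>
  proof -
    have "filterlim (\<lambda>l. l * \<kappa>) at_top at_top"
      using \<kappa> by (intro filterlim_at_top_mult_tendsto_pos[OF tendsto_const] filterlim_ident) auto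
    then have lim: "((\<lambda>l. normal_mass (l * \<kappa>)) \<longlongrightarrow> 1) at_top"
      by (rule filterlim_compose[OF normal_mass_tendsto])
    then have "((\<lambda>l. normal_mass (l * \<kappa>) ^ n * ((1 - \<kappa>) ^ n * vol n K)) \<longlongrightarrow> 1 ^ n * ((1 - \<kappa>) ^ n * vol n K)) at_top"
      by (intro tendsto_intros)
    moreover have "\<forall>\<^sub>F l in at_top. normal_mass (l * \<kappa>) ^ n * ((1 - \<kappa>) ^ n * vol n K) \<le> ?B"
      using order_tendstoD(1)[OF lim, of 0, simplified] eventually_ge_at_top[of 1]
    proof eventually_elim
      case (elim l)
      have "normal_mass (l * \<kappa>) ^ n * ((1 - \<kappa>) ^ n * vol n K) \<le> gauss_expect n (flow l)"
        using elim by (intro gauss_expect_flow_ge K contact \<kappa>) auto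
      also have "\<dots> \<le> ?B" using elim by (intro expect_flow_le) auto
      finally show ?case .
    qed
    ultimately have "1 ^ n * ((1 - \<kappa>) ^ n * vol n K) \<le> ?B"
      by (rule tendsto_upperbound) simp
    then show ?thesis by simp
  qed
  have "((\<lambda>\<kappa>. (1 - \<kappa>) ^ n * vol n K) \<longlongrightarrow> (1 - 0) ^ n * vol n K) (at_right (0::real))"
    by (intro tendsto_intros)
  moreover have "\<forall>\<^sub>F \<kappa> in at_right (0::real). (1 - \<kappa>) ^ n * vol n K \<le> ?B"
    unfolding eventually_at_right_field by (intro exI[of _ 1]) (auto intro: le)
  ultimately have "(1 - 0) ^ n * vol n K \<le> ?B" by (rule tendsto_upperbound) simp
  then show ?thesis by simp
qed

end

section \<open>John's decomposition of the identity\<close>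

lemma nonneg_of_quadratic:
  fixes a b :: real
  assumes "\<And>t. 0 < t \<Longrightarrow> t \<le> 1 \<Longrightarrow> 0 \<le> 2 * t * a + t\<^sup>2 * b"
  shows "0 \<le> a"
proof (rule ccontr)
  assume "\<not> 0 \<le> a"
  then have a: "a < 0" by simp
  define t where "t = min 1 (- a / (\<bar>b\<bar> + 1))"
  have t: "0 < t" "t \<le> 1" "t \<le> - a / (\<bar>b\<bar> + 1)" using a by (auto simp: t_def divide_neg_pos)
  then have t3: "t * (\<bar>b\<bar> + 1) \<le> - a" by (subst (asm) pos_le_divide_eq) auto
  have "0 \<le> t * (2 * a + t * b)" using assms[OF t(1,2)] by (simp add: power2_eq_square algebra_simps)
  then have "0 \<le> 2 * a + t * b" using t(1) by (simp add: zero_le_mult_iff)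
  moreover have "t * b \<le> t * (\<bar>b\<bar> + 1)" using t by (intro mult_left_mono) auto
  ultimately show False using t3 a by linarith
qed

lemma exists_linear_dependence:
  fixes a :: "'i \<Rightarrow> nat \<Rightarrow> real"
  assumes "finite I" "m < card I"
  shows "\<exists>\<mu>. (\<exists>i\<in>I. \<mu> i \<noteq> 0) \<and> (\<forall>k<m. (\<Sum>i\<in>I. \<mu> i * a i k) = 0)"
  using assms
proof (induction m arbitrary: I a)
  case 0
  then have "I \<noteq> {}" by auto
  then show ?case by (intro exI[of _ "\<lambda>_. 1"]) auto
next
  case (Suc m)
  show ?case
  proof (cases "\<forall>i\<in>I. a i m = 0")
    case True
    obtain \<mu> where "\<exists>i\<in>I. \<mu> i \<noteq> 0" "\<forall>k<m. (\<Sum>i\<in>I. \<mu> i * a i k) = 0"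
      using Suc.IH[of I a] Suc.prems by auto
    with True show ?thesis by (intro exI[of _ \<mu>]) (auto simp: less_Suc_eq)
  next
    case False
    then obtain p where p: "p \<in> I" "a p m \<noteq> 0" by auto
    define J where "J = I - {p}"
    have J: "finite J" "p \<notin> J" "I = insert p J" "m < card J"
      using Suc.prems p by (auto simp: J_def)
    obtain \<mu> where \<mu>: "\<exists>i\<in>J. \<mu> i \<noteq> 0" "\<forall>k<m. (\<Sum>i\<in>J. \<mu> i * (a i k - a i m / a p m * a p k)) = 0"
      using Suc.IH[of J "\<lambda>i k. a i k - a i m / a p m * a p k"] J by auto
    define q where "q = - (\<Sum>i\<in>J. \<mu> i * (a i m / a p m))"
    define \<nu> where "\<nu> = \<mu>(p := q)"
    have "(\<Sum>i\<in>I. \<nu> i * a i k) = 0" if "k < Suc m" for k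
    proof -
      have "(\<Sum>i\<in>I. \<nu> i * a i k) = q * a p k + (\<Sum>i\<in>J. \<mu> i * a i k)"
        unfolding J(3) \<nu>_def using J(1,2) by (subst sum.insert) (auto intro!: sum.cong)
      also have "\<dots> = (\<Sum>i\<in>J. \<mu> i * (a i k - a i m / a p m * a p k))"
        by (simp add: q_def right_diff_distrib sum_subtractf sum_distrib_right mult.assoc)
      also have "\<dots> = 0"
      proof (cases "k = m")
        case True
        then show ?thesis using p(2) by simp
      next
        case False
        with that \<mu>(2) show ?thesis by simp
      qed
      finally show ?thesis .
    qed
    moreover have "\<exists>i\<in>I. \<nu> i \<noteq> 0" using \<mu>(1) J by (auto simp: \<nu>_def)
    ultimately show ?thesis by blast
  qed
qed

definition outer_sum :: "nat \<Rightarrow> (nat \<Rightarrow> real) \<Rightarrow> (nat \<Rightarrow> nat \<Rightarrow> real) \<Rightarrow> nat \<Rightarrow> nat \<Rightarrow> real"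
  where "outer_sum N w v j k = (\<Sum>i<N. w i * v i j * v i k)"

text \<open>
  Caratheodory's argument. The matrices \<open>v\<^sub>i \<otimes> v\<^sub>i\<close>, each extended by an entry \<open>1\<close>, live in dimension
  \<open>n\<^sup>2 + 1\<close>, so more than that many are linearly dependent; moving the weights along a dependence
  changes neither the sum nor the total weight, and it can be continued until a weight vanishes.
\<close>

lemma drop_one_weight:
  assumes w: "\<And>i. 0 \<le> w i" "(\<Sum>i<N. w i) = 1" and N: "n * n + 1 < N"
  obtains w' i0 where "\<And>i. 0 \<le> w' i" "(\<Sum>i<N. w' i) = 1" "i0 < N" "w' i0 = 0"
    "\<And>j k. j < n \<Longrightarrow> k < n \<Longrightarrow> outer_sum N w' v j k = outer_sum N w v j k"
proof -
  \<comment> \<open>The pair \<open>(j, k)\<close> is coded as the index \<open>j * n + k\<close>; the index \<open>n * n\<close> stands for the total weight.\<close>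
  define a where "a i k = (if k = n * n then 1 else v i (k div n) * v i (k mod n))" for i k
  obtain \<mu> where \<mu>: "\<exists>i\<in>{..<N}. \<mu> i \<noteq> 0" "\<forall>k<n * n + 1. (\<Sum>i<N. \<mu> i * a i k) = 0"
    using exists_linear_dependence[of "{..<N}" "n * n + 1" a] N by auto
  have s0: "(\<Sum>i<N. \<mu> i) = 0" using \<mu>(2)[rule_format, of "n * n"] by (simp add: a_def)
  have sjk: "(\<Sum>i<N. \<mu> i * (v i j * v i k)) = 0" if jk: "j < n" "k < n" for j k
  proof -
    have "j * n + k < (j + 1) * n" using jk by simp
    also have "\<dots> \<le> n * n" using jk by (intro mult_right_mono) auto
    finally have lt: "j * n + k < n * n" .
    moreover have "(j * n + k) div n = j" "(j * n + k) mod n = k" using jk by auto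
    ultimately show ?thesis using \<mu>(2)[rule_format, of "j * n + k"] by (simp add: a_def)
  qed
  define P where "P = {i. i < N \<and> \<mu> i > 0}"
  have P: "finite P" "P \<noteq> {}"
  proof -
    show "finite P" by (simp add: P_def)
    show "P \<noteq> {}"
    proof
      assume "P = {}"
      then have le: "\<mu> i \<le> 0" if "i < N" for i using that by (force simp: P_def)
      have "\<forall>i\<in>{..<N}. - \<mu> i = 0"
        using s0 le by (subst sum_nonneg_eq_0_iff[symmetric]) (auto simp: sum_negf)
      with \<mu>(1) show False by auto
    qed
  qed
  \<comment> \<open>The largest step along \<open>\<mu>\<close> that keeps all weights nonnegative.\<close>
  define t where "t = Min ((\<lambda>i. w i / \<mu> i) ` P)"
  have "t \<in> (\<lambda>i. w i / \<mu> i) ` P" unfolding t_def using P by (intro Min_in) auto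
  then obtain i0 where i0: "i0 \<in> P" "t = w i0 / \<mu> i0" by auto
  have t0: "t \<ge> 0" using i0 w(1)[of i0] by (auto simp: P_def)
  define w' where "w' i = (if i < N then w i - t * \<mu> i else 0)" for i
  show ?thesis
  proof
    show "0 \<le> w' i" for i
    proof (cases "i \<in> P")
      case True
      then have "t \<le> w i / \<mu> i" unfolding t_def using P by (intro Min_le) auto
      with True show ?thesis by (simp add: w'_def P_def pos_le_divide_eq)
    next
      case False
      then have "t * \<mu> i \<le> 0" if "i < N" using that t0 by (intro mult_nonneg_nonpos) (auto simp: P_def)
      with w(1)[of i] show ?thesis by (auto simp: w'_def intro: order_trans)
    qed
    show "(\<Sum>i<N. w' i) = 1" using w(2) s0 by (simp add: w'_def sum_subtractf sum_distrib_left[symmetric])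
    show "i0 < N" using i0 by (simp add: P_def)
    show "w' i0 = 0" using i0 by (auto simp: w'_def P_def)
    fix j k assume "j < n" "k < n"
    then show "outer_sum N w' v j k = outer_sum N w v j k"
      using sjk[of j k]
      by (simp add: outer_sum_def w'_def left_diff_distrib sum_subtractf mult.assoc flip: sum_distrib_left)
  qed
qed

lemma polar_compact:
  assumes r: "r > 0" "Eball n 0 r \<subseteq> K"
  shows "compact (polar n K)"
proof -
  have sub: "polar n K \<subseteq> box_E n (\<lambda>_. 1 / r)"
  proof
    fix v assume v: "v \<in> polar n K"
    then have vE: "v \<in> Espace n" by (simp add: polar_def)
    have "\<bar>v i\<bar> \<le> 1 / r" if i: "i < n" for i
    proof -
      define e where "e s = (\<lambda>k. if k = i then s * r else 0)" for s :: real
      have "e s \<in> Eball n 0 r" if "\<bar>s\<bar> = 1" for s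
      proof -
        have "dot n (e s) (e s) = (\<Sum>k<n. if k = i then s * r * (s * r) else 0)"
          unfolding dot_def e_def by (intro sum.cong) auto
        also have "\<dots> = (\<bar>s\<bar>)\<^sup>2 * r\<^sup>2" using i by (simp add: power2_eq_square)
        finally show ?thesis using r i that by (auto simp: Eball_0_eq e_def)
      qed
      then have "dot n (e s) v \<le> 1" if "\<bar>s\<bar> = 1" for s using that v r by (auto simp: polar_def)
      moreover have "dot n (e s) v = s * r * v i" for s
      proof -
        have "dot n (e s) v = (\<Sum>k<n. if k = i then s * r * v i else 0)"
          unfolding dot_def e_def by (intro sum.cong) auto
        then show ?thesis using i by simp
      qed
      ultimately have "r * v i \<le> 1" "- (r * v i) \<le> 1" by (metis abs_one mult_1, metis abs_minus_cancel abs_one mult_minus1 mult_minus_left)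
      then have "\<bar>v i\<bar> * r \<le> 1" using r(1) by (simp add: abs_if mult.commute)
      then show ?thesis using r(1) by (simp add: pos_le_divide_eq)
    qed
    with vE show "v \<in> box_E n (\<lambda>_. 1 / r)" by (simp add: box_E_def)
  qed
  have "polar n K = box_E n (\<lambda>_. 1 / r) \<inter> (\<Inter>x\<in>K. {v. dot n x v \<le> 1})"
    using sub by (auto simp: polar_def box_E_def)
  moreover have "compact \<dots>"
    by (intro compact_Int_closed compact_box_E closed_INT ballI
          closed_Collect_le[OF continuous_on_dot[OF continuous_on_const continuous_on_id] continuous_on_const])
  ultimately show ?thesis by simp
qed

lemma polar_norm_le_1:
  assumes K: "Eball n 0 1 \<subseteq> K" and v: "v \<in> polar n K"
  shows "dot n v v \<le> 1"
proof (cases "dot n v v = 0")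
  case False
  then have p: "dot n v v > 0" using dot_self_nonneg[of n v] by linarith
  have "(1 / sqrt (dot n v v)) *\<^sub>R v \<in> Eball n 0 1"
    using p v by (auto simp: Eball_0_eq dot_simps polar_def)
  then have "dot n ((1 / sqrt (dot n v v)) *\<^sub>R v) v \<le> 1" using v K by (auto simp: polar_def)
  then have "sqrt (dot n v v) \<le> 1" using p by (simp add: dot_simps real_div_sqrt)
  then show ?thesis by simp
qed simp

lemma Eball_vol_pos: "n > 0 \<Longrightarrow> vol n (Eball n 0 1) > 0"
proof -
  assume n: "n > 0"
  have "box_E n (\<lambda>_. 1 / n) \<subseteq> Eball n 0 1"
  proof
    fix x assume x: "x \<in> box_E n (\<lambda>_. 1 / n)"
    have "dot n x x \<le> (\<Sum>i<n. 1 / n)"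
      unfolding dot_def
    proof (rule sum_mono)
      fix i assume i: "i \<in> {..<n}"
      then have le: "\<bar>x i\<bar> \<le> 1 / n" using x by (auto simp: box_E_def)
      then have "\<bar>x i\<bar> * \<bar>x i\<bar> \<le> 1 / n * 1" using n by (intro mult_mono) (auto intro: order_trans[OF le])
      then show "x i * x i \<le> 1 / n" by simp
    qed
    also have "\<dots> = 1" using n by simp
    finally show "x \<in> Eball n 0 1" using x by (simp add: Eball_0_eq box_E_def)
  qed
  then have "vol n (box_E n (\<lambda>_. 1 / n)) \<le> vol n (Eball n 0 1)"
    by (intro vol_mono compact_imp_borel compact_box_E compact_Eball_0) (auto simp: Eball_0_eq)
  moreover have "vol n (box_E n (\<lambda>_. 1 / n)) > 0" using n by (subst vol_box_E) (auto intro!: prod_pos)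
  ultimately show ?thesis by linarith
qed

text \<open>
  A permutation other than the identity moves at least two indices, so its term in the Leibniz formula
  vanishes to second order; the identity contributes the trace.
\<close>

lemma det_one_plus_deriv:
  fixes X :: "nat \<Rightarrow> nat \<Rightarrow> real"
  shows "((\<lambda>s. Determinant.det (mat n n (\<lambda>(i,j). (if i = j then 1 else 0) + s * X i j)))
     has_field_derivative (\<Sum>i<n. X i i)) (at 0)"
proof -
  let ?e = "\<lambda>i j s. (if i = j then 1 else 0) + s * X i j"
  have det: "Determinant.det (mat n n (\<lambda>(i,j). ?e i j s)) =
      (\<Sum> p \<in> {p. p permutes {0 ..< n}}. signof p * (\<Prod> i = 0 ..< n. ?e i (p i) s))" for s
  proof -
    have "(\<Prod> i = 0 ..< n. mat n n (\<lambda>(i,j). ?e i j s) $$ (i, p i)) = (\<Prod> i = 0 ..< n. ?e i (p i) s)"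
      if "p permutes {0..<n}" for p
    proof (rule prod.cong[OF refl])
      fix i assume "i \<in> {0..<n}"
      moreover from this have "p i < n" using that by (metis atLeastLessThan_iff permutes_in_image)
      ultimately show "mat n n (\<lambda>(i,j). ?e i j s) $$ (i, p i) = ?e i (p i) s" by simp
    qed
    then show ?thesis by (subst det_def'[of _ n]) (auto intro!: sum.cong)
  qed
  have "((\<lambda>s. \<Sum> p \<in> {p. p permutes {0 ..< n}}. signof p * (\<Prod> i = 0 ..< n. ?e i (p i) s))
      has_field_derivative (\<Sum> p \<in> {p. p permutes {0 ..< n}}. signof p * (\<Sum>i = 0..<n. X i (p i) * (\<Prod>j\<in>{0..<n}-{i}. ?e j (p j) 0)))) (at 0)"
    by (intro DERIV_sum DERIV_cmult has_field_derivative_prod) (auto intro!: derivative_eq_intros)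
  also have "(\<Sum> p \<in> {p. p permutes {0 ..< n}}. signof p * (\<Sum>i = 0..<n. X i (p i) * (\<Prod>j\<in>{0..<n}-{i}. ?e j (p j) 0)))
      = (\<Sum> p \<in> {p. p permutes {0 ..< n}}. if p = id then (\<Sum>i<n. X i i) else 0)"
  proof (rule sum.cong[OF refl])
    fix p assume "p \<in> {p. p permutes {0 ..< n}}"
    then have p: "p permutes {0..<n}" by simp
    show "signof p * (\<Sum>i = 0..<n. X i (p i) * (\<Prod>j\<in>{0..<n}-{i}. ?e j (p j) 0)) = (if p = id then (\<Sum>i<n. X i i) else 0)"
    proof (cases "p = id")
      case True
      then show ?thesis by (simp add: atLeast0LessThan)
    next
      case False
      then obtain m where m: "p m \<noteq> m" by (auto simp: fun_eq_iff)
      then have mn: "m \<in> {0..<n}" using p by (meson permutes_not_in)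
      have pm: "p m \<in> {0..<n}" using p mn by (simp add: permutes_in_image)
      have ppm: "p (p m) \<noteq> p m" using m permutes_inj[OF p] by (meson injD)
      have "X i (p i) * (\<Prod>j\<in>{0..<n}-{i}. ?e j (p j) 0) = 0" for i
      proof -
        have "\<exists>j\<in>{0..<n}-{i}. p j \<noteq> j"
          using m mn pm ppm by (cases "i = m") auto
        then have "\<exists>j\<in>{0..<n}-{i}. ?e j (p j) 0 = 0" by force
        then have "(\<Prod>j\<in>{0..<n}-{i}. ?e j (p j) 0) = 0" by (intro prod_zero) auto
        then show ?thesis by simp
      qed
      then have "(\<Sum>i = 0..<n. X i (p i) * (\<Prod>j\<in>{0..<n}-{i}. ?e j (p j) 0)) = 0"
        by (intro sum.neutral ballI)
      with False show ?thesis by (simp only: mult_zero_right if_False)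
    qed
  qed
  also have "\<dots> = (\<Sum>i<n. X i i)"
    by (simp add: sum.delta' finite_permutations permutes_id)
  finally show ?thesis unfolding det .
qed

text \<open>
  The variational part of John's theorem. If the symmetric matrix \<open>G\<close> strictly separated \<open>I/n\<close> from the
  matrices \<open>v \<otimes> v\<close> with \<open>v\<close> in the polar body, then \<open>X = -(n/\<tau>) G - I\<close>, where \<open>\<tau> = - tr G > 0\<close>,
  has trace zero and \<open>\<langle>v, X v\<rangle> \<le> 1 - \<kappa> - |v|\<^sup>2\<close> on the polar body with \<open>\<kappa> = n d / \<tau>\<close>. For
  small \<open>t > 0\<close> the matrix \<open>A = I + t X\<close> satisfies \<open>|A v|\<^sup>2 \<le> 1 - t \<kappa> = \<theta>\<close> there, so that the image
  of the unit ball under \<open>A / sqrt \<theta>\<close> is contained in \<open>K\<close>, whereas \<open>det A = 1 + o(t) > \<theta>\<close>. As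
  \<open>n \<ge> 2\<close>, this ellipsoid has larger volume than the unit ball.
\<close>

lemma no_strict_separation:
  assumes n: "2 \<le> n"
    and K: "compact K" "convex K" "K \<subseteq> Espace n" "Eball n 0 1 \<subseteq> K"
    and max: "\<And>E. ellipsoid n E \<Longrightarrow> E \<subseteq> K \<Longrightarrow> vol n E \<le> vol n (Eball n 0 1)"
    and sym: "\<And>j k. G j k = G k j" and d: "d > 0"
    and sep: "\<And>v. v \<in> polar n K \<Longrightarrow> (\<Sum>j<n. \<Sum>k<n. G j k * (v j * v k)) \<ge> (\<Sum>j<n. G j j) / n + d"
  shows False
proof -
  have npos: "real n > 0" using n by simp
  define \<tau> where "\<tau> = - (\<Sum>j<n. G j j)"
  have "0 \<in> polar n K" by (simp add: polar_def dot_def)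
  from sep[OF this] have "\<tau> / n \<ge> d" by (simp add: \<tau>_def)
  with d have "0 < \<tau> / n" by linarith
  then have \<tau>: "\<tau> > 0" using npos by (simp add: zero_less_divide_iff)
  define X where "X j k = - (n / \<tau>) * G j k - (if j = k then 1 else 0)" for j k
  have symX: "X j k = X k j" for j k by (simp add: X_def sym[of j k])
  have trX: "(\<Sum>j<n. X j j) = 0"
  proof -
    have "(\<Sum>j<n. X j j) = - (n / \<tau>) * (\<Sum>j<n. G j j) - n"
      by (simp add: X_def sum_subtractf sum_distrib_left sum_negf)
    also have "(\<Sum>j<n. G j j) = - \<tau>" by (simp add: \<tau>_def)
    finally show ?thesis using \<tau> by simp
  qed
  define \<kappa> where "\<kappa> = n * d / \<tau>"
  have \<kappa>: "\<kappa> > 0" using npos d \<tau> by (simp add: \<kappa>_def)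
  define Xv where "Xv v j = (\<Sum>k<n. X j k * v k)" for v j
  have quad: "(\<Sum>j<n. v j * Xv v j) \<le> 1 - \<kappa> - dot n v v" if "v \<in> polar n K" for v
  proof -
    have "(\<Sum>j<n. v j * Xv v j) = - (n / \<tau>) * (\<Sum>j<n. \<Sum>k<n. G j k * (v j * v k)) - dot n v v"
    proof -
      have "v j * Xv v j = - (n / \<tau>) * (\<Sum>k<n. G j k * (v j * v k)) - (\<Sum>k<n. if j = k then v j * v k else 0)" for j
        unfolding Xv_def X_def sum_distrib_left sum_subtractf[symmetric]
        by (intro sum.cong refl) (simp add: algebra_simps)
      then have "(\<Sum>j<n. v j * Xv v j) = (\<Sum>j<n. - (n / \<tau>) * (\<Sum>k<n. G j k * (v j * v k)) - v j * v j)"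
        by (intro sum.cong refl) simp
      then show ?thesis by (simp add: sum_subtractf dot_def sum_distrib_left sum_negf)
    qed
    also have "\<dots> \<le> - (n / \<tau>) * ((\<Sum>j<n. G j j) / n + d) - dot n v v"
      using sep[OF that] \<tau> npos by (intro diff_right_mono mult_left_mono_neg) auto
    also have "- (n / \<tau>) * ((\<Sum>j<n. G j j) / n + d) = 1 - \<kappa>"
      using \<tau> npos by (simp add: \<kappa>_def \<tau>_def field_simps)
    finally show ?thesis .
  qed
  note unit = polar_norm_le_1[OF K(4)]
  have "\<exists>C. \<forall>v\<in>polar n K. (\<Sum>j<n. (Xv v j)\<^sup>2) \<le> C"
  proof -
    have "(Xv v j)\<^sup>2 \<le> (\<Sum>k<n. (X j k)\<^sup>2)" if "v \<in> polar n K" for v j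
    proof -
      have "(Xv v j)\<^sup>2 \<le> (\<Sum>k<n. (X j k)\<^sup>2) * (\<Sum>k<n. (v k)\<^sup>2)"
        unfolding Xv_def by (rule Cauchy_Schwarz_ineq_sum)
      also have "\<dots> \<le> (\<Sum>k<n. (X j k)\<^sup>2) * 1"
        using unit[OF that] by (intro mult_left_mono sum_nonneg) (auto simp: dot_def power2_eq_square)
      finally show ?thesis by simp
    qed
    then show ?thesis by (intro exI[of _ "\<Sum>j<n. \<Sum>k<n. (X j k)\<^sup>2"] ballI sum_mono)
  qed
  then obtain C where C: "\<And>v. v \<in> polar n K \<Longrightarrow> (\<Sum>j<n. (Xv v j)\<^sup>2) \<le> C" by blast
  define f where "f s = Determinant.det (mat n n (\<lambda>(i,j). (if i = j then 1 else 0) + s * X i j))" for s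
  have f0: "f 0 = 1"
  proof -
    have "mat n n (\<lambda>(i,j). (if i = j then 1 else 0) + 0 * X i j) = 1\<^sub>m n" by (intro eq_matI) auto
    then show ?thesis by (simp add: f_def)
  qed
  \<comment> \<open>As \<open>f\<close> has derivative \<open>tr X = 0\<close> at \<open>0\<close>, it stays above \<open>1 - s \<kappa>\<close> for small \<open>s > 0\<close>.\<close>
  have "((\<lambda>s. f s + s * \<kappa>) has_field_derivative 0 + 1 * \<kappa>) (at 0)"
    using det_one_plus_deriv[of n X] unfolding trX f_def by (intro DERIV_add DERIV_cmult_right DERIV_ident)
  from DERIV_pos_inc_right[OF this] \<kappa>
  have "\<exists>\<delta>>0. \<forall>h>0. h < \<delta> \<longrightarrow> f 0 < f h + h * \<kappa>" by simp
  then obtain \<delta> where \<delta>: "\<delta> > 0" "\<And>h. 0 < h \<Longrightarrow> h < \<delta> \<Longrightarrow> f 0 < f h + h * \<kappa>"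
    by blast
  \<comment> \<open>The bounds ensure, in this order: \<open>f t > \<theta>\<close>; \<open>1 - 2 t \<ge> 0\<close>; \<open>\<theta> > 0\<close>;
    \<open>t\<^sup>2 |X v|\<^sup>2 \<le> t \<kappa>\<close> on the polar body.\<close>
  define t where "t = min (\<delta> / 2) (min (1 / 2) (min (1 / (4 * \<kappa>)) (\<kappa> / (\<bar>C\<bar> + 1) / 2)))"
  have t: "0 < t" "t < \<delta>" "t \<le> 1 / 2" "t \<le> 1 / (4 * \<kappa>)" "t \<le> \<kappa> / (\<bar>C\<bar> + 1) / 2"
  proof -
    have 1: "t \<le> \<delta> / 2" and 2: "t \<le> 1 / 2" and 3: "t \<le> 1 / (4 * \<kappa>)" and 4: "t \<le> \<kappa> / (\<bar>C\<bar> + 1) / 2"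
      unfolding t_def by (simp_all only: min_le_iff_disj order_refl simp_thms)
    have "0 < \<delta> / 2" "0 < 1 / (4 * \<kappa>)" "0 < \<kappa> / (\<bar>C\<bar> + 1) / 2" using \<delta>(1) \<kappa> by auto
    then show "0 < t" unfolding t_def by (simp only: min_less_iff_conj simp_thms)
    show "t < \<delta>" using 1 \<delta>(1) by linarith
    show "t \<le> 1 / 2" "t \<le> 1 / (4 * \<kappa>)" "t \<le> \<kappa> / (\<bar>C\<bar> + 1) / 2" by (rule 2 3 4)+
  qed
  have t\<kappa>: "4 * (t * \<kappa>) \<le> 1" using t(4) \<kappa> by (simp add: pos_le_divide_eq)
  have "t * (\<bar>C\<bar> + 1) \<le> \<kappa> / 2" using t(5) by (simp add: pos_le_divide_eq field_simps)
  moreover have "t * C \<le> t * (\<bar>C\<bar> + 1)" using t by (intro mult_left_mono) auto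
  ultimately have tC: "t * C \<le> \<kappa>" using \<kappa> by linarith
  define \<theta> where "\<theta> = 1 - t * \<kappa>"
  have \<theta>: "0 < \<theta>" "\<theta> \<le> 1" using t\<kappa> t(1) \<kappa> by (auto simp: \<theta>_def)
  have ft: "f t > \<theta>" using \<delta>(2)[OF t(1,2)] by (simp add: f0 \<theta>_def)
  define A where "A = mat n n (\<lambda>(i,j). (if i = j then 1 else 0) + t * X i j)"
  have A: "A \<in> carrier_mat n n" by (simp add: A_def)
  have AT: "A\<^sup>T = A" by (intro eq_matI) (auto simp: A_def symX)
  have Av: "apply_mat A v i = v i + t * Xv v i" if "i < n" for v i
    using that by (simp add: apply_mat_def A_def Xv_def distrib_right sum.distrib mult_delta_left sum_distrib_left mult.assoc)
  have Apolar: "dot n (apply_mat A v) (apply_mat A v) \<le> \<theta>" if v: "v \<in> polar n K" for v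
  proof -
    have "dot n (apply_mat A v) (apply_mat A v) = (\<Sum>j<n. v j * v j + 2 * t * (v j * Xv v j) + t\<^sup>2 * (Xv v j)\<^sup>2)"
      unfolding dot_def by (intro sum.cong refl) (simp add: Av power2_eq_square algebra_simps)
    also have "\<dots> = dot n v v + 2 * t * (\<Sum>j<n. v j * Xv v j) + t\<^sup>2 * (\<Sum>j<n. (Xv v j)\<^sup>2)"
      by (simp add: sum.distrib sum_distrib_left dot_def)
    also have "\<dots> \<le> dot n v v + 2 * t * (1 - \<kappa> - dot n v v) + t\<^sup>2 * C"
      using quad[OF v] C[OF v] t by (intro add_mono mult_left_mono) auto
    also have "t\<^sup>2 * C \<le> t * \<kappa>" using tC t(1) by (simp add: power2_eq_square)
    also have "dot n v v + 2 * t * (1 - \<kappa> - dot n v v) + t * \<kappa> = (1 - 2 * t) * dot n v v + 2 * t - t * \<kappa>"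
      by (simp add: algebra_simps)
    also have "\<dots> \<le> (1 - 2 * t) * 1 + 2 * t - t * \<kappa>"
      using unit[OF v] t(3) by (intro add_right_mono diff_right_mono mult_left_mono) auto
    finally show ?thesis by (simp add: \<theta>_def)
  qed
  define B where "B = (1 / sqrt \<theta>) \<cdot>\<^sub>m A"
  have B: "B \<in> carrier_mat n n" using A by (simp add: B_def)
  have detB: "Determinant.det B = (1 / sqrt \<theta>) ^ n * f t"
    using A by (simp add: B_def f_def A_def det_smult)
  have "1 < Determinant.det B"
  proof -
    have "sqrt \<theta> ^ n \<le> sqrt \<theta> ^ 2" using \<theta> n by (intro power_decreasing) auto
    then have "sqrt \<theta> ^ n < f t" using \<theta> ft by simp
    then show ?thesis using \<theta> by (simp add: detB power_divide pos_less_divide_eq)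
  qed
  moreover have "vol n (apply_mat B ` Eball n 0 1) \<le> vol n (Eball n 0 1)"
  proof (rule max)
    have z: "(\<lambda>x. 0 + apply_mat B x) = apply_mat B" by simp
    have "0 \<in> Espace n" by simp
    then show "ellipsoid n (apply_mat B ` Eball n 0 1)"
      unfolding ellipsoid_def using B \<open>1 < Determinant.det B\<close>
      by (intro bexI[of _ B] bexI[of _ 0] conjI) (auto simp: z)
    show "apply_mat B ` Eball n 0 1 \<subseteq> K"
    proof
      fix x assume "x \<in> apply_mat B ` Eball n 0 1"
      then obtain y where y: "y \<in> Eball n 0 1" "x = apply_mat B y" by auto
      show "x \<in> K"
      proof (rule bipolar[OF K(1-3) _ K(4)])
        show "(0::real) < 1" by simp
        show "x \<in> Espace n" unfolding y(2) by (rule apply_mat_in_Espace[OF B])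
        fix v assume v: "v \<in> polar n K"
        have Bv: "apply_mat B\<^sup>T v = (1 / sqrt \<theta>) *\<^sub>R apply_mat A v"
        proof
          fix i
          have BT: "B\<^sup>T = (1 / sqrt \<theta>) \<cdot>\<^sub>m A" using A by (subst AT[symmetric]) (auto simp: B_def)
          show "apply_mat B\<^sup>T v i = ((1 / sqrt \<theta>) *\<^sub>R apply_mat A v) i"
            using A unfolding BT by (simp add: apply_mat_def sum_divide_distrib)
        qed
        have "(dot n x v)\<^sup>2 = (dot n y (apply_mat B\<^sup>T v))\<^sup>2" unfolding y(2) dot_apply_mat[OF B] ..
        also have "\<dots> \<le> dot n y y * dot n (apply_mat B\<^sup>T v) (apply_mat B\<^sup>T v)" by (rule dot_Cauchy_Schwarz)
        also have "dot n (apply_mat B\<^sup>T v) (apply_mat B\<^sup>T v) = dot n (apply_mat A v) (apply_mat A v) / \<theta>"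
          using \<theta> by (simp add: Bv dot_simps)
        also have "dot n y y * (dot n (apply_mat A v) (apply_mat A v) / \<theta>) \<le> 1 * 1"
          using y(1) Apolar[OF v] \<theta> dot_self_nonneg by (intro mult_mono) (auto simp: Eball_0_eq)
        finally have "(dot n x v)\<^sup>2 \<le> 1\<^sup>2" by simp
        then show "dot n x v \<le> 1" by (rule power2_le_imp_le) simp
      qed
    qed
  qed
  moreover have "vol n (apply_mat B ` Eball n 0 1) = \<bar>Determinant.det B\<bar> * vol n (Eball n 0 1)"
    using \<open>1 < Determinant.det B\<close>
    by (intro vol_apply_mat_image[OF B] compact_imp_borel compact_Eball_0) (auto simp: Eball_0_eq)
  ultimately show False using Eball_vol_pos[of n] n by simp
qed

text \<open>
  The residual \<open>F = |\<Sum> w\<^sub>i v\<^sub>i \<otimes> v\<^sub>i - I/n|\<^sup>2\<close> is minimised over convex weights \<open>w\<close> on \<open>N = n\<^sup>2 + 2\<close>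
  points \<open>v\<^sub>i\<close> of the polar body, a compact set. One weight may be assumed to be zero, and its slot
  can be used to move the minimiser towards an arbitrary \<open>y \<otimes> y\<close>. Stationarity says that the residual
  matrix \<open>g\<close> separates \<open>I/n\<close> from all \<open>y \<otimes> y\<close> with margin \<open>F\<close>, so \<open>F = 0\<close>. Points of the polar
  body have norm at most \<open>1\<close>, and taking traces in \<open>\<Sum> w\<^sub>i v\<^sub>i \<otimes> v\<^sub>i = I/n\<close> shows that those with positive
  weight have norm \<open>1\<close>.
\<close>

theorem john_decomposition:
  assumes n: "2 \<le> n"
    and K: "compact K" "convex K" "K \<subseteq> Espace n" "Eball n 0 1 \<subseteq> K" and sym: "\<And>x. x \<in> K \<Longrightarrow> - x \<in> K"
    and max: "\<And>E. ellipsoid n E \<Longrightarrow> E \<subseteq> K \<Longrightarrow> vol n E \<le> vol n (Eball n 0 1)"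
  obtains I :: "nat set" and c :: "nat \<Rightarrow> real" and u :: "nat \<Rightarrow> nat \<Rightarrow> real"
  where "finite I" "\<And>i. i \<in> I \<Longrightarrow> 0 < c i" "\<And>i. i \<in> I \<Longrightarrow> (\<Sum>k<n. (u i k)\<^sup>2) = 1"
    "\<And>j k. j < n \<Longrightarrow> k < n \<Longrightarrow> (\<Sum>i\<in>I. c i * u i j * u i k) = (if j = k then 1 else 0)"
    "\<And>x i. x \<in> K \<Longrightarrow> i \<in> I \<Longrightarrow> \<bar>\<Sum>k<n. u i k * x k\<bar> \<le> 1"
proof -
  have npos: "real n > 0" using n by simp
  define N where "N = n * n + 2"
  have N: "n * n + 1 < N" "0 < N" by (auto simp: N_def)
  define W where "W = {w :: nat \<Rightarrow> real. \<forall>i. w i \<in> {0..1}} \<inter> {w. (\<Sum>i<N. w i) = 1}"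
  define V where "V = {v :: nat \<Rightarrow> nat \<Rightarrow> real. \<forall>i. v i \<in> polar n K}"
  define G where "G w v j k = outer_sum N w v j k - (if j = k then 1 / n else 0)" for w v and j k :: nat
  define F where "F p = (\<Sum>j<n. \<Sum>k<n. (G (fst p) (snd p) j k)\<^sup>2)" for p
  have cW: "compact W"
  proof -
    have "closed {w :: nat \<Rightarrow> real. (\<Sum>i<N. w i) = 1}"
      by (intro closed_Collect_eq continuous_on_sum continuous_on_const) simp
    then show ?thesis unfolding W_def by (intro compact_Int_closed compact_Pi_UNIV) auto
  qed
  have cV: "compact V"
    unfolding V_def by (intro compact_Pi_UNIV polar_compact[OF _ K(4)]) simp
  have cF: "continuous_on UNIV F"
  proof -
    have 1: "continuous_on UNIV (\<lambda>p :: (nat \<Rightarrow> real) \<times> (nat \<Rightarrow> nat \<Rightarrow> real). fst p i)" for i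
      by (rule continuous_on_product_then_coordinatewise[OF continuous_on_fst[OF continuous_on_id]])
    have 2: "continuous_on UNIV (\<lambda>p :: (nat \<Rightarrow> real) \<times> (nat \<Rightarrow> nat \<Rightarrow> real). snd p i j)" for i j
      by (rule continuous_on_product_then_coordinatewise[OF continuous_on_product_then_coordinatewise[OF continuous_on_snd[OF continuous_on_id]]])
    show ?thesis unfolding F_def G_def outer_sum_def
      by (intro continuous_on_sum continuous_on_power continuous_on_diff continuous_on_mult continuous_on_const 1 2)
  qed
  have "0 \<in> polar n K" by (simp add: polar_def dot_def)
  then have "((\<lambda>i. if i = 0 then 1 else 0), (\<lambda>_. 0)) \<in> W \<times> V" using N by (auto simp: W_def V_def)
  then obtain p where p: "p \<in> W \<times> V" "\<And>q. q \<in> W \<times> V \<Longrightarrow> F p \<le> F q"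
    using continuous_attains_inf[OF compact_Times[OF cW cV], of F] continuous_on_subset[OF cF] by blast
  obtain w0 v where pe: "p = (w0, v)" by (cases p)
  have w0: "\<And>i. 0 \<le> w0 i" "(\<Sum>i<N. w0 i) = 1" and v: "\<And>i. v i \<in> polar n K"
    using p(1) by (auto simp: pe W_def V_def)
  obtain w i0 where w: "\<And>i. 0 \<le> w i" "(\<Sum>i<N. w i) = 1" "i0 < N" "w i0 = 0"
    and same: "\<And>j k. j < n \<Longrightarrow> k < n \<Longrightarrow> outer_sum N w v j k = outer_sum N w0 v j k"
    using drop_one_weight[OF w0 N(1), where v = v] by blast
  define g where "g = G w v"
  have Fp: "F p = (\<Sum>j<n. \<Sum>k<n. (g j k)\<^sup>2)"
    unfolding F_def pe g_def G_def by (intro sum.cong refl) (simp add: same)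
  have symg: "g j k = g k j" for j k by (simp add: g_def G_def outer_sum_def mult_ac)
  have "F p = 0"
  proof (rule ccontr)
    assume "F p \<noteq> 0"
    moreover have "F p \<ge> 0" unfolding Fp by (intro sum_nonneg) auto
    ultimately have d: "F p > 0" by simp
    show False
    proof (rule no_strict_separation[OF n K max symg d])
      fix y assume y: "y \<in> polar n K"
      define X where "X j k = y j * y k - (if j = k then 1 / n else 0)" for j k
      have mono: "F p \<le> (\<Sum>j<n. \<Sum>k<n. (g j k + t * (X j k - g j k))\<^sup>2)" if t: "0 < t" "t \<le> 1" for t
      proof -
        \<comment> \<open>The free slot \<open>i0\<close> receives the point \<open>y\<close> with weight \<open>t\<close>; the rest is scaled by \<open>1 - t\<close>.\<close>
        define w' where "w' i = (if i < N then (if i = i0 then t else (1 - t) * w i) else 0)" for i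
        define v' where "v' = v(i0 := y)"
        have split: "(\<Sum>i<N. h i) = h i0 + (\<Sum>i\<in>{..<N}-{i0}. h i)" for h :: "nat \<Rightarrow> real"
          using w(3) by (subst sum.remove[of _ i0]) auto
        have sw: "(\<Sum>i\<in>{..<N}-{i0}. w i) = 1" using split[of w] w(2,4) by simp
        have "(\<Sum>i<N. w' i) = t + (\<Sum>i\<in>{..<N}-{i0}. (1 - t) * w i)"
          unfolding split[of w'] using w(3) by (auto simp: w'_def intro!: sum.cong)
        then have w'1: "(\<Sum>i<N. w' i) = 1" using sw by (simp flip: sum_distrib_left)
        have w'0: "0 \<le> w' i" for i using t w(1) by (auto simp: w'_def)
        have "w' i \<le> 1" for i
        proof (cases "i < N")
          case True
          then show ?thesis unfolding w'1[symmetric] using w'0 by (intro member_le_sum) auto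
        qed (simp add: w'_def)
        then have "(w', v') \<in> W \<times> V" using w'0 w'1 y v by (auto simp: W_def V_def v'_def)
        from p(2)[OF this] have "F p \<le> (\<Sum>j<n. \<Sum>k<n. (G w' v' j k)\<^sup>2)" by (simp add: F_def)
        also have "\<dots> = (\<Sum>j<n. \<Sum>k<n. (g j k + t * (X j k - g j k))\<^sup>2)"
        proof (intro sum.cong refl)
          fix j k
          have "outer_sum N w' v' j k = t * (y j * y k) + (\<Sum>i\<in>{..<N}-{i0}. (1 - t) * (w i * v i j * v i k))"
            unfolding outer_sum_def split[of "\<lambda>i. w' i * v' i j * v' i k"]
            using w(3) by (auto simp: w'_def v'_def mult.assoc intro!: sum.cong)
          also have "(\<Sum>i\<in>{..<N}-{i0}. (1 - t) * (w i * v i j * v i k)) = (1 - t) * outer_sum N w v j k"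
            unfolding outer_sum_def split[of "\<lambda>i. w i * v i j * v i k"] by (simp add: w(4) sum_distrib_left)
          finally have "G w' v' j k = g j k + t * (X j k - g j k)"
            by (simp add: G_def g_def X_def algebra_simps)
          then show "(G w' v' j k)\<^sup>2 = (g j k + t * (X j k - g j k))\<^sup>2" by simp
        qed
        finally show ?thesis .
      qed
      have "0 \<le> (\<Sum>j<n. \<Sum>k<n. g j k * (X j k - g j k))"
      proof (rule nonneg_of_quadratic)
        fix t :: real assume t: "0 < t" "t \<le> 1"
        have "(\<Sum>j<n. \<Sum>k<n. (g j k + t * (X j k - g j k))\<^sup>2)
           = F p + 2 * t * (\<Sum>j<n. \<Sum>k<n. g j k * (X j k - g j k)) + t\<^sup>2 * (\<Sum>j<n. \<Sum>k<n. (X j k - g j k)\<^sup>2)"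
          unfolding Fp sum_distrib_left sum.distrib[symmetric]
          by (intro sum.cong refl) (simp add: power2_eq_square algebra_simps)
        with mono[OF t]
        show "0 \<le> 2 * t * (\<Sum>j<n. \<Sum>k<n. g j k * (X j k - g j k)) + t\<^sup>2 * (\<Sum>j<n. \<Sum>k<n. (X j k - g j k)\<^sup>2)"
          by linarith
      qed
      also have "\<dots> = (\<Sum>j<n. \<Sum>k<n. g j k * (y j * y k)) - (\<Sum>j<n. \<Sum>k<n. if j = k then g j k / n else 0) - F p"
        unfolding Fp X_def sum_subtractf[symmetric]
        by (intro sum.cong refl) (simp add: power2_eq_square algebra_simps)
      also have "(\<Sum>j<n. \<Sum>k<n. if j = k then g j k / n else 0) = (\<Sum>j<n. g j j) / n"
        by (simp add: sum_divide_distrib)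
      finally show "(\<Sum>j<n. g j j) / n + F p \<le> (\<Sum>j<n. \<Sum>k<n. g j k * (y j * y k))" by simp
    qed
  qed
  then have g0: "g j k = 0" if "j < n" "k < n" for j k
  proof -
    have "(\<Sum>j<n. \<Sum>k<n. (g j k)\<^sup>2) = 0" using \<open>F p = 0\<close> Fp by simp
    then have "\<forall>j\<in>{..<n}. (\<Sum>k<n. (g j k)\<^sup>2) = 0"
      by (subst (asm) sum_nonneg_eq_0_iff) (auto intro: sum_nonneg)
    then have "(\<Sum>k<n. (g j k)\<^sup>2) = 0" using that by simp
    then have "\<forall>k\<in>{..<n}. (g j k)\<^sup>2 = 0" by (subst (asm) sum_nonneg_eq_0_iff) auto
    then show ?thesis using that by simp
  qed
  have os: "outer_sum N w v j k = (if j = k then 1 / n else 0)" if "j < n" "k < n" for j k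
    using g0[OF that] by (simp add: g_def G_def)
  define I where "I = {i. i < N \<and> 0 < w i}"
  have I: "I \<subseteq> {..<N}" by (auto simp: I_def)
  have wz: "w i = 0" if "i \<in> {..<N} - I" for i using that w(1)[of i] by (auto simp: I_def)
  have unit_le: "(\<Sum>k<n. (v i k)\<^sup>2) \<le> 1" for i
    using polar_norm_le_1[OF K(4) v[of i]] by (simp add: dot_def power2_eq_square)
  have "(\<Sum>i<N. w i * (1 - (\<Sum>k<n. (v i k)\<^sup>2))) = 0"
  proof -
    have "(\<Sum>i<N. w i * (\<Sum>k<n. (v i k)\<^sup>2)) = (\<Sum>k<n. outer_sum N w v k k)"
      unfolding outer_sum_def sum_distrib_left by (subst sum.swap) (simp add: power2_eq_square mult.assoc)
    also have "\<dots> = 1" using npos by (simp add: os)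
    finally show ?thesis using w(2) by (simp add: right_diff_distrib sum_subtractf)
  qed
  then have "\<forall>i\<in>{..<N}. w i * (1 - (\<Sum>k<n. (v i k)\<^sup>2)) = 0"
    using w(1) unit_le by (subst (asm) sum_nonneg_eq_0_iff) auto
  then have unit: "(\<Sum>k<n. (v i k)\<^sup>2) = 1" if "i \<in> I" for i using that by (force simp: I_def)
  show ?thesis
  proof (rule that[of I "\<lambda>i. n * w i" v])
    show "finite I" using I by (rule finite_subset) simp
    show "0 < n * w i" if "i \<in> I" for i using that npos by (simp add: I_def)
    show "(\<Sum>k<n. (v i k)\<^sup>2) = 1" if "i \<in> I" for i by (rule unit[OF that])
  next
    fix j k assume jk: "j < n" "k < n"
    have "(\<Sum>i\<in>I. n * w i * v i j * v i k) = (\<Sum>i<N. n * w i * v i j * v i k)"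
      using I wz by (intro sum.mono_neutral_left) auto
    also have "\<dots> = n * outer_sum N w v j k" by (simp add: outer_sum_def sum_distrib_left mult_ac)
    finally show "(\<Sum>i\<in>I. n * w i * v i j * v i k) = (if j = k then 1 else 0)"
      using npos by (simp add: os[OF jk])
  next
    fix x i assume x: "x \<in> K"
    have "dot n x (v i) \<le> 1" "dot n (- x) (v i) \<le> 1" using v[of i] x sym[OF x] by (auto simp: polar_def)
    then have "\<bar>dot n x (v i)\<bar> \<le> 1" by (simp add: dot_simps)
    then show "\<bar>\<Sum>k<n. v i k * x k\<bar> \<le> 1" by (simp add: dot_def mult.commute)
  qed
qed

section \<open>Almost orthonormal subfamilies and the distance to the cube\<close>

context weighted_frame
begin

definition row_defect :: "'i \<Rightarrow> real"
  where "row_defect j = (\<Sum>i\<in>I. c i * ((gram j i)\<^sup>2 - (gram j i) ^ 4))"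

lemma row_defect_nonneg: "j \<in> I \<Longrightarrow> 0 \<le> row_defect j"
  unfolding row_defect_def using weight_pos gram_term_nonneg
  by (intro sum_nonneg mult_nonneg_nonneg) (auto intro: less_imp_le)

lemma sum_row_defect: "(\<Sum>j\<in>I. c j * row_defect j) = frame_defect"
  by (simp add: row_defect_def frame_defect_def sum_distrib_left mult.assoc)

text \<open>
  Average over \<open>j\<close> with the weights \<open>c\<^sub>j\<close>. Of the total mass \<open>n\<close>, the \<open>m\<close> chosen vectors use up only
  \<open>m\<close>, so \<open>w j = 1 - \<Sum>\<^sub>a (gram (f a) j)\<^sup>2\<close> has total at least \<open>1\<close>. The constants \<open>A\<close> and \<open>B\<close> are
  such that the two penalties in \<open>T\<close> have totals at most \<open>1/2\<close> and less than \<open>1/2\<close>, so some \<open>T j\<close> is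
  positive. For this \<open>j\<close> the second penalty, being less than \<open>w j \<le> 1\<close>, bounds the row defect; the first one
  gives \<open>A g (1 - g) < 1 - g\<close> for \<open>g = (gram (f a) j)\<^sup>2\<close>, hence \<open>g < 1 / A\<close>.
\<close>

lemma almost_orthonormal_step:
  fixes d :: real and m :: nat
  assumes d: "frame_defect < d" and m: "m < n"
    and f: "\<And>a. a < m \<Longrightarrow> f a \<in> I" "\<And>a. a < m \<Longrightarrow> row_defect (f a) \<le> 2 * d"
  obtains j where "j \<in> I" "row_defect j \<le> 2 * d" "\<And>a. a < m \<Longrightarrow> (gram (f a) j)\<^sup>2 \<le> 4 * n * d"
proof -
  have d0: "d > 0" using frame_defect_nonneg d by linarith
  have n0: "real n > 0" using m by simp
  define A where "A = 1 / (4 * n * d)"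
  define B where "B = 1 / (2 * d)"
  have AB: "A > 0" "B > 0" using d0 n0 by (auto simp: A_def B_def)
  define w where "w j = 1 - (\<Sum>a<m. (gram (f a) j)\<^sup>2)" for j
  define T where "T j = w j - A * (\<Sum>a<m. (gram (f a) j)\<^sup>2 - (gram (f a) j) ^ 4) - B * row_defect j" for j
  have "(\<Sum>j\<in>I. c j * T j) > 0"
  proof -
    have 1: "(\<Sum>j\<in>I. c j * w j) = real n - real m"
    proof -
      have "(\<Sum>j\<in>I. c j * (\<Sum>a<m. (gram (f a) j)\<^sup>2)) = (\<Sum>a<m. \<Sum>j\<in>I. c j * (gram (f a) j)\<^sup>2)"
        unfolding sum_distrib_left by (rule sum.swap)
      also have "\<dots> = real m" using f(1) by (simp add: sum_gram_sq)
      finally show ?thesis by (simp add: w_def right_diff_distrib sum_subtractf sum_weight)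
    qed
    have "(\<Sum>j\<in>I. c j * (\<Sum>a<m. (gram (f a) j)\<^sup>2 - (gram (f a) j) ^ 4)) = (\<Sum>a<m. row_defect (f a))"
      unfolding sum_distrib_left row_defect_def by (rule sum.swap)
    also have "\<dots> \<le> (\<Sum>a<m. 2 * d)" using f(2) by (intro sum_mono) auto
    also have "\<dots> \<le> real n * (2 * d)" using m d0 by simp
    finally have 2: "A * (\<Sum>j\<in>I. c j * (\<Sum>a<m. (gram (f a) j)\<^sup>2 - (gram (f a) j) ^ 4)) \<le> A * (real n * (2 * d))"
      using AB(1) by (intro mult_left_mono) auto
    have 3: "B * (\<Sum>j\<in>I. c j * row_defect j) < B * d" unfolding sum_row_defect using d AB(2) by simp
    have "(\<Sum>j\<in>I. c j * T j) = (\<Sum>j\<in>I. c j * w j) - A * (\<Sum>j\<in>I. c j * (\<Sum>a<m. (gram (f a) j)\<^sup>2 - (gram (f a) j) ^ 4))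
        - B * (\<Sum>j\<in>I. c j * row_defect j)"
    proof -
      have "c j * T j = c j * w j - A * (c j * (\<Sum>a<m. (gram (f a) j)\<^sup>2 - (gram (f a) j) ^ 4)) - B * (c j * row_defect j)" for j
        by (simp add: T_def right_diff_distrib mult.left_commute)
      then show ?thesis by (simp add: sum_subtractf sum_distrib_left)
    qed
    moreover have "A * (real n * (2 * d)) = 1 / 2" "B * d = 1 / 2" using d0 n0 by (auto simp: A_def B_def)
    moreover have "real n - real m \<ge> 1" using m by linarith
    ultimately show ?thesis using 1 2 3 by linarith
  qed
  then obtain j where j: "j \<in> I" "T j > 0"
    using weight_pos by (metis (no_types, lifting) linorder_not_less mult_nonneg_nonpos less_imp_le sum_nonpos)
  have s0: "0 \<le> (\<Sum>a<m. (gram (f a) j)\<^sup>2 - (gram (f a) j) ^ 4)"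
    using f j by (intro sum_nonneg gram_term_nonneg) auto
  have w: "w j > A * (\<Sum>a<m. (gram (f a) j)\<^sup>2 - (gram (f a) j) ^ 4) + B * row_defect j"
    using j(2) by (simp add: T_def)
  have wa: "w j \<le> 1 - (gram (f a) j)\<^sup>2" if "a < m" for a
    unfolding w_def using that by (intro diff_left_mono member_le_sum) auto
  have w1: "w j \<le> 1" unfolding w_def by (simp add: sum_nonneg)
  show ?thesis
  proof
    show "j \<in> I" by fact
    have "0 \<le> A * (\<Sum>a<m. (gram (f a) j)\<^sup>2 - (gram (f a) j) ^ 4)" using s0 AB by simp
    then have "B * row_defect j \<le> 1" using w w1 by linarith
    then show "row_defect j \<le> 2 * d" using d0 by (simp add: B_def pos_divide_le_eq)
    fix a assume a: "a < m"
    define g where "g = (gram (f a) j)\<^sup>2"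
    have g4: "(gram (f a) j) ^ 4 = g * g" by (simp add: g_def flip: power_add)
    have "g - g * g \<le> (\<Sum>a<m. (gram (f a) j)\<^sup>2 - (gram (f a) j) ^ 4)"
      unfolding g4[symmetric] unfolding g_def using a f j by (intro member_le_sum gram_term_nonneg) auto
    then have "A * (g - g * g) \<le> A * (\<Sum>a<m. (gram (f a) j)\<^sup>2 - (gram (f a) j) ^ 4)"
      using AB by (intro mult_left_mono) auto
    moreover have "0 \<le> B * row_defect j" using AB row_defect_nonneg[OF j(1)] by simp
    ultimately have "A * (g - g * g) < 1 - g" using w wa[OF a] by (simp add: g_def)
    then have "(A * g) * (1 - g) < 1 * (1 - g)" by (simp add: algebra_simps)
    moreover have "0 < 1 - g"
    proof -
      have "0 \<le> A * (\<Sum>a<m. (gram (f a) j)\<^sup>2 - (gram (f a) j) ^ 4)" using s0 AB by simp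
      then show ?thesis using w wa[OF a] \<open>0 \<le> B * row_defect j\<close> by (simp add: g_def)
    qed
    ultimately have "A * g < 1" using mult_less_cancel_right_pos by blast
    then have "g \<le> 4 * n * d" using d0 n0 by (simp add: A_def pos_divide_less_eq)
    then show "(gram (f a) j)\<^sup>2 \<le> 4 * n * d" by (simp add: g_def)
  qed
qed

text \<open>
  The vectors are chosen one at a time; the bound on the row defects is what keeps the selection going.
\<close>

theorem almost_orthonormal_subfamily:
  fixes d :: real
  assumes d: "frame_defect < d"
  obtains f where "\<And>a. a < n \<Longrightarrow> f a \<in> I" "\<And>a b. a < n \<Longrightarrow> b < n \<Longrightarrow> a \<noteq> b \<Longrightarrow> (gram (f a) (f b))\<^sup>2 \<le> 4 * n * d"
proof -
  have "\<exists>f. (\<forall>a<m. f a \<in> I \<and> row_defect (f a) \<le> 2 * d) \<and> (\<forall>a<m. \<forall>b<m. a \<noteq> b \<longrightarrow> (gram (f a) (f b))\<^sup>2 \<le> 4 * n * d)"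
    if "m \<le> n" for m
    using that
  proof (induction m)
    case 0
    show ?case by simp
  next
    case (Suc m)
    then obtain f where f: "\<forall>a<m. f a \<in> I \<and> row_defect (f a) \<le> 2 * d"
      "\<forall>a<m. \<forall>b<m. a \<noteq> b \<longrightarrow> (gram (f a) (f b))\<^sup>2 \<le> 4 * n * d" by auto
    obtain j where j: "j \<in> I" "row_defect j \<le> 2 * d" "\<And>a. a < m \<Longrightarrow> (gram (f a) j)\<^sup>2 \<le> 4 * n * d"
      using almost_orthonormal_step[OF d, of m f] Suc.prems f(1) by auto
    then show ?case using f
      by (intro exI[of _ "f(m := j)"]) (auto simp: less_Suc_eq gram_sym[of j])
  qed
  from this[of n] show ?thesis using that by auto
qed

end

text \<open>
  In the Leibniz formula every permutation other than the identity uses at least two off-diagonal entries,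
  each of modulus at most \<open>sqrt h\<close>, and all entries have modulus at most \<open>1\<close>.
\<close>

lemma det_near_identity:
  fixes G :: "real mat"
  assumes G: "G \<in> carrier_mat n n" and diag: "\<And>i. i < n \<Longrightarrow> G $$ (i,i) = 1"
    and off: "\<And>i j. i < n \<Longrightarrow> j < n \<Longrightarrow> i \<noteq> j \<Longrightarrow> (G $$ (i,j))\<^sup>2 \<le> h" and h: "0 \<le> h" "h \<le> 1"
  shows "Determinant.det G \<ge> 1 - fact n * h"
proof -
  let ?P = "{p. p permutes {0..<n}}"
  have absle: "\<bar>G $$ (i,j)\<bar> \<le> sqrt h" if "i < n" "j < n" "i \<noteq> j" for i j
    using off[OF that] by (metis real_sqrt_abs real_sqrt_le_mono)
  have abs1: "\<bar>G $$ (i,j)\<bar> \<le> 1" if "i < n" "j < n" for i j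
    using absle[OF that] diag that h by (cases "i = j") (auto intro: order_trans)
  have fin: "finite ?P" by (simp add: finite_permutations)
  have idP: "id \<in> ?P" by (simp add: permutes_id)
  have tm: "\<bar>signof p * (\<Prod>i = 0..<n. G $$ (i, p i))\<bar> \<le> h" if p: "p permutes {0..<n}" "p \<noteq> id" for p
  proof -
    have pn: "p i < n" if "i < n" for i using p(1) that by (metis atLeastLessThan_iff permutes_in_image zero_le)
    obtain m where m: "p m \<noteq> m" using p(2) by (auto simp: fun_eq_iff)
    then have mn: "m < n" using p(1) by (metis atLeastLessThan_iff permutes_not_in zero_le)
    have ppm: "p (p m) \<noteq> p m" using m permutes_inj[OF p(1)] by (meson injD)
    have "\<bar>signof p * (\<Prod>i = 0..<n. G $$ (i, p i))\<bar> = (\<Prod>i = 0..<n. \<bar>G $$ (i, p i)\<bar>)"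
      by (simp add: abs_mult abs_prod sign_def)
    also have "\<dots> = \<bar>G $$ (m, p m)\<bar> * (\<bar>G $$ (p m, p (p m))\<bar> * (\<Prod>i\<in>{0..<n} - {m} - {p m}. \<bar>G $$ (i, p i)\<bar>))"
      using m mn pn by (subst prod.remove[of _ m], simp, simp, subst prod.remove[of _ "p m"]) auto
    also have "\<dots> \<le> sqrt h * (sqrt h * 1)"
      using m mn pn ppm h
      by (intro mult_mono absle prod_le_1 mult_nonneg_nonneg prod_nonneg) (auto intro!: abs1)
    finally show ?thesis using h by simp
  qed
  have "Determinant.det G = (\<Sum>p\<in>?P. signof p * (\<Prod>i = 0..<n. G $$ (i, p i)))" by (rule det_def'[OF G])
  also have "\<dots> = 1 + (\<Sum>p\<in>?P - {id}. signof p * (\<Prod>i = 0..<n. G $$ (i, p i)))"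
    using fin idP diag by (subst sum.remove[of _ id]) auto
  also have "\<dots> \<ge> 1 - (\<Sum>p\<in>?P - {id}. h)"
  proof -
    have "\<bar>\<Sum>p\<in>?P - {id}. signof p * (\<Prod>i = 0..<n. G $$ (i, p i))\<bar> \<le> (\<Sum>p\<in>?P - {id}. h)"
      by (rule order_trans[OF sum_abs]) (intro sum_mono tm, auto)
    then show ?thesis by linarith
  qed
  finally have "Determinant.det G \<ge> 1 - (\<Sum>p\<in>?P - {id}. h)" .
  moreover have "(\<Sum>p\<in>?P - {id}. h) \<le> (\<Sum>p\<in>?P. h)" using fin h by (intro sum_mono2) auto
  moreover have "(\<Sum>p\<in>?P. h) = fact n * h" by (simp add: card_permutations)
  ultimately show ?thesis by linarith
qed

lemma scale_box_E: "s > 0 \<Longrightarrow> (\<lambda>x. s *\<^sub>R x) ` box_E n b = box_E n (\<lambda>i. s * b i)"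
proof (intro Set.set_eqI iffI)
  fix x assume s: "s > 0" and x: "x \<in> box_E n (\<lambda>i. s * b i)"
  have "(1 / s) *\<^sub>R x \<in> box_E n b"
    using s x by (auto simp: box_E_def abs_mult abs_divide pos_divide_le_eq mult.commute)
  moreover have "x = s *\<^sub>R ((1 / s) *\<^sub>R x)" using s by (simp add: fun_eq_iff)
  ultimately show "x \<in> (\<lambda>x. s *\<^sub>R x) ` box_E n b" by blast
next
  fix x assume "s > 0" "x \<in> (\<lambda>x. s *\<^sub>R x) ` box_E n b"
  then show "x \<in> box_E n (\<lambda>i. s * b i)" by (auto simp: box_E_def abs_mult)
qed

text \<open>
  Normalise \<open>U\<close> to determinant one. The normalised images of \<open>K\<close> and of the cube both have volume
  \<open>1\<close> and both lie in the same cube \<open>T\<close> of volume \<open>2\<^sup>n / (det U \<cdot> V(K))\<close>, so each of them misses a part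
  of \<open>T\<close> of volume \<open>V(T) - 1\<close>.
\<close>

lemma delta_vol_cube_le_pos:
  assumes n: "n > 0" and K: "compact K" "K \<subseteq> Espace n" "vol n K > 0"
    and U: "U \<in> carrier_mat n n" "Determinant.det U > 0"
    and sub: "\<And>x i. x \<in> K \<Longrightarrow> i < n \<Longrightarrow> \<bar>apply_mat U x i\<bar> \<le> 1"
  shows "delta_vol n K (cube n) \<le> 2 * (2 ^ n / (Determinant.det U * vol n K) - 1)"
proof -
  define \<alpha> where "\<alpha> = vol n K powr (- 1 / real n)"
  define \<beta> where "\<beta> = vol n (cube n) powr (- 1 / real n)"
  define \<tau> where "\<tau> = Determinant.det U powr (- 1 / real n)"
  have rootpow: "(a powr (- 1 / real n)) ^ n = 1 / a" if "a > 0" for a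
  proof -
    have "(a powr (- 1 / real n)) ^ n = (a powr (- 1 / real n)) powr real n" using that by (simp add: powr_realpow)
    also have "\<dots> = a powr (- 1)" unfolding powr_powr using n by simp
    also have "\<dots> = 1 / a" using that by (simp add: powr_minus_divide)
    finally show ?thesis .
  qed
  have \<alpha>: "\<alpha> > 0" "\<alpha> ^ n = 1 / vol n K" using K rootpow[of "vol n K"] by (auto simp: \<alpha>_def)
  have \<tau>: "\<tau> > 0" "\<tau> ^ n = 1 / Determinant.det U" using U rootpow[of "Determinant.det U"] by (auto simp: \<tau>_def)
  have \<beta>: "\<beta> > 0" "\<beta> ^ n = 1 / 2 ^ n" using rootpow[of "2 ^ n"] by (auto simp: \<beta>_def vol_cube)
  define \<Phi> where "\<Phi> = \<tau> \<cdot>\<^sub>m U"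
  have \<Phi>c: "\<Phi> \<in> carrier_mat n n" using U by (simp add: \<Phi>_def)
  have det\<Phi>: "Determinant.det \<Phi> = 1" using U \<tau> by (simp add: \<Phi>_def)
  have \<Phi>: "\<Phi> \<in> SL n" using \<Phi>c det\<Phi> by (simp add: SL_def)
  define A where "A = apply_mat \<Phi> ` ((\<lambda>x. \<alpha> *\<^sub>R x) ` K)"
  define W where "W = (\<lambda>x. \<beta> *\<^sub>R x) ` cube n"
  have Kb: "K \<in> sets borel" using K by (intro compact_imp_borel)
  have K\<alpha>: "(\<lambda>x. \<alpha> *\<^sub>R x) ` K \<in> sets borel" "(\<lambda>x. \<alpha> *\<^sub>R x) ` K \<subseteq> Espace n"
    using K \<alpha> Kb by (auto intro!: borel_scale_image)
  have Ab: "A \<in> sets borel"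
    unfolding A_def using det\<Phi> by (intro borel_apply_mat_image[OF \<Phi>c _ K\<alpha>]) simp
  have volA: "vol n A = 1"
    unfolding A_def using det\<Phi> K \<alpha> Kb by (subst vol_apply_mat_image[OF \<Phi>c _ K\<alpha>]) (auto simp: vol_scale_image)
  have Weq: "W = box_E n (\<lambda>_. \<beta>)" unfolding W_def cube_eq_box_E by (simp add: scale_box_E \<beta>)
  have volW: "vol n W = 1" unfolding Weq using \<beta> by (simp add: vol_box_E power_mult_distrib)
  define t where "t = \<tau> * \<alpha>"
  have t: "t > 0" "t ^ n = 1 / (Determinant.det U * vol n K)" using \<alpha> \<tau> by (auto simp: t_def power_mult_distrib)
  define T where "T = box_E n (\<lambda>_. t)"
  have Tc: "compact T" "T \<subseteq> Espace n" unfolding T_def by (rule compact_box_E) (auto simp: box_E_def)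
  have volT: "vol n T = 2 ^ n / (Determinant.det U * vol n K)"
    unfolding T_def using t by (simp add: vol_box_E power_mult_distrib)
  have AT: "A \<subseteq> T"
  proof
    fix y assume "y \<in> A"
    then obtain x where x: "x \<in> K" "y = apply_mat \<Phi> (\<alpha> *\<^sub>R x)" by (auto simp: A_def)
    have "y i = t * apply_mat U x i" if "i < n" for i
      using that U unfolding x(2) by (simp add: apply_mat_def \<Phi>_def t_def sum_distrib_left mult_ac)
    then have "\<bar>y i\<bar> \<le> t" if "i < n" for i
      using that sub[OF x(1) that] t(1) by (simp add: abs_mult mult_left_le)
    moreover have "y \<in> Espace n" unfolding x(2) by (rule apply_mat_in_Espace[OF \<Phi>c])
    ultimately show "y \<in> T" by (simp add: T_def box_E_def)
  qed
  have AvT: "1 \<le> vol n T" using vol_mono[OF AT Ab Tc] volA by simp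
  have "\<beta> \<le> t"
  proof (rule ccontr)
    assume "\<not> \<beta> \<le> t"
    then have "t ^ n < \<beta> ^ n" using t(1) n by (intro power_strict_mono) auto
    then show False using AvT volT t(2) \<beta>(2) by (simp add: field_simps)
  qed
  then have WT: "W \<subseteq> T" unfolding Weq T_def by (auto simp: box_E_def)
  have Wb: "W \<in> sets borel" unfolding Weq by (intro compact_imp_borel compact_box_E)
  have Tb: "T \<in> sets borel" using Tc by (intro compact_imp_borel)
  have fT: "emeasure (lebesgue_E n) T \<noteq> \<infinity>" using emeasure_compact_finite[OF Tc] by simp
  have "vol n (sym_diff A W) \<le> measure (lebesgue_E n) ((T - W) \<union> (T - A))"
    unfolding vol_def
  proof (rule measure_mono_fmeasurable)
    have "T \<in> fmeasurable (lebesgue_E n)" using fT Tb by (intro fmeasurableI) (simp_all add: top.not_eq_extremum)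
    moreover have "(T - W) \<union> (T - A) \<subseteq> T" by blast
    moreover have "(T - W) \<union> (T - A) \<in> sets (lebesgue_E n)" using Tb Wb Ab by simp
    ultimately show "(T - W) \<union> (T - A) \<in> fmeasurable (lebesgue_E n)" by (rule fmeasurableI2)
    show "sym_diff A W \<subseteq> (T - W) \<union> (T - A)" using AT WT by blast
    show "sym_diff A W \<in> sets (lebesgue_E n)" using Ab Wb by simp
  qed
  also have "\<dots> \<le> measure (lebesgue_E n) (T - W) + measure (lebesgue_E n) (T - A)"
    using Tb Wb Ab by (intro measure_Un_le) auto
  also have "measure (lebesgue_E n) (T - W) = vol n T - 1"
    using measure_Diff[OF fT, of W] Tb Wb WT volW by (simp add: vol_def)
  also have "measure (lebesgue_E n) (T - A) = vol n T - 1"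
    using measure_Diff[OF fT, of A] Tb Ab AT volA by (simp add: vol_def)
  finally have le: "vol n (sym_diff A W) \<le> 2 * (2 ^ n / (Determinant.det U * vol n K) - 1)"
    by (simp add: volT)
  have "delta_vol n K (cube n) \<le> vol n (sym_diff A W)"
    unfolding delta_vol_def Let_def A_def W_def \<alpha>_def \<beta>_def
    by (rule cINF_lower[OF _ \<Phi>]) (auto intro!: bdd_belowI[of _ 0] simp: vol_def)
  with le show ?thesis by linarith
qed

text \<open>
  Reflecting the first coordinate preserves the cube and changes the sign of the determinant.
\<close>

lemma delta_vol_cube_le:
  assumes n: "n > 0" and K: "compact K" "K \<subseteq> Espace n" "vol n K > 0"
    and U: "U \<in> carrier_mat n n" "Determinant.det U \<noteq> 0"
    and sub: "\<And>x i. x \<in> K \<Longrightarrow> i < n \<Longrightarrow> \<bar>apply_mat U x i\<bar> \<le> 1"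
  shows "delta_vol n K (cube n) \<le> 2 * (2 ^ n / (\<bar>Determinant.det U\<bar> * vol n K) - 1)"
proof (cases "Determinant.det U > 0")
  case True
  then show ?thesis using delta_vol_cube_le_pos[OF n K U(1) True sub] by simp
next
  case False
  \<comment> \<open>\<open>S\<close> is the reflection of the first coordinate.\<close>
  define S where "S = row_mat n 0 (\<lambda>j. if j = 0 then -1 else 0)"
  have S: "S \<in> carrier_mat n n" by (simp add: S_def)
  have det: "Determinant.det (S * U) = - Determinant.det U"
    unfolding det_mult[OF S U(1)] using n by (simp add: S_def det_row_mat)
  have "\<bar>apply_mat (S * U) x i\<bar> \<le> 1" if "x \<in> K" "i < n" for x i
  proof -
    have "apply_mat (S * U) x = (apply_mat U x)(0 := \<Sum>j<n. (if j = 0 then -1 else 0) * apply_mat U x j)"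
      unfolding apply_mat_mult[OF S U(1)] unfolding S_def by (rule apply_row_mat[OF apply_mat_in_Espace[OF U(1)] n])
    also have "(\<Sum>j<n. (if j = 0 then -1 else 0) * apply_mat U x j) = - apply_mat U x 0"
      using n by (simp add: mult_delta_left)
    finally show ?thesis using sub[OF that] by (cases "i = 0") auto
  qed
  then have "delta_vol n K (cube n) \<le> 2 * (2 ^ n / (Determinant.det (S * U) * vol n K) - 1)"
    using False U S by (intro delta_vol_cube_le_pos n K) (auto simp: det)
  then show ?thesis using False by (simp add: det)
qed

section \<open>Parallel bodies and surface area\<close>

definition outer_body :: "nat \<Rightarrow> (nat \<Rightarrow> real) set \<Rightarrow> real \<Rightarrow> (nat \<Rightarrow> real) set"
  where "outer_body n K t = {x + y | x y. x \<in> K \<and> y \<in> Eball n 0 t}"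

lemma outer_body_mono: "0 \<le> s \<Longrightarrow> s \<le> t \<Longrightarrow> outer_body n K s \<subseteq> outer_body n K t"
proof -
  assume "0 \<le> s" "s \<le> t"
  then have "Eball n 0 s \<subseteq> Eball n 0 t" by (auto simp: Eball_0_eq intro: order_trans power_mono)
  then show ?thesis unfolding outer_body_def by blast
qed

lemma Eball_0_0: "Eball n 0 0 = {0}"
proof -
  have "x = 0" if "x \<in> Espace n" "dot n x x \<le> 0" for x
    using that dot_self_nonneg[of n x] by (intro dot_self_eq_0) auto
  then show ?thesis by (auto simp: Eball_0_eq dot_def)
qed

lemma outer_body_0: "outer_body n K 0 = K"
  by (simp add: outer_body_def Eball_0_0)

lemma outer_body_Espace: "K \<subseteq> Espace n \<Longrightarrow> t \<ge> 0 \<Longrightarrow> outer_body n K t \<subseteq> Espace n"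
  by (auto simp: outer_body_def Eball_0_eq)

lemma compact_outer_body:
  assumes "compact K" "t \<ge> 0" shows "compact (outer_body n K t)"
proof -
  have "outer_body n K t = (\<lambda>p. fst p + snd p) ` (K \<times> Eball n 0 t)"
  proof (intro Set.set_eqI iffI)
    fix z assume "z \<in> outer_body n K t"
    then obtain x y where "z = x + y" "x \<in> K" "y \<in> Eball n 0 t" by (auto simp: outer_body_def)
    then show "z \<in> (\<lambda>p. fst p + snd p) ` (K \<times> Eball n 0 t)"
      by (intro image_eqI[of _ _ "(x, y)"]) auto
  next
    fix z assume "z \<in> (\<lambda>p. fst p + snd p) ` (K \<times> Eball n 0 t)"
    then obtain p where "p \<in> K \<times> Eball n 0 t" "z = fst p + snd p" by blast
    then show "z \<in> outer_body n K t" unfolding outer_body_def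
      by (intro CollectI exI[of _ "fst p"] exI[of _ "snd p"]) auto
  qed
  moreover have "continuous_on (K \<times> Eball n 0 t) (\<lambda>p. fst p + snd p)"
  proof (rule continuous_on_coordinatewise_then_product)
    fix i
    have "continuous_on (K \<times> Eball n 0 t) (\<lambda>p. fst p i + snd p i)"
      by (rule continuous_on_add[OF continuous_on_product_then_coordinatewise[OF continuous_on_fst[OF continuous_on_id]]
            continuous_on_product_then_coordinatewise[OF continuous_on_snd[OF continuous_on_id]]])
    then show "continuous_on (K \<times> Eball n 0 t) (\<lambda>p. (fst p + snd p) i)" by simp
  qed
  ultimately show ?thesis
    using assms by (simp add: compact_continuous_image compact_Times compact_Eball_0)
qed

lemma Eball_convex_comb:
  assumes "x \<in> Eball n 0 s" "y \<in> Eball n 0 t" "s \<ge> 0" "t \<ge> 0" "a \<ge> 0" "b \<ge> 0"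
  shows "a *\<^sub>R x + b *\<^sub>R y \<in> Eball n 0 (a * s + b * t)"
proof -
  have d: "dot n x x \<le> s\<^sup>2" "dot n y y \<le> t\<^sup>2" using assms by (auto simp: Eball_0_eq)
  have xy: "dot n x y \<le> s * t"
  proof -
    have "(dot n x y)\<^sup>2 \<le> dot n x x * dot n y y" by (rule dot_Cauchy_Schwarz)
    also have "\<dots> \<le> s\<^sup>2 * t\<^sup>2" by (rule mult_mono[OF d _ dot_self_nonneg]) simp
    finally have "(dot n x y)\<^sup>2 \<le> (s * t)\<^sup>2" by (simp add: power_mult_distrib)
    then show ?thesis by (rule power2_le_imp_le) (simp add: assms)
  qed
  have "a\<^sup>2 * dot n x x + 2 * (a * b) * dot n x y + b\<^sup>2 * dot n y y \<le> a\<^sup>2 * s\<^sup>2 + 2 * (a * b) * (s * t) + b\<^sup>2 * t\<^sup>2"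
    using assms d xy by (intro add_mono mult_left_mono) auto
  also have "\<dots> = (a * s + b * t)\<^sup>2" by (simp add: power2_eq_square algebra_simps)
  also have "a\<^sup>2 * dot n x x + 2 * (a * b) * dot n x y + b\<^sup>2 * dot n y y = dot n (a *\<^sub>R x + b *\<^sub>R y) (a *\<^sub>R x + b *\<^sub>R y)"
    using dot_commute[of n x y] by (simp add: dot_simps power2_eq_square algebra_simps)
  finally show ?thesis using assms by (auto simp: Eball_0_eq)
qed

lemma outer_body_convex_comb:
  assumes K: "convex K" and x: "x \<in> outer_body n K s" and y: "y \<in> outer_body n K t"
    and st: "s \<ge> 0" "t \<ge> 0" and ab: "a \<ge> 0" "b \<ge> 0" "a + b = 1"
  shows "a *\<^sub>R x + b *\<^sub>R y \<in> outer_body n K (a * s + b * t)"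
proof -
  obtain x1 x2 where x12: "x = x1 + x2" "x1 \<in> K" "x2 \<in> Eball n 0 s" using x by (auto simp: outer_body_def)
  obtain y1 y2 where y12: "y = y1 + y2" "y1 \<in> K" "y2 \<in> Eball n 0 t" using y by (auto simp: outer_body_def)
  have "a *\<^sub>R x + b *\<^sub>R y = (a *\<^sub>R x1 + b *\<^sub>R y1) + (a *\<^sub>R x2 + b *\<^sub>R y2)"
    by (simp add: x12 y12 scaleR_add_right)
  moreover have "a *\<^sub>R x1 + b *\<^sub>R y1 \<in> K" using K x12 y12 ab by (simp add: convexD)
  moreover have "a *\<^sub>R x2 + b *\<^sub>R y2 \<in> Eball n 0 (a * s + b * t)" using x12 y12 st ab by (intro Eball_convex_comb)
  ultimately show ?thesis unfolding outer_body_def by blast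
qed

text \<open>
  A vector of length at most \<open>t\<close> is \<open>t/r\<close> times a vector of \<open>rB \<subseteq> K\<close>, and \<open>K + (t/r) K = (1 + t/r) K\<close>
  by convexity.
\<close>

lemma outer_body_subset_scale:
  assumes K: "convex K" "0 < r" "Eball n 0 r \<subseteq> K" and t: "0 \<le> t"
  shows "outer_body n K t \<subseteq> (\<lambda>x. (1 + t / r) *\<^sub>R x) ` K"
proof
  fix z assume "z \<in> outer_body n K t"
  then obtain x y where xy: "z = x + y" "x \<in> K" "y \<in> Eball n 0 t" by (auto simp: outer_body_def)
  show "z \<in> (\<lambda>x. (1 + t / r) *\<^sub>R x) ` K"
  proof (cases "t = 0")
    case True
    then show ?thesis using xy by (auto simp: Eball_0_0)
  next
    case False
    with t have t0: "t > 0" by simp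
    have "(r / t) *\<^sub>R y \<in> Eball n 0 r"
    proof -
      have "dot n y y \<le> t\<^sup>2" "y \<in> Espace n" using xy(3) t by (auto simp: Eball_0_eq)
      then have "(r / t)\<^sup>2 * dot n y y \<le> (r / t)\<^sup>2 * t\<^sup>2" by (intro mult_left_mono) auto
      also have "\<dots> = r\<^sup>2" using t0 by (simp add: power_divide)
      finally show ?thesis using \<open>y \<in> Espace n\<close> K(2) by (auto simp: Eball_0_eq dot_simps power2_eq_square mult_ac)
    qed
    then have yK: "(r / t) *\<^sub>R y \<in> K" using K by auto
    define q where "q = 1 + t / r"
    have q: "q > 0" using t0 K(2) by (simp add: q_def add_pos_pos)
    have s1: "1 / q + (t / r) / q = 1" using q by (simp only: add_divide_distrib[symmetric] q_def[symmetric]) simp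
    have "(1 / q) *\<^sub>R x + ((t / r) / q) *\<^sub>R ((r / t) *\<^sub>R y) \<in> K"
      using K(1) xy(2) yK q t0 K(2) s1 by (intro convexD) auto
    moreover have "z = q *\<^sub>R ((1 / q) *\<^sub>R x + ((t / r) / q) *\<^sub>R ((r / t) *\<^sub>R y))"
      using q t0 K(2) by (simp add: xy(1) scaleR_add_right)
    ultimately show ?thesis by (auto simp: q_def)
  qed
qed

lemma nn_integral_weight:
  fixes p :: real assumes "0 < p"
  shows "(\<integral>\<^sup>+s. ennreal (2 * (1 - s)) * indicator {0<..1} s * indicator {p..} s \<partial>lborel) = ennreal ((max 0 (1 - p))\<^sup>2)"
proof (cases "p \<le> 1")
  case True
  have "(\<integral>\<^sup>+s. ennreal (2 * (1 - s)) * indicator {0<..1} s * indicator {p..} s \<partial>lborel)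
      = (\<integral>\<^sup>+s. ennreal (2 * (1 - s)) * indicator {p..1} s \<partial>lborel)"
    using assms by (intro nn_integral_cong) (auto simp: indicator_def)
  also have "\<dots> = (\<lambda>s. - (1 - s)\<^sup>2) 1 - (\<lambda>s. - (1 - s)\<^sup>2) p"
    using True by (intro nn_integral_FTC_Icc) (auto intro!: derivative_eq_intros)
  finally show ?thesis using True by (simp add: max_def)
next
  case False
  then have "(\<integral>\<^sup>+s. ennreal (2 * (1 - s)) * indicator {0<..1} s * indicator {p..} s \<partial>lborel) = (\<integral>\<^sup>+s. 0 \<partial>(lborel :: real measure))"
    by (intro nn_integral_cong) (auto simp: indicator_def)
  with False show ?thesis by (simp add: max_def)
qed

text \<open>
  The value of the integral of \<open>2 (1 - s) s\<^sup>n\<close> over \<open>[0, 1]\<close>.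
\<close>

definition layer_const :: "nat \<Rightarrow> real"
  where "layer_const n = 2 / ((n + 1) * (n + 2))"

lemma nn_integral_weight_power:
  "(\<integral>\<^sup>+s. ennreal (2 * (1 - s)) * indicator {0<..1} s * ennreal (s ^ n) \<partial>lborel) = ennreal (layer_const n)"
proof -
  have "(\<integral>\<^sup>+s. ennreal (2 * (1 - s)) * indicator {0<..1} s * ennreal (s ^ n) \<partial>lborel)
      = (\<integral>\<^sup>+s. ennreal (2 * (1 - s) * s ^ n) * indicator {0..1} s \<partial>lborel)"
  proof (rule nn_integral_cong_AE)
    have "AE s in lborel. s \<noteq> (0::real)" by (rule AE_lborel_singleton)
    then show "AE s in lborel. ennreal (2 * (1 - s)) * indicator {0<..1} s * ennreal (s ^ n) = ennreal (2 * (1 - s) * s ^ n) * indicator {0..1} s"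
      by eventually_elim (auto simp: indicator_def ennreal_mult)
  qed
  also have "\<dots> = ennreal ((\<lambda>s. 2 * (s ^ Suc n / (n + 1) - s ^ Suc (Suc n) / (n + 2))) 1 - (\<lambda>s. 2 * (s ^ Suc n / (n + 1) - s ^ Suc (Suc n) / (n + 2))) 0)"
  proof -
    have 1: "((\<lambda>s. s ^ Suc n / (n + 1)) has_real_derivative s ^ n) (at s)" for s :: real
      by (rule DERIV_cong[OF DERIV_cdivide[OF DERIV_pow]]) simp
    have 2: "((\<lambda>s. s ^ Suc (Suc n) / (n + 2)) has_real_derivative s ^ Suc n) (at s)" for s :: real
      by (rule DERIV_cong[OF DERIV_cdivide[OF DERIV_pow]]) (simp add: add.commute)
    have d: "((\<lambda>s. 2 * (s ^ Suc n / (n + 1) - s ^ Suc (Suc n) / (n + 2))) has_real_derivative 2 * (1 - s) * s ^ n) (at s)" for s :: real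
      by (rule DERIV_cong[OF DERIV_cmult[OF DERIV_diff[OF 1 2]]]) (simp add: algebra_simps)
    show ?thesis
      by (rule nn_integral_FTC_Icc[OF _ d]) auto
  qed
  also have "(\<lambda>s. 2 * (s ^ Suc n / (n + 1) - s ^ Suc (Suc n) / (n + 2))) 1 - (\<lambda>s. 2 * (s ^ Suc n / (n + 1) - s ^ Suc (Suc n) / (n + 2))) 0 = layer_const n"
    by (simp add: layer_const_def field_simps)
  finally show ?thesis .
qed

text \<open>
  The radial function of \<open>L\<close> in the direction \<open>x\<close>.
\<close>

definition ray :: "(nat \<Rightarrow> real) set \<Rightarrow> (nat \<Rightarrow> real) \<Rightarrow> real"
  where "ray L x = Sup {R. 0 \<le> R \<and> R *\<^sub>R x \<in> L}"

lemma ray_iff: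
  assumes L: "compact L" "convex L" and r: "r > 0" "Eball n 0 r \<subseteq> L" and x: "x \<in> Espace n" "x \<noteq> 0"
  shows "0 < ray L x" "0 \<le> R \<Longrightarrow> R *\<^sub>R x \<in> L \<longleftrightarrow> R \<le> ray L x"
proof -
  let ?A = "{R. 0 \<le> R \<and> R *\<^sub>R x \<in> L}"
  obtain i where i: "i < n" "x i \<noteq> 0" using x by (auto simp: fun_eq_iff) (metis linorder_not_less)
  obtain B where B: "B > 0" "\<And>y i. y \<in> L \<Longrightarrow> i < n \<Longrightarrow> \<bar>y i\<bar> \<le> B" using compact_bounded_coords[OF L(1)] by blast
  have bdd: "bdd_above ?A"
  proof (rule bdd_aboveI[of _ "B / \<bar>x i\<bar>"])
    fix R assume "R \<in> ?A"
    then have "0 \<le> R" "\<bar>(R *\<^sub>R x) i\<bar> \<le> B" using B(2)[of "R *\<^sub>R x" i] i(1) by auto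
    then show "R \<le> B / \<bar>x i\<bar>" using i by (simp add: abs_mult pos_le_divide_eq)
  qed
  have p: "dot n x x > 0" using dot_self_eq_0[OF x(1)] x(2) dot_self_nonneg[of n x] by (force simp: less_le)
  have R0: "r / sqrt (dot n x x) \<in> ?A"
  proof -
    have "(r / sqrt (dot n x x)) *\<^sub>R x \<in> Eball n 0 r" using p r x by (auto simp: Eball_0_eq dot_simps power2_eq_square)
    then show ?thesis using r p by auto
  qed
  have cl: "closed ?A"
  proof -
    have "continuous_on UNIV (\<lambda>R. R *\<^sub>R x)"
    proof (rule continuous_on_coordinatewise_then_product)
      fix i
      have "continuous_on UNIV (\<lambda>R. R * x i)" by (intro continuous_intros)
      then show "continuous_on UNIV (\<lambda>R. (R *\<^sub>R x) i)" by simp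
    qed
    then have "closed ((\<lambda>R. R *\<^sub>R x) -` L)"
      using compact_imp_closed[OF L(1)] by (simp add: continuous_on_closed_vimage)
    then have "closed ({0..} \<inter> ((\<lambda>R. R *\<^sub>R x) -` L))" by (intro closed_Int) auto
    moreover have "?A = {0..} \<inter> ((\<lambda>R. R *\<^sub>R x) -` L)" by auto
    ultimately show ?thesis by simp
  qed
  have mem: "ray L x \<in> ?A" unfolding ray_def using R0 by (intro closed_contains_Sup bdd cl) auto
  have "r / sqrt (dot n x x) \<le> ray L x" unfolding ray_def using R0 bdd by (intro cSup_upper)
  moreover have "0 < r / sqrt (dot n x x)" using r p by simp
  ultimately show pos: "0 < ray L x" by linarith
  assume R: "0 \<le> R"
  show "R *\<^sub>R x \<in> L \<longleftrightarrow> R \<le> ray L x"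
  proof
    assume "R *\<^sub>R x \<in> L"
    then show "R \<le> ray L x" unfolding ray_def using R bdd by (intro cSup_upper) auto
  next
    assume le: "R \<le> ray L x"
    have "0 \<in> L" using r by (auto simp: Eball_0_eq dot_def)
    then have "(1 - R / ray L x) *\<^sub>R 0 + (R / ray L x) *\<^sub>R (ray L x *\<^sub>R x) \<in> L"
      using L(2) mem R le pos by (intro convexD) (auto simp: divide_le_eq)
    then show "R *\<^sub>R x \<in> L" using pos by simp
  qed
qed

definition layer_weight :: "real \<Rightarrow> ennreal"
  where "layer_weight s = ennreal (2 * (1 - s)) * indicator {0<..1} s"

text \<open>
  An average of the indicator functions of the dilates \<open>s L\<close>, \<open>0 < s \<le> 1\<close>. As \<open>V(s L) = s\<^sup>n V(L)\<close>, its
  integral is a constant multiple of \<open>V(L)\<close>; and by \<open>layer_eq\<close> it is a function of the radial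
  function. Together these replace polar coordinates. The weight \<open>2 (1 - s)\<close> makes that function,
  \<open>z \<mapsto> (max 0 (1 - 1/z))\<^sup>2\<close>, continuously differentiable, so that the volume of a family of
  bodies can be differentiated through the radial functions.
\<close>

definition layer :: "(nat \<Rightarrow> real) set \<Rightarrow> (nat \<Rightarrow> real) \<Rightarrow> real"
  where "layer L x = enn2real (\<integral>\<^sup>+s. layer_weight s * indicator L ((1 / s) *\<^sub>R x) \<partial>lborel)"

lemma measurable_layer_weight [measurable]: "layer_weight \<in> borel_measurable borel"
  unfolding layer_weight_def[abs_def] by measurable

lemma borel_measurable_layer_nn:
  fixes L :: "(nat \<Rightarrow> real) set"
  assumes [measurable]: "L \<in> sets borel"
  shows "(\<lambda>x. \<integral>\<^sup>+s. layer_weight s * indicator L ((1 / s) *\<^sub>R x) \<partial>lborel) \<in> borel_measurable borel"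
proof -
  have mm: "(\<lambda>p :: (nat \<Rightarrow> real) \<times> real. (1 / snd p) *\<^sub>R fst p) \<in> borel_measurable (borel \<Otimes>\<^sub>M lborel)"
  proof (rule measurable_coordinatewise_then_product)
    fix i
    have "(\<lambda>p :: (nat \<Rightarrow> real) \<times> real. (1 / snd p) * fst p i) \<in> borel_measurable (borel \<Otimes>\<^sub>M lborel)" by measurable
    then show "(\<lambda>p :: (nat \<Rightarrow> real) \<times> real. ((1 / snd p) *\<^sub>R fst p) i) \<in> borel_measurable (borel \<Otimes>\<^sub>M lborel)" by simp
  qed
  have i: "(\<lambda>p. indicator L ((1 / snd p) *\<^sub>R fst p) :: ennreal) \<in> borel_measurable (borel \<Otimes>\<^sub>M lborel)"
    by (rule measurable_compose[OF mm borel_measurable_indicator[OF assms]])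
  have "(\<lambda>p :: (nat \<Rightarrow> real) \<times> real. layer_weight (snd p)) \<in> borel_measurable (borel \<Otimes>\<^sub>M lborel)"
    by (rule measurable_compose[OF _ measurable_layer_weight]) measurable
  from borel_measurable_times_ennreal[OF this i]
  have "(\<lambda>p. layer_weight (snd p) * indicator L ((1 / snd p) *\<^sub>R fst p)) \<in> borel_measurable (borel \<Otimes>\<^sub>M lborel)" .
  then show ?thesis by (intro lborel.borel_measurable_nn_integral) (simp add: case_prod_beta')
qed

lemma borel_measurable_layer: "L \<in> sets borel \<Longrightarrow> layer L \<in> borel_measurable borel"
  unfolding layer_def[abs_def] by (rule borel_measurable_enn2real, rule borel_measurable_layer_nn)

lemma layer_nn_eq:
  assumes L: "compact L" "convex L" and r: "r > 0" "Eball n 0 r \<subseteq> L" and x: "x \<in> Espace n" "x \<noteq> 0"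
  shows "(\<integral>\<^sup>+s. layer_weight s * indicator L ((1 / s) *\<^sub>R x) \<partial>lborel) = ennreal ((max 0 (1 - 1 / ray L x))\<^sup>2)"
proof -
  note ray = ray_iff[OF L r x]
  have "(\<integral>\<^sup>+s. layer_weight s * indicator L ((1 / s) *\<^sub>R x) \<partial>lborel) = (\<integral>\<^sup>+s. layer_weight s * indicator {1 / ray L x..} s \<partial>lborel)"
  proof (rule nn_integral_cong)
    fix s :: real
    show "layer_weight s * indicator L ((1 / s) *\<^sub>R x) = layer_weight s * indicator {1 / ray L x..} s"
    proof (cases "s \<in> {0<..1}")
      case True
      have "(1 / s) *\<^sub>R x \<in> L \<longleftrightarrow> 1 / s \<le> ray L x" using True by (intro ray(2)) auto
      also have "\<dots> \<longleftrightarrow> 1 / ray L x \<le> s" using True ray(1) by (simp add: divide_le_eq mult.commute)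
      finally show ?thesis by (simp add: indicator_def)
    qed (simp add: layer_weight_def)
  qed
  also have "\<dots> = ennreal ((max 0 (1 - 1 / ray L x))\<^sup>2)"
    using ray(1) nn_integral_weight[of "1 / ray L x"] by (simp add: layer_weight_def)
  finally show ?thesis .
qed

lemma layer_eq:
  assumes "compact L" "convex L" "r > 0" "Eball n 0 r \<subseteq> L" "x \<in> Espace n" "x \<noteq> 0"
  shows "layer L x = (max 0 (1 - 1 / ray L x))\<^sup>2"
  unfolding layer_def layer_nn_eq[OF assms] by simp

lemma AE_Espace_nonzero:
  assumes "n > 0" shows "AE x in lebesgue_E n. x \<in> Espace n \<and> x \<noteq> 0"
proof -
  have "emeasure (lebesgue_E n) {0} = 0"
  proof -
    have "{0} = box_E n (\<lambda>_. 0)" by (auto simp: box_E_def fun_eq_iff) (metis linorder_not_less)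
    then show ?thesis using assms by (simp add: emeasure_box_E)
  qed
  then have "AE x in lebesgue_E n. x \<noteq> 0" by (intro AE_I[of _ _ "{0}"]) auto
  then show ?thesis using AE_lebesgue_E_Espace[of n] by eventually_elim blast
qed

text \<open>
  Fubini, and the scaling of volume under dilation.
\<close>

lemma layer_cake:
  assumes L: "compact L" "convex L" "L \<subseteq> Espace n" and r: "r > 0" "Eball n 0 r \<subseteq> L" and n: "n > 0"
  shows "(\<integral>\<^sup>+x. ennreal (layer L x) \<partial>lebesgue_E n) = ennreal (layer_const n) * emeasure (lebesgue_E n) L"
proof -
  have Lb[measurable]: "L \<in> sets borel" by (rule compact_imp_borel[OF L(1)])
  interpret PiL: product_sigma_finite "\<lambda>_::nat. lborel :: real measure" by (rule product_sigma_finite_lborel)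
  interpret F: sigma_finite_measure "PiL n" by (rule PiL.sigma_finite) simp
  interpret P: pair_sigma_finite lborel "PiL n" ..
  let ?w = "layer_weight"
  let ?g = "\<lambda>s x. ?w s * indicator L ((1 / s) *\<^sub>R (x :: nat \<Rightarrow> real))"
  have m: "(\<lambda>p. (1 / fst p) *\<^sub>R pad n (snd p)) \<in> borel_measurable (lborel \<Otimes>\<^sub>M PiL n)"
  proof (rule measurable_coordinatewise_then_product)
    fix i
    have "(\<lambda>x. pad n x i) \<in> borel_measurable (PiL n)" by measurable
    then have "(\<lambda>p. (1 / fst p) * pad n (snd p) i) \<in> borel_measurable (lborel \<Otimes>\<^sub>M PiL n)" by measurable
    then show "(\<lambda>p. ((1 / fst p) *\<^sub>R pad n (snd p)) i) \<in> borel_measurable (lborel \<Otimes>\<^sub>M PiL n)" by simp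
  qed
  have m2: "(\<lambda>p. ?g (fst p) (pad n (snd p))) \<in> borel_measurable (lborel \<Otimes>\<^sub>M PiL n)"
    using measurable_compose[OF m borel_measurable_indicator[OF Lb]] by measurable
  have "AE x in lebesgue_E n. ennreal (layer L x) = (\<integral>\<^sup>+s. ?g s x \<partial>lborel)"
    using AE_Espace_nonzero[OF n]
  proof eventually_elim
    case (elim x)
    then have "x \<in> Espace n" "x \<noteq> 0" by auto
    from layer_eq[OF L(1,2) r this] layer_nn_eq[OF L(1,2) r this] show ?case by simp
  qed
  then have "(\<integral>\<^sup>+x. ennreal (layer L x) \<partial>lebesgue_E n) = (\<integral>\<^sup>+x. (\<integral>\<^sup>+s. ?g s x \<partial>lborel) \<partial>lebesgue_E n)"
    by (rule nn_integral_cong_AE)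
  also have "\<dots> = (\<integral>\<^sup>+x. (\<integral>\<^sup>+s. ?g s (pad n x) \<partial>lborel) \<partial>PiL n)" by (rule nn_integral_lebesgue_E[OF borel_measurable_layer_nn[OF Lb]])
  also have "\<dots> = (\<integral>\<^sup>+s. (\<integral>\<^sup>+x. ?g s (pad n x) \<partial>PiL n) \<partial>lborel)"
    using m2 by (intro P.Fubini'[of "\<lambda>s x. ?g s (pad n x)"]) (simp add: case_prod_beta')
  also have "\<dots> = (\<integral>\<^sup>+s. ?w s * ennreal (s ^ n) * emeasure (lebesgue_E n) L \<partial>lborel)"
  proof (rule nn_integral_cong)
    fix s :: real
    show "(\<integral>\<^sup>+x. ?g s (pad n x) \<partial>PiL n) = ?w s * ennreal (s ^ n) * emeasure (lebesgue_E n) L"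
    proof (cases "s \<in> {0<..1}")
      case True
      define T where "T = (\<lambda>x. s *\<^sub>R x) ` L"
      have Tb: "T \<in> sets borel" unfolding T_def using L Lb True by (intro borel_scale_image) auto
      have iT: "indicator L ((1 / s) *\<^sub>R x) = (indicator T x :: ennreal)" for x
      proof -
        have "(1 / s) *\<^sub>R x \<in> L \<longleftrightarrow> x \<in> T"
        proof
          assume "(1 / s) *\<^sub>R x \<in> L"
          moreover have "x = s *\<^sub>R ((1 / s) *\<^sub>R x)" using True by (simp add: fun_eq_iff)
          ultimately show "x \<in> T" unfolding T_def by blast
        qed (use True in \<open>auto simp: T_def\<close>)
        then show ?thesis by (simp add: indicator_def)
      qed
      have "(\<integral>\<^sup>+x. ?g s (pad n x) \<partial>PiL n) = (\<integral>\<^sup>+x. ?g s x \<partial>lebesgue_E n)"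
        unfolding iT using Tb by (intro nn_integral_lebesgue_E[symmetric]) auto
      also have "\<dots> = ?w s * emeasure (lebesgue_E n) T"
        unfolding iT using Tb by (simp add: nn_integral_cmult)
      also have "emeasure (lebesgue_E n) T = ennreal (s ^ n) * emeasure (lebesgue_E n) L"
        unfolding T_def using L Lb True by (intro emeasure_scale_image) auto
      finally show ?thesis by (simp only: mult.assoc)
    qed (simp add: layer_weight_def)
  qed
  also have "\<dots> = (\<integral>\<^sup>+s. ?w s * ennreal (s ^ n) \<partial>lborel) * emeasure (lebesgue_E n) L"
  proof (rule nn_integral_multc)
    have "(\<lambda>s::real. ennreal (s ^ n)) \<in> borel_measurable borel"
      by (intro measurable_compose[OF borel_measurable_continuous_onI measurable_ennreal] continuous_intros)
    from borel_measurable_times_ennreal[OF measurable_layer_weight this]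
    show "(\<lambda>s. layer_weight s * ennreal (s ^ n)) \<in> borel_measurable lborel" by simp
  qed
  also have "\<dots> = ennreal (layer_const n) * emeasure (lebesgue_E n) L"
    unfolding layer_weight_def nn_integral_weight_power ..
  finally show ?thesis .
qed

lemma layer_nonneg: "0 \<le> layer L x" by (simp add: layer_def)

lemma layer_const_pos: "layer_const n > 0" by (simp add: layer_const_def)

lemma integral_layer:
  assumes L: "compact L" "convex L" "L \<subseteq> Espace n" and r: "r > 0" "Eball n 0 r \<subseteq> L" and n: "n > 0"
  shows "integrable (lebesgue_E n) (layer L)" "(\<integral>x. layer L x \<partial>lebesgue_E n) = layer_const n * vol n L"
proof -
  have m: "layer L \<in> borel_measurable (lebesgue_E n)"
    using borel_measurable_layer[OF compact_imp_borel[OF L(1)]] by simp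
  have fin: "emeasure (lebesgue_E n) L < \<infinity>" by (rule emeasure_compact_finite[OF L(1,3)])
  note lc = layer_cake[OF assms]
  show "integrable (lebesgue_E n) (layer L)"
    unfolding integrable_iff_bounded using m fin lc by (auto simp: layer_nonneg ennreal_mult_less_top)
  show "(\<integral>x. layer L x \<partial>lebesgue_E n) = layer_const n * vol n L"
    using m by (subst integral_eq_nn_integral) (auto simp: layer_nonneg lc enn2real_mult vol_def measure_def less_imp_le[OF layer_const_pos])
qed

context
  fixes n :: nat and K :: "(nat \<Rightarrow> real) set" and r :: real
  assumes n: "n > 0" and K: "compact K" "convex K" "K \<subseteq> Espace n" and r: "r > 0" "Eball n 0 r \<subseteq> K"
begin

lemma outer_body_props:
  assumes "t \<ge> 0"
  shows "compact (outer_body n K t)" "convex (outer_body n K t)" "outer_body n K t \<subseteq> Espace n" "Eball n 0 r \<subseteq> outer_body n K t"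
proof -
  show "compact (outer_body n K t)" using K assms by (intro compact_outer_body)
  show "convex (outer_body n K t)"
  proof (rule convexI)
    fix x y :: "nat \<Rightarrow> real" and a b :: real
    assume "x \<in> outer_body n K t" "y \<in> outer_body n K t" "0 \<le> a" "0 \<le> b" "a + b = 1"
    from outer_body_convex_comb[OF K(2) this(1,2) assms assms this(3-5)]
    show "a *\<^sub>R x + b *\<^sub>R y \<in> outer_body n K t" using \<open>a + b = 1\<close> by (simp flip: distrib_right)
  qed
  show "outer_body n K t \<subseteq> Espace n" using K assms by (intro outer_body_Espace)
  show "Eball n 0 r \<subseteq> outer_body n K t" using outer_body_mono[of 0 t n K] r assms by (auto simp: outer_body_0)
qed

lemma ray_outer_mono:
  assumes x: "x \<in> Espace n" "x \<noteq> 0" and st: "0 \<le> s" "s \<le> t"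
  shows "ray (outer_body n K s) x \<le> ray (outer_body n K t) x"
proof -
  have t: "0 \<le> t" using st by simp
  note S = outer_body_props[OF st(1)] and T = outer_body_props[OF t]
  note rs = ray_iff[OF S(1,2) r(1) S(4) x] and rt = ray_iff[OF T(1,2) r(1) T(4) x]
  have "ray (outer_body n K s) x *\<^sub>R x \<in> outer_body n K s" using rs by (simp add: less_imp_le)
  then have "ray (outer_body n K s) x *\<^sub>R x \<in> outer_body n K t" using outer_body_mono[OF st] by blast
  then show ?thesis using rs rt by (simp add: less_imp_le)
qed

text \<open>
  By convexity of \<open>K\<close>, \<open>(1 - a) K + a (K + tB) \<subseteq> K + a t B\<close>. Concavity in the parameter of the
  parallel body is what makes the one-sided derivative of the radial function exist.
\<close>

lemma ray_outer_concave:
  assumes x: "x \<in> Espace n" "x \<noteq> 0" and t: "0 \<le> t" and a: "0 \<le> a" "a \<le> 1"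
  shows "(1 - a) * ray K x + a * ray (outer_body n K t) x \<le> ray (outer_body n K (a * t)) x"
proof -
  have at: "0 \<le> a * t" using a t by simp
  note T = outer_body_props[OF t] and A = outer_body_props[OF at]
  note r0 = ray_iff[OF K(1,2) r x] and rt = ray_iff[OF T(1,2) r(1) T(4) x] and ra = ray_iff[OF A(1,2) r(1) A(4) x]
  have "ray K x *\<^sub>R x \<in> outer_body n K 0" using r0 by (simp add: outer_body_0 less_imp_le)
  moreover have "ray (outer_body n K t) x *\<^sub>R x \<in> outer_body n K t" using rt by (simp add: less_imp_le)
  ultimately have "(1 - a) *\<^sub>R (ray K x *\<^sub>R x) + a *\<^sub>R (ray (outer_body n K t) x *\<^sub>R x) \<in> outer_body n K ((1 - a) * 0 + a * t)"
    using t a by (intro outer_body_convex_comb[OF K(2)]) auto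
  then have "((1 - a) * ray K x + a * ray (outer_body n K t) x) *\<^sub>R x \<in> outer_body n K (a * t)"
    by (simp add: scaleR_add_left)
  then show ?thesis using ra a r0(1) rt(1) by (simp add: less_imp_le)
qed

lemma ray_outer_upper:
  assumes x: "x \<in> Espace n" "x \<noteq> 0" and t: "0 \<le> t"
  shows "ray (outer_body n K t) x \<le> (1 + t / r) * ray K x"
proof -
  note T = outer_body_props[OF t]
  note r0 = ray_iff[OF K(1,2) r x] and rt = ray_iff[OF T(1,2) r(1) T(4) x]
  define q where "q = 1 + t / r"
  have q: "q > 0" using t r by (simp add: q_def add_pos_nonneg)
  have "ray (outer_body n K t) x *\<^sub>R x \<in> outer_body n K t" using rt by (simp add: less_imp_le)
  then obtain k where k: "k \<in> K" "ray (outer_body n K t) x *\<^sub>R x = q *\<^sub>R k"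
    using outer_body_subset_scale[OF K(2) r t] by (auto simp: q_def)
  have "(ray (outer_body n K t) x / q) *\<^sub>R x = (1 / q) *\<^sub>R (ray (outer_body n K t) x *\<^sub>R x)" by simp
  also have "\<dots> = k" unfolding k(2) using q by simp
  finally have "(ray (outer_body n K t) x / q) *\<^sub>R x \<in> K" using k by simp
  then have "ray (outer_body n K t) x / q \<le> ray K x" using r0 rt q by (simp add: less_imp_le)
  then show ?thesis using q by (simp add: pos_divide_le_eq q_def mult.commute)
qed

end

lemma antimono_bounded_tendsto_at_right:
  fixes f :: "real \<Rightarrow> real"
  assumes anti: "\<And>s t. 0 < s \<Longrightarrow> s \<le> t \<Longrightarrow> f t \<le> f s" and bd: "\<And>t. 0 < t \<Longrightarrow> f t \<le> B"
  shows "\<exists>l. (f \<longlongrightarrow> l) (at_right 0)"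
proof -
  define l where "l = Sup (f ` {0<..})"
  have bdd: "bdd_above (f ` {0<..})" using bd by (auto intro!: bdd_aboveI[of _ B])
  have le: "f t \<le> l" if "0 < t" for t unfolding l_def using that bdd by (intro cSup_upper) auto
  have "(f \<longlongrightarrow> l) (at_right 0)"
  proof (rule order_tendstoI)
    fix a assume "a < l"
    then obtain y where "y \<in> f ` {0<..}" "a < y"
      unfolding l_def by (subst (asm) less_cSup_iff[OF _ bdd]) auto
    then obtain t where t: "0 < t" "a < f t" by auto
    then have "a < f s" if "0 < s" "s < t" for s using anti[of s t] that by auto
    then show "\<forall>\<^sub>F x in at_right 0. a < f x" unfolding eventually_at_right_field using t by blast
  next
    fix a assume "l < a"
    then have "f s < a" if "0 < s" for s using le[OF that] by simp
    then show "\<forall>\<^sub>F x in at_right 0. f x < a" unfolding eventually_at_right_field by (intro exI[of _ 1]) auto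
  qed
  then show ?thesis by blast
qed

lemma DERIV_max0_square: "((\<lambda>y::real. (max 0 y)\<^sup>2) has_field_derivative 2 * max 0 y) (at y)"
proof (cases y "0::real" rule: linorder_cases)
  case less
  have "((\<lambda>y::real. 0) has_field_derivative 2 * max 0 y) (at y)" using less by (auto intro!: derivative_eq_intros)
  then show ?thesis
    by (rule has_field_derivative_transform_within_open[of _ _ _ "{..<0}"]) (use less in auto)
next
  case greater
  have "((\<lambda>y::real. y\<^sup>2) has_field_derivative 2 * max 0 y) (at y)" using greater by (auto intro!: derivative_eq_intros)
  then show ?thesis
    by (rule has_field_derivative_transform_within_open[of _ _ _ "{0<..}"]) (use greater in auto)
next
  case equal
  have "((\<lambda>z::real. (max 0 z)\<^sup>2 / z) \<longlongrightarrow> 0) (at 0)"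
  proof (rule Lim_null_comparison)
    show "\<forall>\<^sub>F z in at 0. norm ((max 0 z)\<^sup>2 / z) \<le> \<bar>z::real\<bar>"
      by (intro always_eventually allI) (auto simp: max_def power2_eq_square)
    show "((\<lambda>z::real. \<bar>z\<bar>) \<longlongrightarrow> 0) (at 0)" using tendsto_rabs[OF tendsto_ident_at[of 0 UNIV]] by simp
  qed
  then show ?thesis using equal by (simp add: has_field_derivative_iff)
qed

context
  fixes n :: nat and K :: "(nat \<Rightarrow> real) set" and r :: real
  assumes n: "n > 0" and K: "compact K" "convex K" "K \<subseteq> Espace n" and r: "r > 0" "Eball n 0 r \<subseteq> K"
begin

text \<open>
  The difference quotients of the concave function \<open>t \<mapsto> ray (K + tB) x\<close> are antimonotone in \<open>t\<close> and bounded by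
  \<open>ray K x / r\<close>, hence converge; the layer function is a differentiable function of the radial one.
\<close>

lemma layer_quotient_converges:
  assumes x: "x \<in> Espace n" "x \<noteq> 0"
  shows "\<exists>l. ((\<lambda>t. (layer (outer_body n K t) x - layer K x) / t) \<longlongrightarrow> l) (at_right 0)"
proof -
  define q where "q t = ray (outer_body n K t) x" for t
  have q0: "q 0 = ray K x" by (simp add: q_def outer_body_0)
  have q0pos: "q 0 > 0" unfolding q0 by (rule ray_iff(1)[OF K(1,2) r x])
  have "\<exists>l. ((\<lambda>t. (q t - q 0) / t) \<longlongrightarrow> l) (at_right 0)"
  proof (rule antimono_bounded_tendsto_at_right)
    fix s t :: real assume st: "0 < s" "s \<le> t"
    define a where "a = s / t"
    have a: "0 \<le> a" "a \<le> 1" "a * t = s" using st by (auto simp: a_def)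
    have "(1 - a) * q 0 + a * q t \<le> q s"
      using ray_outer_concave[OF n K r x _ a(1,2), of t] st a(3) unfolding q_def by (simp add: outer_body_0)
    then have "a * (q t - q 0) \<le> q s - q 0" by (simp add: algebra_simps)
    then have "(a * (q t - q 0)) / s \<le> (q s - q 0) / s" using st by (intro divide_right_mono) auto
    moreover have "(a * (q t - q 0)) / s = (q t - q 0) / t" using st by (simp add: a_def)
    ultimately show "(q t - q 0) / t \<le> (q s - q 0) / s" by simp
  next
    fix t :: real assume t: "0 < t"
    have "q t \<le> (1 + t / r) * q 0" unfolding q_def using ray_outer_upper[OF n K r x, of t] t by (simp add: outer_body_0)
    then show "(q t - q 0) / t \<le> q 0 / r" using t r(1) by (simp add: divide_le_eq field_simps)
  qed
  then obtain l where "((\<lambda>t. (q t - q 0) / t) \<longlongrightarrow> l) (at_right 0)" by blast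
  then have dq: "(q has_field_derivative l) (at 0 within {0<..})" by (simp add: has_field_derivative_iff)
  have "((\<lambda>z. 1 - 1 / z) has_field_derivative 1 / (q 0)\<^sup>2) (at (q 0))"
    using q0pos by (auto intro!: derivative_eq_intros simp: power2_eq_square)
  from DERIV_chain2[OF DERIV_max0_square this]
  obtain E where "((\<lambda>z. (max 0 (1 - 1 / z))\<^sup>2) has_field_derivative E) (at (q 0))" by blast
  from DERIV_chain'[OF dq this]
  have "((\<lambda>t. (max 0 (1 - 1 / q t))\<^sup>2) has_field_derivative E * l) (at 0 within {0<..})" .
  then have "((\<lambda>t. ((max 0 (1 - 1 / q t))\<^sup>2 - (max 0 (1 - 1 / q 0))\<^sup>2) / t) \<longlongrightarrow> E * l) (at_right 0)"
    by (simp add: has_field_derivative_iff)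
  moreover have "\<forall>\<^sub>F t in at_right 0. ((max 0 (1 - 1 / q t))\<^sup>2 - (max 0 (1 - 1 / q 0))\<^sup>2) / t = (layer (outer_body n K t) x - layer K x) / t"
    unfolding eventually_at_right_field
  proof (intro exI[of _ 1] conjI allI impI)
    fix t :: real assume "0 < t" "t < 1"
    then have t: "0 \<le> t" by simp
    note T = outer_body_props[OF n K r t]
    show "((max 0 (1 - 1 / q t))\<^sup>2 - (max 0 (1 - 1 / q 0))\<^sup>2) / t = (layer (outer_body n K t) x - layer K x) / t"
      unfolding layer_eq[OF T(1,2) r(1) T(4) x] layer_eq[OF K(1,2) r x] q0 by (simp add: q_def)
  qed simp
  ultimately show ?thesis by (blast intro: Lim_transform_eventually)
qed

text \<open>
  A dominating function for the passage to the limit: outside \<open>K + rB\<close> both layer functions vanish, and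
  inside the radial function grows at most by the factor \<open>1 + t/r\<close>.
\<close>

lemma layer_quotient_bound:
  assumes x: "x \<in> Espace n" "x \<noteq> 0" and t: "0 < t" "t \<le> r"
  shows "\<bar>(layer (outer_body n K t) x - layer K x) / t\<bar> \<le> 2 / r * indicator (outer_body n K r) x"
proof -
  have t0: "0 \<le> t" using t by simp
  note T = outer_body_props[OF n K r t0]
  define q0 where "q0 = ray K x"
  define qt where "qt = ray (outer_body n K t) x"
  have q0: "q0 > 0" unfolding q0_def by (rule ray_iff(1)[OF K(1,2) r x])
  have qt: "qt > 0" unfolding qt_def by (rule ray_iff(1)[OF T(1,2) r(1) T(4) x])
  have le: "q0 \<le> qt" using ray_outer_mono[OF n K r x, of 0 t] t by (simp add: q0_def qt_def outer_body_0)
  have up: "qt \<le> (1 + t / r) * q0" unfolding q0_def qt_def by (rule ray_outer_upper[OF n K r x t0])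
  define a where "a = 1 - 1 / qt"
  define b where "b = 1 - 1 / q0"
  have ab: "b \<le> a" unfolding a_def b_def using le q0 qt by (intro diff_left_mono divide_left_mono) auto
  have L: "layer (outer_body n K t) x = (max 0 a)\<^sup>2" "layer K x = (max 0 b)\<^sup>2"
    unfolding layer_eq[OF T(1,2) r(1) T(4) x] layer_eq[OF K(1,2) r x] by (simp_all add: a_def b_def q0_def qt_def)
  show ?thesis
  proof (cases "qt \<ge> 1")
    case False
    then have "a \<le> 0" using qt by (simp add: a_def)
    with ab show ?thesis unfolding L by (simp add: r(1) less_imp_le)
  next
    case True
    have "1 *\<^sub>R x \<in> outer_body n K t"
      using ray_iff(2)[OF T(1,2) r(1) T(4) x, of 1] True by (simp add: qt_def)
    then have xr: "x \<in> outer_body n K r" using outer_body_mono[OF t0 t(2)] by auto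
    have a1: "0 \<le> a" "a \<le> 1" using True qt by (auto simp: a_def)
    have "a - b \<le> t / r"
    proof -
      have "1 / q0 \<le> (1 + t / r) / qt" using up q0 qt by (simp add: divide_simps mult.commute)
      then have "a - b \<le> (t / r) / qt" by (simp add: a_def b_def add_divide_distrib)
      also have "\<dots> \<le> (t / r) / 1" using True t r by (intro divide_left_mono) auto
      finally show ?thesis by simp
    qed
    moreover have "max 0 a - max 0 b \<le> a - b" using a1 ab by (simp add: max_def)
    ultimately have d: "max 0 a - max 0 b \<le> t / r" by linarith
    have d0: "0 \<le> max 0 a - max 0 b" using ab by (simp add: max_def)
    have "\<bar>(max 0 a)\<^sup>2 - (max 0 b)\<^sup>2\<bar> = (max 0 a - max 0 b) * (max 0 a + max 0 b)"
      using d0 by (simp add: power2_eq_square algebra_simps abs_of_nonneg mult_mono)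
    also have "\<dots> \<le> (t / r) * 2"
      using d d0 a1 ab t r by (intro mult_mono) (auto simp: max_def)
    finally have "\<bar>(max 0 a)\<^sup>2 - (max 0 b)\<^sup>2\<bar> / t \<le> (t / r) * 2 / t" using t by (intro divide_right_mono) auto
    then show ?thesis using t xr unfolding L by (simp add: abs_divide)
  qed
qed

text \<open>
  Dominated convergence for the layer functions.
\<close>

lemma surface_limit_exists:
  "\<exists>S. ((\<lambda>t. (vol n (outer_body n K t) - vol n K) / t) \<longlongrightarrow> S) (at_right 0)"
proof -
  define D where "D t x = (layer (outer_body n K t) x - layer K x) / t" for t x
  define l where "l x = lim (\<lambda>i. D (1 / Suc i) x)" for x
  have Kb: "K \<in> sets borel" by (rule compact_imp_borel[OF K(1)])
  have Tb: "outer_body n K t \<in> sets borel" if "0 \<le> t" for t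
    by (rule compact_imp_borel[OF outer_body_props(1)[OF n K r that]])
  have mD: "D t \<in> borel_measurable (lebesgue_E n)" if "0 \<le> t" for t
    unfolding D_def using borel_measurable_layer[OF Tb[OF that]] borel_measurable_layer[OF Kb] by measurable
  have ml: "l \<in> borel_measurable (lebesgue_E n)"
    unfolding l_def[abs_def] by (intro borel_measurable_lim_metric mD) simp
  have seq0: "filterlim (\<lambda>i. 1 / real (Suc i)) (at_right 0) sequentially"
    by (intro filterlim_atI lim_1_over_n[THEN filterlim_compose, OF filterlim_Suc] | rule tendsto_imp_filterlim_at_right)+
       (auto intro!: LIMSEQ_Suc[OF lim_1_over_n])
  have Dl: "((\<lambda>t. D t x) \<longlongrightarrow> l x) (at_right 0)" if x: "x \<in> Espace n \<and> x \<noteq> 0" for x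
  proof -
    obtain m where m: "((\<lambda>t. D t x) \<longlongrightarrow> m) (at_right 0)"
      using layer_quotient_converges[of x] x unfolding D_def by blast
    from filterlim_compose[OF m seq0] have "(\<lambda>i. D (1 / Suc i) x) \<longlonglongrightarrow> m" .
    then have "l x = m" unfolding l_def by (rule limI)
    with m show ?thesis by simp
  qed
  have Cr: "compact (outer_body n K r)" "outer_body n K r \<subseteq> Espace n"
    using outer_body_props[OF n K r, of r] r by auto
  have w: "integrable (lebesgue_E n) (\<lambda>x. 2 / r * indicator (outer_body n K r) x)"
    using emeasure_compact_finite[OF Cr] compact_imp_borel[OF Cr(1)] by (intro integrable_mult_right) auto
  have intD: "(\<integral>x. D t x \<partial>lebesgue_E n) = layer_const n * ((vol n (outer_body n K t) - vol n K) / t)" if "0 \<le> t" for t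
  proof -
    note T = outer_body_props[OF n K r that]
    show ?thesis unfolding D_def
      using integral_layer[OF T(1-3) r(1) T(4) n] integral_layer[OF K r n]
      by (simp add: right_diff_distrib)
  qed
  have "((\<lambda>t. \<integral>x. D t x \<partial>lebesgue_E n) \<longlongrightarrow> (\<integral>x. l x \<partial>lebesgue_E n)) (at_right 0)"
    unfolding tendsto_at_iff_sequentially
  proof (intro allI impI)
    fix X :: "nat \<Rightarrow> real" assume X: "\<forall>i. X i \<in> {0<..} - {0}" "X \<longlonglongrightarrow> 0"
    have "\<forall>\<^sub>F i in sequentially. X i < r" using X(2) r(1) by (rule order_tendstoD)
    then obtain N where N: "\<And>i. i \<ge> N \<Longrightarrow> X i < r" by (auto simp: eventually_sequentially)
    have Xpos: "0 < X i" for i using X(1) by auto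
    have X': "(\<lambda>i. X (i + N)) \<longlonglongrightarrow> 0" using X(2) by (rule LIMSEQ_ignore_initial_segment)
    have "(\<lambda>i. \<integral>x. D (X (i + N)) x \<partial>lebesgue_E n) \<longlonglongrightarrow> (\<integral>x. l x \<partial>lebesgue_E n)"
    proof (rule integral_dominated_convergence[OF ml _ w])
      show "D (X (i + N)) \<in> borel_measurable (lebesgue_E n)" for i using Xpos by (intro mD less_imp_le)
      show "AE x in lebesgue_E n. (\<lambda>i. D (X (i + N)) x) \<longlonglongrightarrow> l x"
        using AE_Espace_nonzero[OF n]
      proof eventually_elim
        case (elim x)
        from Dl[OF this] X' Xpos show ?case by (auto simp: tendsto_at_iff_sequentially comp_def)
      qed
      show "AE x in lebesgue_E n. norm (D (X (i + N)) x) \<le> 2 / r * indicator (outer_body n K r) x" for i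
        using AE_Espace_nonzero[OF n]
      proof eventually_elim
        case (elim x)
        then show ?case unfolding D_def real_norm_def
          using Xpos N[of "i + N"] by (intro layer_quotient_bound) (auto intro: less_imp_le)
      qed
    qed
    then show "((\<lambda>t. \<integral>x. D t x \<partial>lebesgue_E n) \<circ> X) \<longlonglongrightarrow> (\<integral>x. l x \<partial>lebesgue_E n)"
      unfolding comp_def by (rule LIMSEQ_offset)
  qed
  then have "((\<lambda>t. (\<integral>x. D t x \<partial>lebesgue_E n) / layer_const n) \<longlongrightarrow> (\<integral>x. l x \<partial>lebesgue_E n) / layer_const n) (at_right 0)"
    using layer_const_pos[of n] by (intro tendsto_divide tendsto_const) auto
  moreover have "\<forall>\<^sub>F t in at_right 0. (\<integral>x. D t x \<partial>lebesgue_E n) / layer_const n = (vol n (outer_body n K t) - vol n K) / t"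
    unfolding eventually_at_right_field using layer_const_pos[of n] intD by (intro exI[of _ 1]) auto
  ultimately show ?thesis by (blast intro: Lim_transform_eventually)
qed

lemma surface_area_tendsto:
  "((\<lambda>t. (vol n (outer_body n K t) - vol n K) / t) \<longlongrightarrow> surface_area n K) (at_right 0)"
proof -
  obtain S where S: "((\<lambda>t. (vol n (outer_body n K t) - vol n K) / t) \<longlongrightarrow> S) (at_right 0)"
    using surface_limit_exists by blast
  have "surface_area n K = S"
    unfolding surface_area_def outer_body_def[symmetric] by (rule tendsto_Lim[OF trivial_limit_at_right_real S])
  with S show ?thesis by simp
qed

lemma surface_area_nonneg: "0 \<le> surface_area n K"
proof (rule tendsto_lowerbound[OF surface_area_tendsto])
  show "\<forall>\<^sub>F t in at_right 0. 0 \<le> (vol n (outer_body n K t) - vol n K) / t"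
    unfolding eventually_at_right_field
  proof (intro exI[of _ 1] conjI allI impI)
    fix t :: real assume "0 < t" "t < 1"
    then have t: "0 \<le> t" by simp
    have "vol n K \<le> vol n (outer_body n K t)"
      using outer_body_mono[of 0 t n K] outer_body_props[OF n K r t] t K
      by (intro vol_mono) (auto simp: outer_body_0 compact_imp_borel)
    then show "0 \<le> (vol n (outer_body n K t) - vol n K) / t" using t by simp
  qed simp
qed simp

text \<open>
  The volume of \<open>K + tB \<subseteq> (1 + t/r) K\<close> is at most \<open>(1 + t/r)\<^sup>n V(K)\<close>.
\<close>

lemma surface_area_le: "surface_area n K \<le> n * vol n K / r"
proof -
  have "((\<lambda>t. (1 + t / r) ^ n) has_field_derivative n * (1 + 0 / r) ^ (n - 1) * (1 / r)) (at 0)"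
    by (rule DERIV_cong[OF DERIV_power[OF DERIV_add[OF DERIV_const DERIV_cdivide[OF DERIV_ident]]]]) simp
  then have "((\<lambda>t. ((1 + t / r) ^ n - 1) / t) \<longlongrightarrow> n / r) (at 0)"
    by (simp add: has_field_derivative_iff)
  then have "((\<lambda>t. ((1 + t / r) ^ n - 1) / t) \<longlongrightarrow> n / r) (at_right 0)"
    by (rule filterlim_mono) (auto simp: at_within_le_at)
  then have "((\<lambda>t. ((1 + t / r) ^ n - 1) / t * vol n K) \<longlongrightarrow> n / r * vol n K) (at_right 0)"
    by (rule tendsto_mult_right)
  moreover have "\<forall>\<^sub>F t in at_right 0. (vol n (outer_body n K t) - vol n K) / t \<le> ((1 + t / r) ^ n - 1) / t * vol n K"
    unfolding eventually_at_right_field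
  proof (intro exI[of _ 1] conjI allI impI)
    fix t :: real assume "0 < t" "t < 1"
    then have t: "0 \<le> t" "0 < t" by auto
    have q: "1 + t / r > 0" using t r by (simp add: add_pos_nonneg)
    have Kb: "K \<in> sets borel" by (rule compact_imp_borel[OF K(1)])
    have "compact ((\<lambda>x. (1 + t / r) *\<^sub>R x) ` K)" by (rule compact_scale_image[OF K(1)])
    then have "vol n (outer_body n K t) \<le> vol n ((\<lambda>x. (1 + t / r) *\<^sub>R x) ` K)"
      using outer_body_subset_scale[OF K(2) r t(1)] outer_body_props[OF n K r t(1)] K
      by (intro vol_mono compact_imp_borel) auto
    also have "\<dots> = (1 + t / r) ^ n * vol n K" by (rule vol_scale_image[OF Kb K(3) q])
    finally have "vol n (outer_body n K t) - vol n K \<le> ((1 + t / r) ^ n - 1) * vol n K" by (simp add: algebra_simps)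
    then show "(vol n (outer_body n K t) - vol n K) / t \<le> ((1 + t / r) ^ n - 1) / t * vol n K"
      using t by (simp add: divide_right_mono)
  qed simp
  ultimately have "surface_area n K \<le> n / r * vol n K"
    by (intro tendsto_le[OF trivial_limit_at_right_real _ surface_area_tendsto])
  then show ?thesis by simp
qed

end

lemma convex_cube: "convex (cube n)"
proof (rule convexI)
  fix x y :: "nat \<Rightarrow> real" and a b :: real
  assume x: "x \<in> cube n" and y: "y \<in> cube n" and ab: "0 \<le> a" "0 \<le> b" "a + b = 1"
  have "\<bar>a * x i + b * y i\<bar> \<le> 1" if "i < n" for i
  proof -
    have "\<bar>a * x i + b * y i\<bar> \<le> a * \<bar>x i\<bar> + b * \<bar>y i\<bar>"
      using ab by (intro order_trans[OF abs_triangle_ineq]) (simp add: abs_mult)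
    also have "\<dots> \<le> a * 1 + b * 1" using x y that ab unfolding cube_eq_box_E box_E_def by (intro add_mono mult_left_mono) auto
    finally show ?thesis using ab by simp
  qed
  then show "a *\<^sub>R x + b *\<^sub>R y \<in> cube n" using x y unfolding cube_eq_box_E box_E_def by simp
qed

lemma Eball_subset_cube: "Eball n 0 1 \<subseteq> cube n"
proof
  fix x assume x: "x \<in> Eball n 0 1"
  then have "(x i)\<^sup>2 \<le> 1" if "i < n" for i using coord_sq_le_dot[OF that, of x] by (auto simp: Eball_0_eq)
  then show "x \<in> cube n" using x unfolding cube_eq_box_E box_E_def by (auto simp: Eball_0_eq abs_square_le_1)
qed

text \<open>
  The parallel body of the cube contains, besides the cube, the slabs of thickness \<open>t\<close> over its facets: for
  each coordinate \<open>j\<close> a pair of slabs of total volume \<open>2\<^sup>n t\<close>, disjoint for different \<open>j\<close>.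
\<close>

lemma surface_area_cube_ge:
  assumes n: "n > 0"
  shows "real n * 2 ^ n \<le> surface_area n (cube n)"
proof -
  have W: "compact (cube n)" "convex (cube n)" "cube n \<subseteq> Espace n"
    by (auto simp: cube_eq_box_E compact_box_E convex_cube[unfolded cube_eq_box_E]) (auto simp: box_E_def)
  have "\<forall>\<^sub>F t in at_right 0. real n * 2 ^ n \<le> (vol n (outer_body n (cube n) t) - vol n (cube n)) / t"
    unfolding eventually_at_right_field
  proof (intro exI[of _ 1] conjI allI impI)
    fix t :: real assume "0 < t" "t < 1"
    then have t: "0 < t" "0 \<le> t" by auto
    \<comment> \<open>\<open>A j\<close> is the pair of slabs in direction \<open>j < n\<close>, and \<open>A n\<close> is the cube itself.\<close>
    define b where "b j = (\<lambda>i::nat. if i = j then 1 + t else 1)" for j :: nat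
    define A where "A j = (if j = n then cube n else box_E n (b j) - cube n)" for j
    have cubesub: "cube n \<subseteq> box_E n (b j)" for j using t by (auto simp: cube_eq_box_E box_E_def b_def)
    have bb: "box_E n (b j) \<in> sets borel" for j by (intro compact_imp_borel compact_box_E)
    have cb: "cube n \<in> sets borel" by (intro compact_imp_borel W)
    have volb: "vol n (box_E n (b j)) = 2 ^ n * (1 + t)" if "j < n" for j
    proof -
      have "vol n (box_E n (b j)) = (\<Prod>i<n. 2 * b j i)" using t by (intro vol_box_E) (auto simp: b_def)
      also have "\<dots> = 2 ^ n * (\<Prod>i<n. b j i)" by (simp add: prod.distrib)
      also have "(\<Prod>i<n. b j i) = 1 + t" using that unfolding b_def by (simp add: prod.delta)
      finally show ?thesis .
    qed
    have fin: "emeasure (lebesgue_E n) (box_E n (b j)) \<noteq> \<infinity>" for j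
    proof -
      have "box_E n (b j) \<subseteq> Espace n" by (auto simp: box_E_def)
      from emeasure_compact_finite[OF compact_box_E this] show ?thesis by simp
    qed
    have volA: "vol n (A j) = 2 ^ n * t" if "j < n" for j
      using that measure_Diff[OF fin[of j], of "cube n"] bb cb cubesub volb[OF that] vol_cube[of n]
      by (simp add: A_def vol_def algebra_simps)
    have Asub: "A j \<subseteq> box_E n (b j)" for j using cubesub by (auto simp: A_def)
    have Ab: "A j \<in> sets borel" for j using bb cb by (auto simp: A_def)
    have "measure (lebesgue_E n) (\<Union>j\<in>{..n}. A j) = (\<Sum>j\<in>{..n}. measure (lebesgue_E n) (A j))"
    proof (rule measure_finite_Union)
      show "A ` {..n} \<subseteq> sets (lebesgue_E n)" using Ab by auto
      show "disjoint_family_on A {..n}"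
        unfolding disjoint_family_on_def
      proof (intro ballI impI)
        fix j k assume jk: "j \<in> {..n}" "k \<in> {..n}" "j \<noteq> k"
        have "x \<in> cube n" if x: "x \<in> box_E n (b j)" "x \<in> box_E n (b k)" for x
          unfolding cube_eq_box_E box_E_def
        proof (intro CollectI conjI allI impI)
          show "x i = 0" if "n \<le> i" for i using x that by (auto simp: box_E_def)
          fix i assume "i < n"
          then have "\<bar>x i\<bar> \<le> b j i" "\<bar>x i\<bar> \<le> b k i" using x by (auto simp: box_E_def)
          then show "\<bar>x i\<bar> \<le> 1" using jk(3) unfolding b_def by (cases "i = j"; cases "i = k") auto
        qed
        then show "A j \<inter> A k = {}" using jk by (auto simp: A_def)
      qed
      show "emeasure (lebesgue_E n) (A j) \<noteq> \<infinity>" if "j \<in> {..n}" for j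
        using emeasure_mono[OF Asub[of j], of "lebesgue_E n"] bb fin[of j] by (auto simp: top_unique)
    qed simp
    also have "\<dots> = (\<Sum>j<n. 2 ^ n * t) + 2 ^ n"
      using volA vol_cube[of n] unfolding lessThan_Suc_atMost[symmetric] by (simp add: vol_def A_def[of n])
    finally have m: "measure (lebesgue_E n) (\<Union>j\<in>{..n}. A j) = n * (2 ^ n * t) + 2 ^ n" by simp
    have "(\<Union>j\<in>{..n}. A j) \<subseteq> outer_body n (cube n) t"
    proof
      fix x assume "x \<in> (\<Union>j\<in>{..n}. A j)"
      then obtain j where j: "j \<le> n" "x \<in> A j" by auto
      show "x \<in> outer_body n (cube n) t"
      proof (cases "j = n")
        case True
        then show ?thesis using j outer_body_mono[of 0 t n "cube n"] t by (auto simp: A_def outer_body_0)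
      next
        case False
        then have jn: "j < n" using j by simp
        have xb: "x \<in> box_E n (b j)" using Asub j by auto
        define d where "d = x j - max (-1) (min 1 (x j))"
        define y where "y = (\<lambda>i. if i = j then d else 0 :: real)"
        have xj: "\<bar>x j\<bar> \<le> 1 + t" using xb jn by (auto simp: box_E_def b_def)
        then have dt: "\<bar>d\<bar> \<le> t" using t by (auto simp: d_def max_def min_def)
        have "dot n y y = (\<Sum>i<n. if i = j then d * d else 0)" unfolding dot_def y_def by (intro sum.cong) auto
        also have "\<dots> = d\<^sup>2" using jn by (simp add: power2_eq_square)
        also have "\<dots> \<le> t\<^sup>2" using dt by (intro abs_le_square_iff[THEN iffD1]) auto
        finally have "y \<in> Eball n 0 t" using t jn by (auto simp: Eball_0_eq y_def)
        moreover have "x - y \<in> cube n"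
          unfolding cube_eq_box_E box_E_def
        proof (intro CollectI conjI allI impI)
          show "(x - y) i = 0" if "n \<le> i" for i using xb that jn by (auto simp: box_E_def y_def)
          fix i assume "i < n"
          then show "\<bar>(x - y) i\<bar> \<le> 1" using xb by (cases "i = j") (auto simp: y_def d_def box_E_def b_def)
        qed
        moreover have "x = (x - y) + y" by simp
        ultimately show ?thesis unfolding outer_body_def by blast
      qed
    qed
    then have "measure (lebesgue_E n) (\<Union>j\<in>{..n}. A j) \<le> vol n (outer_body n (cube n) t)"
      unfolding vol_def[symmetric] using Ab W t
      by (intro vol_mono compact_outer_body outer_body_Espace sets.finite_UN) auto
    then have "n * 2 ^ n * t \<le> vol n (outer_body n (cube n) t) - vol n (cube n)" by (simp add: m vol_cube algebra_simps)
    then show "real n * 2 ^ n \<le> (vol n (outer_body n (cube n) t) - vol n (cube n)) / t" using t by (simp add: pos_le_divide_eq)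
  qed simp
  note ev = this
  have "(0::real) < 1" by simp
  from tendsto_lowerbound[OF surface_area_tendsto[OF n W this Eball_subset_cube] ev] show ?thesis by simp
qed

section \<open>Translations and ellipsoids\<close>

lemma PiL_translate:
  "distr (PiL n) (PiL n) (\<lambda>x. restrict (\<lambda>i. x i + a i) {..<n}) = PiL n"
proof -
  interpret product_sigma_finite "\<lambda>_::nat. lborel :: real measure" by (rule product_sigma_finite_lborel)
  have m: "(\<lambda>x. restrict (\<lambda>i. x i + a i) {..<n}) \<in> measurable (PiL n) (PiL n)"
    by (intro measurable_restrict) (use measurable_PiL_coord in measurable)
  show ?thesis
  proof (rule PiM_eqI)
    fix A :: "nat \<Rightarrow> real set" assume A: "\<And>i. i \<in> {..<n} \<Longrightarrow> A i \<in> sets lborel"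
    have "emeasure (distr (PiL n) (PiL n) (\<lambda>x. restrict (\<lambda>i. x i + a i) {..<n})) (PiE {..<n} A)
       = emeasure (PiL n) ((\<lambda>x. restrict (\<lambda>i. x i + a i) {..<n}) -` PiE {..<n} A \<inter> space (PiL n))"
      using A by (intro emeasure_distr m sets_PiM_I_finite) auto
    also have "(\<lambda>x. restrict (\<lambda>i. x i + a i) {..<n}) -` PiE {..<n} A \<inter> space (PiL n) = PiE {..<n} (\<lambda>i. (\<lambda>s. a i + s) -` A i \<inter> space lborel)"
      by (auto simp: space_PiM PiE_iff add.commute)
    also have "emeasure (PiL n) \<dots> = (\<Prod>i<n. emeasure lborel ((\<lambda>s. a i + s) -` A i \<inter> space lborel))"
      using A by (intro emeasure_PiM measurable_sets[of _ lborel lborel]) auto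
    also have "\<dots> = (\<Prod>i<n. emeasure lborel (A i))"
    proof (rule prod.cong[OF refl])
      fix i assume "i \<in> {..<n}"
      then have "emeasure (distr lborel borel ((+) (a i))) (A i) = emeasure lborel ((\<lambda>s. a i + s) -` A i \<inter> space lborel)"
        using A by (intro emeasure_distr) auto
      then show "emeasure lborel ((\<lambda>s. a i + s) -` A i \<inter> space lborel) = emeasure lborel (A i)"
        by (simp add: lborel_distr_plus)
    qed
    finally show "emeasure (distr (PiL n) (PiL n) (\<lambda>x. restrict (\<lambda>i. x i + a i) {..<n})) (PiE {..<n} A) = (\<Prod>i\<in>{..<n}. emeasure lborel (A i))" .
  qed auto
qed

lemma vol_translate_vimage:
  assumes a: "a \<in> Espace n" and S: "S \<in> sets borel" and T: "{x. x + a \<in> S} \<in> sets borel"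
  shows "vol n {x. x + a \<in> S} = vol n S"
proof -
  let ?g = "\<lambda>x. restrict (\<lambda>i. x i + a i) {..<n}"
  have m: "?g \<in> measurable (PiL n) (PiL n)"
    by (intro measurable_restrict) (use measurable_PiL_coord in measurable)
  have g: "pad n (?g x) = pad n x + a" for x
    using a by (auto simp: pad_def fun_eq_iff)
  have "vol n S = measure (PiL n) (pad n -` S \<inter> space (PiL n))" by (rule vol_eq_PiL[OF S])
  also have "\<dots> = measure (distr (PiL n) (PiL n) ?g) (pad n -` S \<inter> space (PiL n))" unfolding PiL_translate ..
  also have "\<dots> = measure (PiL n) (?g -` (pad n -` S \<inter> space (PiL n)) \<inter> space (PiL n))"
    by (intro measure_distr m measurable_sets[OF measurable_pad S])
  also have "?g -` (pad n -` S \<inter> space (PiL n)) \<inter> space (PiL n) = pad n -` {x. x + a \<in> S} \<inter> space (PiL n)"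
    using measurable_space[OF m] by (intro Set.set_eqI) (simp only: vimage_def Int_iff mem_Collect_eq g, blast)
  also have "measure (PiL n) \<dots> = vol n {x. x + a \<in> S}" by (rule vol_eq_PiL[OF T, symmetric])
  finally show ?thesis by simp
qed

lemma Eball_translate:
  assumes "a \<in> Espace n" shows "Eball n a r = (\<lambda>x. a + x) ` Eball n 0 r"
proof (intro Set.set_eqI iffI)
  fix x assume x: "x \<in> Eball n a r"
  then have "x - a \<in> Eball n 0 r" using assms by (auto simp: Eball_def)
  moreover have "x = a + (x - a)" by simp
  ultimately show "x \<in> (\<lambda>x. a + x) ` Eball n 0 r" by blast
next
  fix x assume "x \<in> (\<lambda>x. a + x) ` Eball n 0 r"
  then show "x \<in> Eball n a r" using assms by (auto simp: Eball_def)
qed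

lemma continuous_add_const: "continuous_on A (\<lambda>x. a + x :: nat \<Rightarrow> real)"
proof (rule continuous_on_coordinatewise_then_product)
  fix i
  have "continuous_on A (\<lambda>x. a i + x i)"
    by (rule continuous_on_add[OF continuous_on_const continuous_on_subset[OF continuous_on_product_coordinates]]) simp
  then show "continuous_on A (\<lambda>x. (a + x) i)" by simp
qed

lemma continuous_apply_mat: "continuous_on S (apply_mat A)"
proof (rule continuous_on_coordinatewise_then_product)
  fix i
  have "continuous_on S (\<lambda>x. \<Sum>j<dim_col A. A $$ (i,j) * x j)"
    by (rule continuous_on_sum, rule continuous_on_mult[OF continuous_on_const continuous_on_subset[OF continuous_on_product_coordinates]]) simp
  then show "continuous_on S (\<lambda>x. apply_mat A x i)"
    by (cases "i < dim_row A") (simp_all add: apply_mat_def)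
qed

lemma vol_Eball_translate:
  assumes a: "a \<in> Espace n" and r: "r \<ge> 0"
  shows "vol n (Eball n a r) = vol n (Eball n 0 r)"
proof -
  have c: "compact (Eball n a r)" unfolding Eball_translate[OF a]
    by (intro compact_continuous_image continuous_add_const compact_Eball_0 r)
  have eq: "{x. x + a \<in> Eball n a r} = Eball n 0 r"
    using a by (auto simp: Eball_def)
  show ?thesis
    using vol_translate_vimage[OF a compact_imp_borel[OF c]] compact_imp_borel[OF compact_Eball_0[OF r, of n]]
    unfolding eq by simp
qed

lemma compact_ellipsoid: "ellipsoid n E \<Longrightarrow> compact E \<and> E \<subseteq> Espace n"
proof -
  assume "ellipsoid n E"
  then obtain A a where A: "A \<in> carrier_mat n n" "a \<in> Espace n" "E = (\<lambda>x. a + apply_mat A x) ` Eball n 0 1"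
    by (auto simp: ellipsoid_def)
  have "E = (\<lambda>x. a + x) ` (apply_mat A ` Eball n 0 1)" by (simp add: A(3) image_image)
  moreover have "compact \<dots>"
    by (intro compact_continuous_image continuous_add_const continuous_apply_mat compact_Eball_0) simp
  moreover have "E \<subseteq> Espace n" using A(2) apply_mat_in_Espace[OF A(1)] by (auto simp: A(3))
  ultimately show ?thesis by simp
qed

lemma ellipsoid_scale:
  assumes E: "ellipsoid n E" and r: "r > 0"
  shows "ellipsoid n ((\<lambda>x. r *\<^sub>R x) ` E)"
proof -
  obtain A a where A: "A \<in> carrier_mat n n" "a \<in> Espace n" "Determinant.det A \<noteq> 0" "E = (\<lambda>x. a + apply_mat A x) ` Eball n 0 1"
    using E by (auto simp: ellipsoid_def)
  have ap: "apply_mat (r \<cdot>\<^sub>m A) x = r *\<^sub>R apply_mat A x" for x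
    using A(1) by (auto simp: apply_mat_def fun_eq_iff sum_distrib_left mult.assoc)
  have "(\<lambda>x. r *\<^sub>R x) ` E = (\<lambda>x. r *\<^sub>R a + apply_mat (r \<cdot>\<^sub>m A) x) ` Eball n 0 1"
    by (simp add: A(4) image_image ap scaleR_add_right)
  moreover have "r \<cdot>\<^sub>m A \<in> carrier_mat n n" "r *\<^sub>R a \<in> Espace n" "Determinant.det (r \<cdot>\<^sub>m A) \<noteq> 0"
    using A r by auto
  ultimately show ?thesis unfolding ellipsoid_def topspace_Euclidean_space by blast
qed

lemma Eball_scale:
  assumes r: "r > 0" shows "Eball n 0 r = (\<lambda>x. r *\<^sub>R x) ` Eball n 0 1"
proof (intro Set.set_eqI iffI)
  fix x assume x: "x \<in> Eball n 0 r"
  then have "dot n x x \<le> r\<^sup>2" "x \<in> Espace n" using r by (auto simp: Eball_0_eq)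
  then have "(1 / r) *\<^sub>R x \<in> Eball n 0 1" using r by (auto simp: Eball_0_eq dot_simps power2_eq_square divide_le_eq)
  moreover have "x = r *\<^sub>R ((1 / r) *\<^sub>R x)" using r by (simp add: fun_eq_iff)
  ultimately show "x \<in> (\<lambda>x. r *\<^sub>R x) ` Eball n 0 1" by blast
next
  fix x assume "x \<in> (\<lambda>x. r *\<^sub>R x) ` Eball n 0 1"
  then obtain y where y: "y \<in> Espace n" "dot n y y \<le> 1" "x = r *\<^sub>R y" by (auto simp: Eball_0_eq)
  have "r\<^sup>2 * dot n y y \<le> r\<^sup>2 * 1" using y by (intro mult_left_mono) auto
  then show "x \<in> Eball n 0 r" using y r by (auto simp: Eball_0_eq dot_simps power2_eq_square mult.assoc)
qed

text \<open>
  The product of the gain in the volume bound and the factor \<open>1 / (32 n n!)\<close> that relates \<open>\<epsilon>\<close> to the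
  threshold for the frame defect in \<open>volume_or_parallelotope\<close>.
\<close>

section \<open>Stability of the volume and of the isoperimetric ratio\<close>

definition stability_gain :: "nat \<Rightarrow> real"
  where "stability_gain n = exp (- real n) * (1 / 2000) ^ 8 / 1350 / (32 * real n * fact n)"

text \<open>
  The frame defect of a John decomposition decides between the alternatives. If it is at least \<open>d\<close>, the
  volume bound has the required deficit. Otherwise \<open>n\<close> of the contact vectors, the rows of \<open>U\<close>, have a
  Gram matrix close to the identity.
\<close>

lemma volume_or_parallelotope:
  assumes n: "2 \<le> n"
    and K: "compact K" "convex K" "K \<subseteq> Espace n" "Eball n 0 1 \<subseteq> K" and sym: "\<And>x. x \<in> K \<Longrightarrow> - x \<in> K"
    and max: "\<And>E. ellipsoid n E \<Longrightarrow> E \<subseteq> K \<Longrightarrow> vol n E \<le> vol n (Eball n 0 1)"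
    and \<epsilon>: "0 < \<epsilon>" "\<epsilon> < 1"
  shows "vol n K \<le> 2 ^ n"
    and "vol n K \<le> (1 - stability_gain n * \<epsilon>) * 2 ^ n \<or>
      (\<exists>U\<in>carrier_mat n n. 1 - \<epsilon> / 8 \<le> \<bar>Determinant.det U\<bar> \<and> (\<forall>x\<in>K. \<forall>i<n. \<bar>apply_mat U x i\<bar> \<le> 1))"
proof -
  obtain I :: "nat set" and c u where fr: "finite I" "\<And>i. i \<in> I \<Longrightarrow> 0 < c i" "\<And>i. i \<in> I \<Longrightarrow> (\<Sum>k<n. (u i k)\<^sup>2) = 1"
    "\<And>j k. j < n \<Longrightarrow> k < n \<Longrightarrow> (\<Sum>i\<in>I. c i * u i j * u i k) = (if j = k then 1 else 0)"
    and contact: "\<And>x i. x \<in> K \<Longrightarrow> i \<in> I \<Longrightarrow> \<bar>\<Sum>k<n. u i k * x k\<bar> \<le> 1"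
    using john_decomposition[OF n K sym max] by blast
  interpret F: weighted_frame n I c u by unfold_locales (use fr in auto)
  have volle: "vol n K \<le> 2 ^ n * (1 - F.gain * F.frame_defect)"
    using K contact by (intro F.vol_le_frame_defect compact_imp_borel emeasure_compact_finite) (auto simp: F.coeff_def)
  have gain0: "F.gain > 0" by (simp add: F.gain_def)
  show "vol n K \<le> 2 ^ n"
  proof (rule order_trans[OF volle])
    have "F.gain * F.frame_defect \<ge> 0" using gain0 F.frame_defect_nonneg by simp
    then show "2 ^ n * (1 - F.gain * F.frame_defect) \<le> 2 ^ n" by (simp add: mult_left_le)
  qed
  \<comment> \<open>Chosen so that \<open>n! \<cdot> 4 n d = \<epsilon> / 8\<close> in the estimate of the Gram determinant.\<close>
  define d where "d = \<epsilon> / (32 * real n * fact n)"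
  have gd: "F.gain * d = stability_gain n * \<epsilon>" by (simp add: d_def stability_gain_def F.gain_def)
  show "vol n K \<le> (1 - stability_gain n * \<epsilon>) * 2 ^ n \<or>
      (\<exists>U\<in>carrier_mat n n. 1 - \<epsilon> / 8 \<le> \<bar>Determinant.det U\<bar> \<and> (\<forall>x\<in>K. \<forall>i<n. \<bar>apply_mat U x i\<bar> \<le> 1))"
  proof (cases "F.frame_defect < d")
    case False
    then have "F.gain * d \<le> F.gain * F.frame_defect" using gain0 by simp
    then have "2 ^ n * (1 - F.gain * F.frame_defect) \<le> 2 ^ n * (1 - F.gain * d)" by (intro mult_left_mono) auto
    with volle have "vol n K \<le> 2 ^ n * (1 - stability_gain n * \<epsilon>)" unfolding gd by (rule order_trans)
    then show ?thesis by (simp add: mult.commute)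
  next
    case True
    obtain f where f: "\<And>a. a < n \<Longrightarrow> f a \<in> I"
      "\<And>a b. a < n \<Longrightarrow> b < n \<Longrightarrow> a \<noteq> b \<Longrightarrow> (F.gram (f a) (f b))\<^sup>2 \<le> 4 * n * d"
      using F.almost_orthonormal_subfamily[OF True] by blast
    define U where "U = mat n n (\<lambda>(i,j). u (f i) j)"
    have U: "U \<in> carrier_mat n n" by (simp add: U_def)
    define h where "h = 4 * n * d"
    have h: "fact n * h = \<epsilon> / 8" "0 \<le> h" using \<epsilon> n by (auto simp: h_def d_def)
    have "h \<le> 1"
    proof -
      have "1 * h \<le> fact n * h" using h(2) by (intro mult_right_mono) (auto simp: fact_ge_1)
      then show ?thesis using h(1) \<epsilon> by linarith
    qed
    have G: "(U * U\<^sup>T) $$ (i,j) = F.gram (f i) (f j)" if "i < n" "j < n" for i j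
      using that by (simp add: U_def scalar_prod_def F.gram_def atLeast0LessThan)
    have "Determinant.det (U * U\<^sup>T) \<ge> 1 - fact n * h"
    proof (rule det_near_identity)
      show "U * U\<^sup>T \<in> carrier_mat n n" using U by auto
      show "(U * U\<^sup>T) $$ (i,i) = 1" if "i < n" for i using f that by (simp add: G F.gram_self)
      show "((U * U\<^sup>T) $$ (i,j))\<^sup>2 \<le> h" if "i < n" "j < n" "i \<noteq> j" for i j
        using f(2)[OF that] that by (simp add: G h_def)
    qed fact+
    moreover have "Determinant.det (U * U\<^sup>T) = (Determinant.det U)\<^sup>2"
      using U by (simp add: det_mult[OF U] det_transpose[OF U] power2_eq_square)
    ultimately have d2: "(Determinant.det U)\<^sup>2 \<ge> 1 - \<epsilon> / 8" by (simp add: h)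
    have "1 - \<epsilon> / 8 \<le> \<bar>Determinant.det U\<bar>"
    proof (cases "\<bar>Determinant.det U\<bar> \<le> 1")
      case True
      then have "\<bar>Determinant.det U\<bar> * \<bar>Determinant.det U\<bar> \<le> \<bar>Determinant.det U\<bar> * 1" by (intro mult_left_mono) auto
      then show ?thesis using d2 by (simp add: power2_eq_square flip: abs_mult)
    qed (use \<epsilon> in simp)
    moreover have "\<bar>apply_mat U x i\<bar> \<le> 1" if "x \<in> K" "i < n" for x i
      using contact[OF that(1) f(1)[OF that(2)]] that by (simp add: apply_mat_def U_def)
    ultimately show ?thesis using U by blast
  qed
qed

text \<open>
  By \<open>e\<^sup>n \<le> n\<^sup>n\<close> and \<open>n! \<le> n\<^sup>n\<close>, and since the numerical constants are at most \<open>3\<^sup>6\<^sup>6 \<le> n\<^sup>6\<^sup>6\<close>, the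
  reciprocal of \<open>stability_gain n\<close> is at most a power of \<open>n\<close> with exponent \<open>67 + 2 n\<close>, linear in \<open>n\<close>.
\<close>

lemma stability_gain_ge:
  assumes n: "3 \<le> n"
  shows "real n powr (- 100 * real n ^ 3) \<le> stability_gain n"
proof -
  have n1: "1 \<le> real n" "3 \<le> real n" "0 < real n" using n by auto
  have "32 * real n * fact n * exp (real n) * (2000 ^ 8 * 1350) \<le> real n * real n ^ n * real n ^ n * real n ^ 66"
  proof -
    have "exp (real n) = exp 1 ^ n" by (simp flip: exp_of_nat_mult)
    also have "\<dots> \<le> 3 ^ n" using exp_le by (intro power_mono) auto
    also have "\<dots> \<le> real n ^ n" using n1 by (intro power_mono) auto
    finally have e: "exp (real n) \<le> real n ^ n" .
    have f: "fact n \<le> real n ^ n" using fact_le_power[of n, where 'a = real] by simp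
    have "32 * (2000 ^ 8 * 1350) \<le> (3::real) ^ 66" by simp
    also have "\<dots> \<le> real n ^ 66" using n1 by (intro power_mono) auto
    finally have k: "32 * (2000 ^ 8 * 1350) \<le> real n ^ 66" .
    have "real n * fact n * exp (real n) * (32 * (2000 ^ 8 * 1350)) \<le> real n * real n ^ n * real n ^ n * real n ^ 66"
      by (intro mult_mono e f k order_refl mult_nonneg_nonneg) auto
    then show ?thesis by (simp only: mult_ac)
  qed
  also have "real n * real n ^ n * real n ^ n * real n ^ 66 = real n ^ (67 + 2 * n)"
  proof -
    have "67 + 2 * n = 1 + n + n + 66" by simp
    then show ?thesis by (simp only: power_add power_one_right)
  qed
  also have "\<dots> \<le> real n ^ (100 * n ^ 3)"
  proof (rule power_increasing)
    have "n * 1 \<le> n * n\<^sup>2" using n by (intro mult_left_mono) auto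
    then have "n \<le> n ^ 3" by (simp add: power3_eq_cube power2_eq_square)
    then show "67 + 2 * n \<le> 100 * n ^ 3" using n by linarith
  qed (use n1 in simp)
  finally have le: "32 * real n * fact n * exp (real n) * (2000 ^ 8 * 1350) \<le> real n ^ (100 * n ^ 3)" .
  have pos: "0 < 32 * real n * fact n * exp (real n) * (2000 ^ 8 * 1350)" using n1 by simp
  have "real n powr (- 100 * real n ^ 3) = 1 / real n powr (real (100 * n ^ 3))"
    by (simp add: powr_minus_divide)
  also have "\<dots> = 1 / real n ^ (100 * n ^ 3)" using n1 by (subst powr_realpow) auto
  also have "\<dots> \<le> 1 / (32 * real n * fact n * exp (real n) * (2000 ^ 8 * 1350))"
    using pos n1 by (intro divide_left_mono[OF le] mult_pos_pos[OF _ pos]) simp_all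
  also have "\<dots> = stability_gain n"
    by (simp add: stability_gain_def exp_minus power_one_over field_simps)
  finally show ?thesis .
qed

text \<open>
  Rescale to \<open>r = 1\<close>. If the volume bound failed, \<open>K\<close> would lie in a parallelotope with
  \<open>|det U| \<ge> 1 - \<epsilon>/8\<close> and have volume greater than \<open>(1 - \<epsilon>/8) 2\<^sup>n\<close>, which puts its distance to the
  cube below \<open>2 ((1 - \<epsilon>/8)\<^sup>-\<^sup>2 - 1) < \<epsilon>\<close>.
\<close>

theorem volume_stability:
  assumes n: "2 \<le> n" and K: "compact K" "convex K" "K \<subseteq> Espace n" and sym: "\<And>x. x \<in> K \<Longrightarrow> - x \<in> K"
    and r: "r > 0" "Eball n 0 r \<subseteq> K"
    and max: "\<And>E. ellipsoid n E \<Longrightarrow> E \<subseteq> K \<Longrightarrow> vol n E \<le> vol n (Eball n 0 r)"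
    and \<epsilon>: "0 \<le> \<epsilon>" "\<epsilon> < 1" and delta: "\<epsilon> \<le> delta_vol n K (cube n)"
  shows "vol n K / r ^ n \<le> (1 - stability_gain n * \<epsilon>) * 2 ^ n"
proof -
  define L where "L = (\<lambda>x. (1 / r) *\<^sub>R x) ` K"
  have KL: "K = (\<lambda>x. r *\<^sub>R x) ` L" using r by (simp add: L_def image_image)
  have Kb: "K \<in> sets borel" by (rule compact_imp_borel[OF K(1)])
  have memL: "x \<in> L \<longleftrightarrow> r *\<^sub>R x \<in> K" for x
  proof
    assume "r *\<^sub>R x \<in> K"
    then have "(1 / r) *\<^sub>R (r *\<^sub>R x) \<in> L" unfolding L_def by blast
    then show "x \<in> L" using r by simp
  qed (use r in \<open>auto simp: L_def\<close>)
  have L1: "compact L" unfolding L_def by (rule compact_scale_image[OF K(1)])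
  have L2: "convex L"
  proof (rule convexI)
    fix x y :: "nat \<Rightarrow> real" and a b :: real
    assume "x \<in> L" "y \<in> L" and ab: "0 \<le> a" "0 \<le> b" "a + b = 1"
    then have "a *\<^sub>R (r *\<^sub>R x) + b *\<^sub>R (r *\<^sub>R y) \<in> K" using K(2) by (intro convexD) (auto simp: memL)
    then show "a *\<^sub>R x + b *\<^sub>R y \<in> L" by (simp add: memL scaleR_add_right mult.commute)
  qed
  have L3: "L \<subseteq> Espace n" using K(3) by (auto simp: L_def)
  have L4: "Eball n 0 1 \<subseteq> L" using r unfolding Eball_scale[OF r(1)] by (auto simp: memL)
  have Lsym: "- x \<in> L" if "x \<in> L" for x using sym[of "r *\<^sub>R x"] that by (simp add: memL)
  have Lmax: "vol n E \<le> vol n (Eball n 0 1)" if E: "ellipsoid n E" "E \<subseteq> L" for E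
  proof -
    have Ec: "E \<in> sets borel" "E \<subseteq> Espace n" using compact_ellipsoid[OF E(1)] by (auto simp: compact_imp_borel)
    have Bc: "Eball n 0 1 \<in> sets borel" "Eball n 0 1 \<subseteq> Espace n"
      using compact_Eball_0[of 1 n] by (auto simp: compact_imp_borel Eball_0_eq)
    have "(\<lambda>x. r *\<^sub>R x) ` E \<subseteq> K" using E(2) by (auto simp: memL)
    from max[OF ellipsoid_scale[OF E(1) r(1)] this]
    have "r ^ n * vol n E \<le> r ^ n * vol n (Eball n 0 1)"
      unfolding Eball_scale[OF r(1)] vol_scale_image[OF Ec r(1)] vol_scale_image[OF Bc r(1)] .
    then show ?thesis using r by simp
  qed
  have volKL: "vol n K = r ^ n * vol n L"
    unfolding KL by (rule vol_scale_image[OF compact_imp_borel[OF L1] L3 r(1)])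
  have eq: "vol n K / r ^ n = vol n L" using r by (simp add: volKL)
  show ?thesis
  proof (cases "\<epsilon> = 0")
    case True
    have "vol n L \<le> 2 ^ n" by (rule volume_or_parallelotope(1)[OF n L1 L2 L3 L4 Lsym Lmax, of "1/2"]) auto
    then show ?thesis by (simp add: eq True)
  next
    case False
    with \<epsilon> have e0: "0 < \<epsilon>" by simp
    show ?thesis unfolding eq
    proof (rule ccontr)
      assume no: "\<not> vol n L \<le> (1 - stability_gain n * \<epsilon>) * 2 ^ n"
      have "stability_gain n \<le> 1 / 8"
      proof -
        have "stability_gain n = exp (- real n) * ((1 / 2000) ^ 8 / 1350 / (32 * real n * fact n))" by (simp add: stability_gain_def)
        also have "\<dots> \<le> 1 * ((1 / 2000) ^ 8 / 1350 / (32 * real n * fact n))" by (intro mult_right_mono) auto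
        also have "\<dots> \<le> (1 / 8) / 1"
        proof (unfold mult_1, rule frac_le)
          show "(1 / 2000) ^ 8 / 1350 \<le> (1 / 8 :: real)" by (simp add: power_one_over)
          have "1 * 1 \<le> (32 * real n) * fact n" using n by (intro mult_mono) (auto simp: fact_ge_1)
          then show "1 \<le> 32 * real n * fact n" by simp
        qed auto
        finally show ?thesis by simp
      qed
      then have "stability_gain n * \<epsilon> \<le> 1 / 8 * \<epsilon>" using e0 by (intro mult_right_mono) auto
      then have "(1 - \<epsilon> / 8) * 2 ^ n \<le> (1 - stability_gain n * \<epsilon>) * 2 ^ n" by (intro mult_right_mono) auto
      then have vL: "(1 - \<epsilon> / 8) * 2 ^ n < vol n L" using no by linarith
      obtain U where U: "U \<in> carrier_mat n n" "1 - \<epsilon> / 8 \<le> \<bar>Determinant.det U\<bar>"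
        and sub: "\<And>x i. x \<in> L \<Longrightarrow> i < n \<Longrightarrow> \<bar>apply_mat U x i\<bar> \<le> 1"
        using volume_or_parallelotope(2)[OF n L1 L2 L3 L4 Lsym Lmax e0 \<epsilon>(2)] no by blast
      define q where "q = 1 - \<epsilon> / 8"
      have q: "7 / 8 < q" "q < 1" using e0 \<epsilon> by (auto simp: q_def)
      have vLpos: "vol n L > 0"
      proof (rule less_trans[OF _ vL])
        show "0 < (1 - \<epsilon> / 8) * 2 ^ n" using \<epsilon> by (intro mult_pos_pos) simp_all
      qed
      define V where "V = (1 / r) \<cdot>\<^sub>m U"
      have V: "V \<in> carrier_mat n n" using U by (simp add: V_def)
      have detV: "Determinant.det V = (1 / r) ^ n * Determinant.det U" using U by (simp add: V_def)
      have Vap: "apply_mat V x i = apply_mat U ((1 / r) *\<^sub>R x) i" if "i < n" for x i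
        using that U by (simp add: V_def apply_mat_def)
      have "delta_vol n K (cube n) \<le> 2 * (2 ^ n / (\<bar>Determinant.det V\<bar> * vol n K) - 1)"
      proof (rule delta_vol_cube_le[OF _ K(1,3) _ V])
        show "0 < n" using n by simp
        show "0 < vol n K" using vLpos r by (simp add: volKL)
        show "Determinant.det V \<noteq> 0" using U(2) q r by (auto simp: detV q_def[symmetric])
        show "\<bar>apply_mat V x i\<bar> \<le> 1" if "x \<in> K" "i < n" for x i
          unfolding Vap[OF that(2)] using that by (intro sub) (auto simp: L_def)
      qed
      also have "\<bar>Determinant.det V\<bar> * vol n K = \<bar>Determinant.det U\<bar> * vol n L"
        using r by (simp add: detV volKL abs_mult power_one_over)
      also have "2 ^ n / (\<bar>Determinant.det U\<bar> * vol n L) \<le> 2 ^ n / (q * (q * 2 ^ n))"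
        using U(2) vL q vLpos by (intro divide_left_mono mult_mono mult_pos_pos) (auto simp: q_def)
      also have "2 ^ n / (q * (q * 2 ^ n)) = 1 / q\<^sup>2" by (simp add: power2_eq_square)
      finally have "\<epsilon> \<le> 2 * (1 / q\<^sup>2 - 1)" using delta by simp
      moreover have "1 / q\<^sup>2 < 1 + \<epsilon> / 2"
      proof -
        have "1 < (1 + \<epsilon> / 2) * q\<^sup>2"
        proof -
          have "0 < \<epsilon> / 4 * (1 - \<epsilon> * 7 / 16)" using e0 \<epsilon>(2) by simp
          moreover have "0 \<le> \<epsilon> ^ 3 / 128" using e0 by simp
          moreover have "(1 + \<epsilon> / 2) * q\<^sup>2 = 1 + \<epsilon> / 4 * (1 - \<epsilon> * 7 / 16) + \<epsilon> ^ 3 / 128"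
            by (simp add: q_def power2_eq_square power3_eq_cube field_simps)
          ultimately show ?thesis by linarith
        qed
        then show ?thesis using q by (simp add: pos_divide_less_eq)
      qed
      ultimately show False by simp
    qed
  qed
qed

theorem theorem1p1:
  shows "\<exists>c::real. c > 0 \<and>
    (\<forall>(n::nat) (K :: (nat \<Rightarrow> real) set) (\<epsilon>::real).
       n \<ge> 3 \<longrightarrow>
       convex_body n K \<longrightarrow>
       origin_symmetric K \<longrightarrow>
       (\<exists>a \<in> topspace (Euclidean_space n). \<exists>r>0. is_john_ellipsoid n K (Eball n a r)) \<longrightarrow>
       0 \<le> \<epsilon> \<longrightarrow> \<epsilon> < 1 \<longrightarrow>
       delta_vol n K (cube n) \<ge> \<epsilon> \<longrightarrow>
       (let \<gamma> = real n powr (- c * real n ^ 3)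
        in surface_area n K ^ n / vol n K ^ (n - 1)
             \<le> (1 - \<gamma> * \<epsilon> ^ 3) * (surface_area n (cube n) ^ n / vol n (cube n) ^ (n - 1))))"
proof (intro exI[of _ 100] conjI allI impI)
  show "(0::real) < 100" by simp
  fix n :: nat and K :: "(nat \<Rightarrow> real) set" and \<epsilon> :: real
  assume n: "3 \<le> n" and body: "convex_body n K" and osym: "origin_symmetric K"
    and john: "\<exists>a \<in> topspace (Euclidean_space n). \<exists>r>0. is_john_ellipsoid n K (Eball n a r)"
    and \<epsilon>: "0 \<le> \<epsilon>" "\<epsilon> < 1" and delta: "\<epsilon> \<le> delta_vol n K (cube n)"
  have K: "compact K" "convex K" "K \<subseteq> Espace n"
    using body by (auto simp: convex_body_def compactin_Euclidean_space_iff)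
  have sym: "- x \<in> K" if "x \<in> K" for x using osym that unfolding origin_symmetric_def by blast
  obtain a r where a: "a \<in> Espace n" and r: "r > 0" and J: "is_john_ellipsoid n K (Eball n a r)"
    using john by auto
  have sub: "Eball n a r \<subseteq> K" using J by (simp add: is_john_ellipsoid_def)
  \<comment> \<open>By symmetry \<open>K\<close> also contains the ball around \<open>-a\<close>, hence by convexity the one around \<open>0\<close>.\<close>
  have B: "Eball n 0 r \<subseteq> K"
  proof
    fix y assume y: "y \<in> Eball n 0 r"
    then have "- y \<in> Eball n 0 r" using r by (auto simp: Eball_0_eq dot_simps)
    then have "a + y \<in> K" "a + - y \<in> K" using y sub unfolding Eball_translate[OF a] by blast+
    then have "(1/2) *\<^sub>R (a + y) + (1/2) *\<^sub>R (- (a + - y)) \<in> K"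
      using K(2) by (intro convexD sym) auto
    moreover have "(1/2) *\<^sub>R (a + y) + (1/2) *\<^sub>R (- (a + - y)) = y" by (rule ext) (simp add: field_simps)
    ultimately show "y \<in> K" by simp
  qed
  have max: "vol n E \<le> vol n (Eball n 0 r)" if "ellipsoid n E" "E \<subseteq> K" for E
    using J that vol_Eball_translate[OF a, of r] r by (auto simp: is_john_ellipsoid_def)
  have n2: "2 \<le> n" and n0: "0 < n" using n by auto
  have stab: "vol n K / r ^ n \<le> (1 - stability_gain n * \<epsilon>) * 2 ^ n"
    by (rule volume_stability[OF n2 K sym r B max \<epsilon> delta])
  have Vpos: "vol n K > 0"
  proof -
    have c: "compact (Eball n 0 1)" "Eball n 0 1 \<subseteq> Espace n" using compact_Eball_0[of 1 n] by (auto simp: Eball_0_eq)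
    have "0 < r ^ n * vol n (Eball n 0 1)" using Eball_vol_pos[OF n0] r by simp
    also have "\<dots> = vol n (Eball n 0 r)"
      unfolding Eball_scale[OF r] by (rule vol_scale_image[OF compact_imp_borel[OF c(1)] c(2) r, symmetric])
    also have "\<dots> \<le> vol n K"
      using r by (intro vol_mono[OF B _ K(1,3)] compact_imp_borel compact_Eball_0) simp
    finally show ?thesis .
  qed
  let ?\<gamma> = "real n powr (- 100 * real n ^ 3)"
  have g1: "?\<gamma> \<le> stability_gain n" by (rule stability_gain_ge[OF n])
  have g0: "0 \<le> ?\<gamma>" by simp
  \<comment> \<open>The deficit obtained is linear in \<open>\<epsilon>\<close>.\<close>
  have "\<epsilon> ^ 3 \<le> \<epsilon> ^ 1" using \<epsilon> by (intro power_decreasing) auto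
  then have g\<epsilon>: "?\<gamma> * \<epsilon> ^ 3 \<le> stability_gain n * \<epsilon>" using g1 order_trans[OF g0 g1] \<epsilon> by (intro mult_mono) simp_all
  have g3: "?\<gamma> * \<epsilon> ^ 3 \<le> 1"
  proof -
    have "?\<gamma> \<le> real n powr 0" using n by (intro powr_mono) auto
    then have "?\<gamma> * \<epsilon> ^ 3 \<le> 1 * 1" using \<epsilon> n by (intro mult_mono power_le_one) auto
    then show ?thesis by simp
  qed
  have pw: "x ^ n = x ^ (n - 1) * x" for x :: real using n0 by (metis Suc_pred' power_Suc2)
  have "surface_area n K ^ n / vol n K ^ (n - 1) \<le> (real n * vol n K / r) ^ n / vol n K ^ (n - 1)"
    using Vpos surface_area_le[OF n0 K r B] surface_area_nonneg[OF n0 K r B]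
    by (intro divide_right_mono power_mono) auto
  also have "\<dots> = real n ^ n * (vol n K / r ^ n)"
  proof -
    have "(real n * vol n K / r) ^ n = real n ^ n * vol n K ^ n / r ^ n" by (simp add: power_divide power_mult_distrib)
    also have "vol n K ^ n = vol n K ^ (n - 1) * vol n K" by (rule pw)
    finally show ?thesis using Vpos by simp
  qed
  also have "\<dots> \<le> real n ^ n * ((1 - stability_gain n * \<epsilon>) * 2 ^ n)" using stab by (intro mult_left_mono) auto
  also have "\<dots> \<le> real n ^ n * ((1 - ?\<gamma> * \<epsilon> ^ 3) * 2 ^ n)" using g\<epsilon> by (intro mult_left_mono mult_right_mono) auto
  also have "\<dots> = (1 - ?\<gamma> * \<epsilon> ^ 3) * ((real n * 2 ^ n) ^ n / (2 ^ n) ^ (n - 1))"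
  proof -
    have "(real n * 2 ^ n) ^ n / (2 ^ n) ^ (n - 1) = real n ^ n * ((2 ^ n) ^ n / (2 ^ n) ^ (n - 1))" for n :: nat
      by (simp add: power_mult_distrib)
    moreover have "((2::real) ^ n) ^ n = (2 ^ n) ^ (n - 1) * 2 ^ n" by (rule pw)
    ultimately show ?thesis by (simp add: power_mult_distrib)
  qed
  also have "\<dots> \<le> (1 - ?\<gamma> * \<epsilon> ^ 3) * (surface_area n (cube n) ^ n / vol n (cube n) ^ (n - 1))"
    unfolding vol_cube using g3 by (intro mult_left_mono divide_right_mono power_mono surface_area_cube_ge[OF n0]) simp_all
  finally show "let \<gamma> = real n powr (- 100 * real n ^ 3)
        in surface_area n K ^ n / vol n K ^ (n - 1)
             \<le> (1 - \<gamma> * \<epsilon> ^ 3) * (surface_area n (cube n) ^ n / vol n (cube n) ^ (n - 1))"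
    unfolding Let_def .
qed

end
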